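(* Let $\boldsymbol\lambda$ be a partition with at most $N$ parts, $n=|\boldsymbol\lambda|$, let $\tau_{\boldsymbol\lambda}:\mathcal O_{\boldsymbol\lambda}\to\mathcal B_{\boldsymbol\lambda}$ be the graded algebra isomorphism with $\tau_{\boldsymbol\lambda}(F_{ij})=\hat B_{ij}$, and let $v\in\mathcal M_{\boldsymbol\lambda}$ be a nonzero homogeneous vector of degree $\sum_{i=1}^N(i-1)\lambda_i$. Define $\mu_{\boldsymbol\lambda}:\mathcal O_{\boldsymbol\lambda}\to\mathcal M_{\boldsymbol\lambda}$, $F\mapsto\tau_{\boldsymbol\lambda}(F)v$. Then $\mu_{\boldsymbol\lambda}$ is an isomorphism of graded vector spaces of degree $\sum_{i=1}^N(i-1)\lambda_i$, and $\mu_{\boldsymbol\lambda}(FG)=\tau_{\boldsymbol\lambda}(F)\mu_{\boldsymbol\lambda}(G)$ for all $F,G\in\mathcal O_{\boldsymbol\lambda}$. In other words, $\tau_{\boldsymbol\lambda}$ and $\mu_{\boldsymbol\lambda}$ give an isomorphism of the regular representation of $\mathcal O_{\boldsymbol\lambda}$ with the $\mathcal B_{\boldsymbol\lambda}$-module $\mathcal M_{\boldsymbol\lambda}$.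
   Context: $\mathfrak{gl}_N$ has basis $e_{ij}$; singular vectors of weight $\boldsymbol\mu$: $e_{ii}v=\mu_iv$, $e_{ij}v=0$ ($i<j$). $V=\mathbb C^N$. $\mathfrak{gl}_N[t]=\mathfrak{gl}_N\otimes\mathbb C[t]$, $g(u)=\sum_{s\ge0}(g\otimes t^s)u^{-s-1}$; $\operatorname{rdet}A=\sum_\sigma\operatorname{sgn}(\sigma)a_{1\sigma(1)}a_{2\sigma(2)}\cdots$; $\operatorname{rdet}(\delta_{ij}\partial-e_{ji}(u))_{i,j=1}^N=\partial^N+\sum_iB_i(u)\partial^{N-i}$ with $\partial=d/du$ moved to the right, $B_i(u)=\sum_{j\ge1}B_{ij}u^{-j}$; the Bethe algebra $\mathcal B\subset U(\mathfrak{gl}_N[t])$ is generated by the $B_{ij}$. $\mathcal V=V^{\otimes n}\otimes\mathbb C[z_1,\dots,z_n]$ with $g(u)(p\,v_1\otimes\dots\otimes v_n)=p\sum_s\frac{v_1\otimes\dots\otimes gv_s\otimes\dots\otimes v_n}{u-z_s}$ and $S_n$ permuting factors and variables simultaneously; $\mathcal V$ is graded by $\deg z_i=1$; $\mathcal M_{\boldsymbol\lambda}=(\mathcal V^S)^{sing}_{\boldsymbol\lambda}$ (graded subspace of the $S_n$-invariants); $\mathcal B_{\boldsymbol\lambda}$ is the image of $\mathcal B$ in $\operatorname{End}(\mathcal M_{\boldsymbol\lambda})$ and $\hat B_{ij}$ the image of $B_{ij}$. $d_i=\lambda_i+N-i$, $P=\{d_i\}$, $\mathcal O_{\boldsymbol\lambda}=\mathbb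 C[f_{ij}:1\le j\le d_i,\,d_i-j\notin P]$ graded by $\deg f_{ij}=j$, $f_i(u)=u^{d_i}+\sum f_{ij}u^{d_i-j}$, $\operatorname{Wr}(g_1,\dots,g_N)=\det(g_i^{(j-1)})$, and $F_{ij}$ are defined by $\frac1{\operatorname{Wr}(f_1,\dots,f_N)}\operatorname{rdet}\begin{pmatrix}f_1&\dots&f_1^{(N)}\\ \vdots&&\vdots\\ f_N&\dots&f_N^{(N)}\\1&\dots&\partial^N\end{pmatrix}=\partial^N+\sum_iF_i(u)\partial^{N-i}$, $F_i(u)=\sum_{j\ge1}F_{ij}u^{-j}$. (The paper shows the homogeneous component of $\mathcal M_{\boldsymbol\lambda}$ of degree $\sum(i-1)\lambda_i$ is one-dimensional and is the lowest nonzero degree.) *)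

theory Defs
  imports "HOL-Library.Poly_Mapping" "HOL-Computational_Algebra.Polynomial"
          "HOL-Combinatorics.Permutations" "HOL-Library.Product_Lexorder"
begin

type_synonym zpoly = "(nat \<Rightarrow>\<^sub>0 nat) \<Rightarrow>\<^sub>0 complex"

text \<open>An element of V^{\<otimes>n} \<otimes> C[z_1..z_n] is stored as the function sending a word
  w (w s = index of the basis vector of C^N in tensor factor s, 0-based) to its
  polynomial coefficient.\<close>
type_synonym vvec = "(nat \<Rightarrow> nat) \<Rightarrow> zpoly"
type_synonym vop = "vvec \<Rightarrow> vvec"

definition words :: "nat \<Rightarrow> nat \<Rightarrow> (nat \<Rightarrow> nat) set" where
  "words N n = {w. (\<forall>s<n. w s < N) \<and> (\<forall>s\<ge>n. w s = 0)}"

definition zconst :: "complex \<Rightarrow> zpoly" where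
  "zconst c = Poly_Mapping.single 0 c"

definition zvar :: "nat \<Rightarrow> zpoly" where
  "zvar s = Poly_Mapping.single (Poly_Mapping.single s 1) 1"

definition mdeg :: "('a \<Rightarrow>\<^sub>0 nat) \<Rightarrow> nat" where
  "mdeg m = (\<Sum>g\<in>Poly_Mapping.keys m. Poly_Mapping.lookup m g)"

definition VV :: "nat \<Rightarrow> nat \<Rightarrow> vvec set" where
  "VV N n = {x. (\<forall>w. w \<notin> words N n \<longrightarrow> x w = 0) \<and>
                (\<forall>w. \<forall>m\<in>Poly_Mapping.keys (x w). Poly_Mapping.keys m \<subseteq> {..<n})}"

definition vadd :: "vvec \<Rightarrow> vvec \<Rightarrow> vvec" where
  "vadd x y = (\<lambda>w. x w + y w)"

definition vscale :: "complex \<Rightarrow> vvec \<Rightarrow> vvec" where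
  "vscale c x = (\<lambda>w. zconst c * x w)"

definition vhom :: "nat \<Rightarrow> vvec \<Rightarrow> bool" where
  "vhom d x \<longleftrightarrow> (\<forall>w. \<forall>m\<in>Poly_Mapping.keys (x w). mdeg m = d)"

text \<open>E_{ij} acting in tensor factor s (E_{ij} e_k = \<delta>_{jk} e_i).\<close>
definition Eop :: "nat \<Rightarrow> nat \<Rightarrow> nat \<Rightarrow> vop" where
  "Eop s i j x = (\<lambda>w. if w s = i then x (w(s := j)) else 0)"

text \<open>Action of e_{ij} \<otimes> t^k on the module: it is the coefficient of u^{-k-1} in
  \<Sum>_s E^{(s)}_{ij}/(u - z_s), i.e. \<Sum>_s z_s^k E^{(s)}_{ij}.\<close>
definition genop :: "nat \<Rightarrow> nat \<Rightarrow> nat \<Rightarrow> nat \<Rightarrow> vop" where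
  "genop n i j k x = (\<lambda>w. \<Sum>s<n. zvar s ^ k * Eop s i j x w)"

text \<open>S_n action: factor s goes to position \<sigma> s, z_s \<mapsto> z_{\<sigma> s}.  Invariance of x means
  coefficient of monomial m in x(w \<circ> inv \<sigma>) equals coefficient of m \<circ> \<sigma> in x w.\<close>
definition Sn_invariant :: "nat \<Rightarrow> vvec \<Rightarrow> bool" where
  "Sn_invariant n x \<longleftrightarrow>
     (\<forall>\<sigma>. \<sigma> permutes {..<n} \<longrightarrow> (\<forall>w m m'. Poly_Mapping.lookup m' = Poly_Mapping.lookup m \<circ> \<sigma> \<longrightarrow>
        Poly_Mapping.lookup (x (w \<circ> inv \<sigma>)) m = Poly_Mapping.lookup (x w) m'))"

definition singular :: "nat \<Rightarrow> nat \<Rightarrow> (nat \<Rightarrow> nat) \<Rightarrow> vvec \<Rightarrow> bool" where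
  "singular N n lam x \<longleftrightarrow>
     (\<forall>i<N. genop n i i 0 x = vscale (of_nat (lam i)) x) \<and>
     (\<forall>i j. i < j \<and> j < N \<longrightarrow> genop n i j 0 x = (\<lambda>w. 0))"

definition MM :: "nat \<Rightarrow> (nat \<Rightarrow> nat) \<Rightarrow> vvec set" where
  "MM N lam = (let n = (\<Sum>i<N. lam i) in
     {x \<in> VV N n. Sn_invariant n x \<and> singular N n lam x})"

text \<open>Series in u^{-1}: j \<mapsto> coefficient of u^{-j}.  Differential operators in normal
  order (\<partial> on the right): k \<mapsto> series coefficient of \<partial>^k.\<close>
type_synonym vser = "nat \<Rightarrow> vop"
type_synonym vdop = "nat \<Rightarrow> vser"

definition opzero :: vop where "opzero = (\<lambda>x w. 0)"

definition opscale :: "complex \<Rightarrow> vop \<Rightarrow> vop" where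
  "opscale c T = (\<lambda>x. vscale c (T x))"

definition ser_mult :: "vser \<Rightarrow> vser \<Rightarrow> vser" where
  "ser_mult a b j = (\<lambda>x w. \<Sum>p\<le>j. a p (b (j - p) x) w)"

text \<open>m-th derivative in u: d^m/du^m u^{-p} = (-1)^m p(p+1)..(p+m-1) u^{-p-m}.\<close>
definition ser_derivn :: "nat \<Rightarrow> vser \<Rightarrow> vser" where
  "ser_derivn m b j = (if m \<le> j then opscale ((-1)^m * pochhammer (of_nat (j - m)) m) (b (j - m))
                       else opzero)"

text \<open>Product of normally ordered differential operators of \<partial>-order at most K, using
  \<partial>^k b = \<Sum>_m (k choose m) b^{(m)} \<partial>^{k-m}.\<close>
definition dop_mult :: "nat \<Rightarrow> vdop \<Rightarrow> vdop \<Rightarrow> vdop" where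
  "dop_mult K A B r j = (\<lambda>x w. \<Sum>k\<le>K. \<Sum>l\<le>K. \<Sum>m\<le>k.
      if k - m + l = r then
        of_nat (k choose m) * ser_mult (A k) (ser_derivn m (B l)) j x w
      else 0)"

definition dop_one :: vdop where
  "dop_one k j = (if k = 0 \<and> j = 0 then id else opzero)"

text \<open>The entry \<delta>_{ij} \<partial> - e_{ji}(u), e_{ji}(u) = \<Sum>_{s\<ge>0} (e_{ji} \<otimes> t^s) u^{-s-1}.\<close>
definition bethe_entry :: "nat \<Rightarrow> nat \<Rightarrow> nat \<Rightarrow> vdop" where
  "bethe_entry n i j k l =
     (if k = 1 then (if i = j \<and> l = 0 then id else opzero)
      else if k = 0 then (if l \<ge> 1 then opscale (-1) (genop n j i (l - 1)) else opzero)
      else opzero)"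

fun row_prod :: "nat \<Rightarrow> nat \<Rightarrow> (nat \<Rightarrow> nat) \<Rightarrow> nat \<Rightarrow> vdop" where
  "row_prod N n \<sigma> 0 = dop_one"
| "row_prod N n \<sigma> (Suc r) = dop_mult N (row_prod N n \<sigma> r) (bethe_entry n r (\<sigma> r))"

definition bethe_rdet :: "nat \<Rightarrow> nat \<Rightarrow> vdop" where
  "bethe_rdet N n k j = (\<lambda>x w. \<Sum>\<sigma>\<in>{\<sigma>. \<sigma> permutes {..<N}}.
      of_int (sign \<sigma>) * row_prod N n \<sigma> N k j x w)"

definition Bop :: "nat \<Rightarrow> nat \<Rightarrow> nat \<Rightarrow> nat \<Rightarrow> vop" where
  "Bop N n i j = bethe_rdet N n (N - i) j"

definition op_eq_on :: "vvec set \<Rightarrow> vop \<Rightarrow> vop \<Rightarrow> bool" where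
  "op_eq_on M T S \<longleftrightarrow> (\<forall>x\<in>M. T x = S x)"

text \<open>The (unital) algebra generated by the B_{ij}; its restriction to M_\<lambda> is B_\<lambda>.\<close>
inductive_set bethe_alg :: "nat \<Rightarrow> nat \<Rightarrow> vop set" for N n where
  one: "id \<in> bethe_alg N n"
| gen: "1 \<le> i \<Longrightarrow> i \<le> N \<Longrightarrow> 1 \<le> j \<Longrightarrow> Bop N n i j \<in> bethe_alg N n"
| add: "T \<in> bethe_alg N n \<Longrightarrow> S \<in> bethe_alg N n \<Longrightarrow> (\<lambda>x. vadd (T x) (S x)) \<in> bethe_alg N n"
| scale: "T \<in> bethe_alg N n \<Longrightarrow> opscale c T \<in> bethe_alg N n"
| comp: "T \<in> bethe_alg N n \<Longrightarrow> S \<in> bethe_alg N n \<Longrightarrow> T \<circ> S \<in> bethe_alg N n"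

type_synonym opoly = "((nat \<times> nat) \<Rightarrow>\<^sub>0 nat) \<Rightarrow>\<^sub>0 complex"

definition dd :: "nat \<Rightarrow> (nat \<Rightarrow> nat) \<Rightarrow> nat \<Rightarrow> nat" where
  "dd N lam i = lam i + N - 1 - i"

definition Ogens :: "nat \<Rightarrow> (nat \<Rightarrow> nat) \<Rightarrow> (nat \<times> nat) set" where
  "Ogens N lam = {(i, j). i < N \<and> 1 \<le> j \<and> j \<le> dd N lam i \<and>
                          dd N lam i - j \<notin> dd N lam ` {..<N}}"

definition Oalg :: "nat \<Rightarrow> (nat \<Rightarrow> nat) \<Rightarrow> opoly set" where
  "Oalg N lam = {F. \<forall>m\<in>Poly_Mapping.keys F. Poly_Mapping.keys m \<subseteq> Ogens N lam}"

definition oconst :: "complex \<Rightarrow> opoly" where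
  "oconst c = Poly_Mapping.single 0 c"

definition ovar :: "nat \<times> nat \<Rightarrow> opoly" where
  "ovar g = Poly_Mapping.single (Poly_Mapping.single g 1) 1"

definition wdeg :: "((nat \<times> nat) \<Rightarrow>\<^sub>0 nat) \<Rightarrow> nat" where
  "wdeg m = (\<Sum>g\<in>Poly_Mapping.keys m. snd g * Poly_Mapping.lookup m g)"

definition ohom :: "nat \<Rightarrow> opoly \<Rightarrow> bool" where
  "ohom d F \<longleftrightarrow> (\<forall>m\<in>Poly_Mapping.keys F. wdeg m = d)"

definition fpoly :: "nat \<Rightarrow> (nat \<Rightarrow> nat) \<Rightarrow> nat \<Rightarrow> opoly poly" where
  "fpoly N lam i = monom 1 (dd N lam i) +
     (\<Sum>j\<in>{j. (i, j) \<in> Ogens N lam}. monom (ovar (i, j)) (dd N lam i - j))"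

definition wronskian :: "nat \<Rightarrow> (nat \<Rightarrow> opoly poly) \<Rightarrow> opoly poly" where
  "wronskian N g = (\<Sum>\<sigma>\<in>{\<sigma>. \<sigma> permutes {..<N}}.
      of_int (sign \<sigma>) * (\<Prod>i<N. (pderiv ^^ \<sigma> i) (g i)))"

text \<open>rdet of the (N+1)x(N+1) matrix with rows (f_i, f_i', ..., f_i^{(N)}) and last row
  (1, \<partial>, ..., \<partial>^N); since the \<partial>'s occur last in each product, it equals
  \<Sum>_k ocoef k \<partial>^k with the following polynomial coefficients.\<close>
definition ocoef :: "nat \<Rightarrow> (nat \<Rightarrow> opoly poly) \<Rightarrow> nat \<Rightarrow> opoly poly" where
  "ocoef N g k = (\<Sum>\<sigma>\<in>{\<sigma>. \<sigma> permutes {..N} \<and> \<sigma> N = k}.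
      of_int (sign \<sigma>) * (\<Prod>i<N. (pderiv ^^ \<sigma> i) (g i)))"

definition icoeff :: "'a::zero poly \<Rightarrow> int \<Rightarrow> 'a" where
  "icoeff p e = (if e \<ge> 0 then coeff p (nat e) else 0)"

text \<open>Q(u^{-1}) = \<Sum>_{j\<ge>0} Q_j u^{-j} is the expansion at u = \<infinity> of c(u)/W(u):
  c(u) = W(u) Q as formal Laurent series in u^{-1}.\<close>
definition laurent_quot :: "opoly poly \<Rightarrow> opoly poly \<Rightarrow> (nat \<Rightarrow> opoly) \<Rightarrow> bool" where
  "laurent_quot c W Q \<longleftrightarrow> (\<forall>e::int.
      icoeff c e = (\<Sum>j\<in>{j::nat. int j \<le> int (degree W) - e}. icoeff W (e + int j) * Q j))"

definition Fcoef :: "nat \<Rightarrow> (nat \<Rightarrow> nat) \<Rightarrow> nat \<Rightarrow> nat \<Rightarrow> opoly" where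
  "Fcoef N lam i j = (THE Q. laurent_quot (ocoef N (fpoly N lam) (N - i))
                                 (wronskian N (fpoly N lam)) Q) j"

definition is_partition :: "nat \<Rightarrow> (nat \<Rightarrow> nat) \<Rightarrow> bool" where
  "is_partition N lam \<longleftrightarrow> (\<forall>i j. i \<le> j \<longrightarrow> lam j \<le> lam i) \<and> (\<forall>i\<ge>N. lam i = 0)"

end

theory Submission
  imports Defs "Jordan_Normal_Form.Determinant" "HOL-Computational_Algebra.Formal_Power_Series"
begin

text \<open>
  The map \<open>\<mu>\<close> is injective because the Bethe algebra contains, on the module, all multiplications by
  symmetric polynomials: its first series acts by the negated power sums of the \<open>z\<^sub>s\<close>, and monomial
  symmetric sums are polynomials in these. The module is torsion-free, so the image of \<open>\<mu>\<close> contains a copy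
  of the symmetric polynomials in \<open>n\<close> variables, which grows like \<open>D\<^sup>n\<close> with the degree \<open>D\<close>. A
  nonzero kernel would leave only a quotient of a polynomial ring in \<open>n\<close> variables by a nonzero ideal,
  which grows like \<open>D\<^bsup>n-1\<^esup>\<close>.

  Surjectivity is a comparison of Hilbert series. A symmetric tensor is a function on multisets of letters
  \<open>(i, k)\<close>, standing for the basis vector \<open>i\<close> times \<open>z\<^sup>k\<close>. Splitting off the letters with \<open>k = 0\<close> gives a
  branching rule that bounds the singular part for \<open>\<lambda>\<close> by those for the partitions \<open>\<mu>\<close> with \<open>\<lambda>/\<mu>\<close> a
  horizontal strip. The same recursion, now with equality, holds for the shifted Hilbert series of the
  polynomial algebra: written as a product over the \<open>d\<^sub>i\<close> that series is a determinant of Vandermonde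
  type, and the recursion is multilinearity in the rows.
\<close>

text \<open>The row determinant is evaluated only at order \<open>N - 1\<close>; the rest is
  counting. In place of dimensions, both counts rest on one principle: a homogeneous linear system
  with more unknowns than equations has a nontrivial solution. For injectivity the equations are
  monomials of bounded weight, for surjectivity they are evaluation points. The upper bound for
  singular vectors is accordingly a finite set of multisets such that a singular function vanishing
  on it is zero. Branching to \<open>\<mu>\<close> lowers the degree by the size of
  \<open>\<mu>\<close>, because each letter that survives the removal of the degree-zero letters
  loses one power of its variable. This is the origin of the power of q in the recursion for the
  series, and of the induction on degree plus size. An inequality is enough in the branching, since
  injectivity supplies the opposite one: monomials in the generators applied to \<open>v\<close> are
  independent and at least as numerous as the points. Surjectivity therefore depends on
  injectivity.\<close>

lemma homogeneous_system_nontrivial: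
  fixes a :: "'s \<Rightarrow> 'k \<Rightarrow> 'f::field"
  assumes "finite K" "finite S" "card K < card S"
  shows "\<exists>c. (\<exists>s\<in>S. c s \<noteq> 0) \<and> (\<forall>k\<in>K. (\<Sum>s\<in>S. c s * a s k) = 0)"
  using assms
proof (induction K arbitrary: S a rule: finite_induct)
  case empty
  then have "S \<noteq> {}" by auto
  then show ?case by (intro exI[of _ "\<lambda>_. 1"]) auto
next
  case (insert k K)
  show ?case
  proof (cases "\<forall>s\<in>S. a s k = 0")
    case True
    obtain c where "\<exists>s\<in>S. c s \<noteq> 0" "\<forall>k\<in>K. (\<Sum>s\<in>S. c s * a s k) = 0"
      using insert.IH[of S a] insert.prems insert.hyps by auto
    with True show ?thesis by (intro exI[of _ c]) auto
  next
    case False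
    then obtain s0 where s0: "s0 \<in> S" "a s0 k \<noteq> 0" by blast
    define T where "T = S - {s0}"
    have T: "finite T" "s0 \<notin> T" "S = insert s0 T" "card K < card T"
      using insert.prems insert.hyps s0 by (auto simp: T_def)
    \<comment> \<open>Gaussian elimination with pivot \<open>a s0 k\<close>: the modified
      coefficients vanish in equation \<open>k\<close>, so only the equations in \<open>K\<close>
      remain for the unknowns in \<open>T\<close>. The value at \<open>s0\<close> is afterwards the
      one that solves equation \<open>k\<close>.\<close>
    obtain c where c: "\<exists>s\<in>T. c s \<noteq> 0"
      "\<forall>l\<in>K. (\<Sum>s\<in>T. c s * (a s l - a s k / a s0 k * a s0 l)) = 0"
      using insert.IH[of T "\<lambda>s l. a s l - a s k / a s0 k * a s0 l"] T by auto
    define c' where "c' = c(s0 := - (\<Sum>s\<in>T. c s * a s k) / a s0 k)"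
    have c'T: "(\<Sum>s\<in>T. c' s * a s l) = (\<Sum>s\<in>T. c s * a s l)" for l
      by (rule sum.cong) (use T(2) in \<open>auto simp: c'_def\<close>)
    have "(\<Sum>s\<in>S. c' s * a s l) = 0" if l: "l \<in> insert k K" for l
    proof -
      have eq: "(\<Sum>s\<in>S. c' s * a s l) =
          (\<Sum>s\<in>T. c s * a s l) - (\<Sum>s\<in>T. c s * a s k) / a s0 k * a s0 l"
        using T by (simp add: c'T) (simp add: c'_def)
      also have "\<dots> = 0"
      proof (cases "l = k")
        case False
        then have "(\<Sum>s\<in>T. c s * (a s l - a s k / a s0 k * a s0 l)) = 0"
          using c l by blast
        then show ?thesis
          by (simp add: right_diff_distrib sum_subtractf sum_distrib_right sum_divide_distrib mult.assoc)
      qed (use s0 in simp)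
      finally show ?thesis .
    qed
    moreover have "\<exists>s\<in>S. c' s \<noteq> 0"
      using c(1) T(2,3) by (metis c'_def fun_upd_apply insertCI)
    ultimately show ?thesis by blast
  qed
qed

subsection \<open>Letter multisets and raising operators\<close>

text \<open>The action of \<open>e\<^bsub>ij\<^esub>\<close> on a symmetric tensor, in terms of its coefficient function on multisets
  of letters.\<close>

definition mset_op :: "nat \<Rightarrow> nat \<Rightarrow> ((nat \<times> nat) multiset \<Rightarrow> complex) \<Rightarrow> (nat \<times> nat) multiset \<Rightarrow> complex" where
  "mset_op i j c A = (\<Sum>p\<in>#filter_mset (\<lambda>p. fst p = i) A. c (add_mset (j, snd p) (A - {#p#})))"

definition letter_count :: "nat \<Rightarrow> (nat \<times> nat) multiset \<Rightarrow> nat" where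
  "letter_count i A = size (filter_mset (\<lambda>p. fst p = i) A)"

lemma letter_count_simps [simp]:
  "letter_count i {#} = 0"
  "letter_count i (add_mset q A) = (if fst q = i then Suc (letter_count i A) else letter_count i A)"
  "letter_count i (A + B) = letter_count i A + letter_count i B"
  by (auto simp: letter_count_def)

lemma mset_op_empty [simp]: "mset_op i j c {#} = 0"
  by (simp add: mset_op_def)

text \<open>Leibniz rule: the distinguished copy of \<open>q\<close> is either the letter replaced
  or a spectator. Inductions over multisets below run on this recursion, which avoids handling
  multiplicities directly.\<close>

lemma mset_op_add_mset:
  "mset_op i j c (add_mset q B) =
     (if fst q = i then c (add_mset (j, snd q) B) else 0) + mset_op i j (\<lambda>A. c (add_mset q A)) B"
proof -
  have "(\<Sum>p\<in>#filter_mset (\<lambda>p. fst p = i) B. c (add_mset (j, snd p) (add_mset q B - {#p#})))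
      = mset_op i j (\<lambda>A. c (add_mset q A)) B"
    unfolding mset_op_def
  proof (intro arg_cong[of _ _ sum_mset] image_mset_cong)
    fix p assume "p \<in># filter_mset (\<lambda>p. fst p = i) B"
    then have "add_mset q B - {#p#} = add_mset q (B - {#p#})"
      by (cases "p = q") auto
    then show "c (add_mset (j, snd p) (add_mset q B - {#p#})) =
        c (add_mset q (add_mset (j, snd p) (B - {#p#})))"
      by (simp add: add_mset_commute)
  qed
  then show ?thesis
    by (auto simp: mset_op_def[of i j c "add_mset q B"])
qed

lemma mset_op_zero [simp]: "mset_op i j (\<lambda>A. 0) = (\<lambda>A. 0)"
  by (rule ext) (simp add: mset_op_def)

lemma mset_op_add: "mset_op i j (\<lambda>A. c A + c' A) = (\<lambda>A. mset_op i j c A + mset_op i j c' A)"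
  by (rule ext) (simp add: mset_op_def sum_mset.distrib)

lemma mset_op_scale: "mset_op i j (\<lambda>A. k * c A) = (\<lambda>A. k * mset_op i j c A)"
proof
  fix A show "mset_op i j (\<lambda>A. k * c A) A = k * mset_op i j c A"
    by (induction A arbitrary: c) (simp_all add: mset_op_add_mset distrib_left)
qed

lemma mset_op_union:
  "mset_op i j c (X + Y) = mset_op i j (\<lambda>A. c (A + Y)) X + mset_op i j (\<lambda>A. c (X + A)) Y"
  by (induction X arbitrary: c) (simp_all add: mset_op_add_mset)

lemma mset_op_pow_zero [simp]: "(mset_op i j ^^ m) (\<lambda>A. 0) = (\<lambda>A. 0)"
  by (induction m) auto

lemma mset_op_pow_scale: "(mset_op i j ^^ m) (\<lambda>A. k * c A) = (\<lambda>A. k * (mset_op i j ^^ m) c A)"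
  by (induction m) (simp_all add: mset_op_scale)

text \<open>This is \<open>[e_ij, e_ji] = e_ii - e_jj\<close>, where \<open>e_ii\<close> acts
  diagonally on coefficient functions through the number of letters in row \<open>i\<close>.\<close>

lemma mset_op_commutator:
  assumes "i \<noteq> j"
  shows "mset_op i j (mset_op j i c) A = mset_op j i (mset_op i j c) A + (of_nat (letter_count i A) - of_nat (letter_count j A)) * c A"
proof (induction A arbitrary: c)
  case (add q B)
  have 1: "mset_op i j (\<lambda>A. mset_op j i c (add_mset q A)) B =
      (if fst q = j then mset_op i j (\<lambda>A. c (add_mset (i, snd q) A)) B else 0)
       + mset_op i j (mset_op j i (\<lambda>A. c (add_mset q A))) B" for c :: "(nat \<times> nat) multiset \<Rightarrow> complex" and i j
    by (simp add: mset_op_add_mset mset_op_add)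
  show ?case
    using assms add[of "\<lambda>A. c (add_mset q A)"]
    by (cases q) (auto simp: mset_op_add_mset[of _ _ _ q B] 1 mset_op_add_mset[of _ _ _ "(_,_)"] mset_op_add algebra_simps)
qed simp

text \<open>Weights are integers so that they may be lowered past zero; a function of negative
  weight is zero, and that is where the induction on weights stops.\<close>

definition pair_weight :: "nat \<Rightarrow> nat \<Rightarrow> int \<Rightarrow> int \<Rightarrow> ((nat \<times> nat) multiset \<Rightarrow> complex) \<Rightarrow> bool" where
  "pair_weight i j a b c \<longleftrightarrow> (\<forall>A. c A \<noteq> 0 \<longrightarrow> int (letter_count i A) = a \<and> int (letter_count j A) = b)"

lemma mset_op_nonzeroE:
  assumes "mset_op i j c A \<noteq> 0"
  obtains p where "p \<in># A" "fst p = i" "c (add_mset (j, snd p) (A - {#p#})) \<noteq> 0"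
proof -
  have "\<exists>p. p \<in># A \<and> fst p = i \<and> c (add_mset (j, snd p) (A - {#p#})) \<noteq> 0"
  proof (rule ccontr)
    assume "\<not> ?thesis"
    then have "mset_op i j c A = (\<Sum>p\<in>#filter_mset (\<lambda>p. fst p = i) A. 0)"
      unfolding mset_op_def by (intro arg_cong[of _ _ sum_mset] image_mset_cong) auto
    with assms show False by simp
  qed
  with that show ?thesis by blast
qed

lemma letter_count_replace:
  assumes "p \<in># A"
  shows "int (letter_count k (add_mset q (A - {#p#}))) =
     int (letter_count k A) - (if fst p = k then 1 else 0) + (if fst q = k then 1 else 0)"
proof -
  obtain B where "A = add_mset p B" using assms by (metis mset_add)
  then show ?thesis by simp
qed

lemma pair_weight_mset_op:
  assumes "pair_weight i j a b c" "i \<noteq> j"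
  shows "pair_weight i j (a + 1) (b - 1) (mset_op i j c)"
  unfolding pair_weight_def
proof (intro allI impI)
  fix A assume "mset_op i j c A \<noteq> 0"
  then obtain p where "p \<in># A" "fst p = i" "c (add_mset (j, snd p) (A - {#p#})) \<noteq> 0"
    by (rule mset_op_nonzeroE)
  then show "int (letter_count i A) = a + 1 \<and> int (letter_count j A) = b - 1"
    using assms letter_count_replace[of p A i "(j, snd p)"] letter_count_replace[of p A j "(j, snd p)"]
    by (auto simp: pair_weight_def)
qed

lemma pair_weight_swap: "pair_weight i j a b c \<longleftrightarrow> pair_weight j i b a c"
  by (auto simp: pair_weight_def)

lemma pair_weight_mset_op_pow:
  assumes "pair_weight i j a b c" "i \<noteq> j"
  shows "pair_weight i j (a + int m) (b - int m) ((mset_op i j ^^ m) c)"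
proof (induction m)
  case (Suc m)
  from pair_weight_mset_op[OF Suc assms(2)] show ?case by (simp add: algebra_simps)
qed (use assms in simp)

lemma mset_op_commutator_wt:
  assumes "pair_weight i j a b c" "i \<noteq> j"
  shows "mset_op i j (mset_op j i c) A = mset_op j i (mset_op i j c) A + of_int (a - b) * c A"
proof (cases "c A = 0")
  case False
  then have "of_int (a - b) = (of_nat (letter_count i A) - of_nat (letter_count j A) :: complex)"
    using assms(1) False unfolding pair_weight_def by (metis of_int_diff of_int_of_nat_eq)
  with mset_op_commutator[OF assms(2), of c A] show ?thesis by simp
qed (simp add: mset_op_commutator[OF assms(2)])

text \<open>The \<open>sl_2\<close> identity
  \<open>e^(m+1) f = f e^(m+1) + (m+1) e^m (h + m)\<close>, with \<open>h\<close> evaluated as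
  \<open>a - b\<close> on \<open>c\<close>; it sums the weights \<open>a - b + 2k\<close> for
  \<open>k\<close> from 0 to \<open>m\<close>.\<close>

lemma mset_op_pow_commutator:
  assumes "pair_weight i j a b c" "i \<noteq> j"
  shows "(mset_op i j ^^ Suc m) (mset_op j i c) = (\<lambda>A. mset_op j i ((mset_op i j ^^ Suc m) c) A
           + of_int (int (Suc m) * (a - b + int m)) * (mset_op i j ^^ m) c A)"
proof (induction m)
  case 0
  show ?case using mset_op_commutator_wt[OF assms] by (auto simp: fun_eq_iff)
next
  case (Suc m)
  have "(mset_op i j ^^ Suc (Suc m)) (mset_op j i c) = mset_op i j ((mset_op i j ^^ Suc m) (mset_op j i c))" by simp
  also have "\<dots> = (\<lambda>A. mset_op i j (mset_op j i ((mset_op i j ^^ Suc m) c)) A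
           + of_int (int (Suc m) * (a - b + int m)) * (mset_op i j ^^ Suc m) c A)"
    unfolding Suc by (simp add: mset_op_add mset_op_scale)
  also have "\<dots> = (\<lambda>A. mset_op j i ((mset_op i j ^^ Suc (Suc m)) c) A
           + of_int (int (Suc (Suc m)) * (a - b + int (Suc m))) * (mset_op i j ^^ Suc m) c A)"
    by (subst mset_op_commutator_wt[OF pair_weight_mset_op_pow[OF assms] assms(2)]) (simp add: algebra_simps)
  finally show ?case .
qed

text \<open>Injectivity of \<open>e\<^sup>r\<close> on the \<open>sl\<^sub>2\<close>-weight \<open>-r\<close>: an element of its kernel is killed by \<open>f\<close>,
  inductively, hence is a lowest weight vector, on which \<open>e\<^sup>r\<close> does not vanish.\<close>

lemma mset_op_pow_injective:
  assumes "pair_weight i j a b u" "i \<noteq> j" "(mset_op i j ^^ r) u = (\<lambda>A. 0)" "b - a = int r"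
  shows "u = (\<lambda>A. 0)"
  using assms(1,3,4)
proof (induction "nat (a + 1)" arbitrary: u a b r rule: less_induct)
  case less
  show ?case
  proof (cases "a < 0")
    case True
    have "u A = 0" for A
    proof (rule ccontr)
      assume "u A \<noteq> 0"
      then have "int (letter_count i A) = a" using less.prems(1) by (auto simp: pair_weight_def)
      with True show False by simp
    qed
    then show ?thesis by auto
  next
    case False
    have pow: "(mset_op i j ^^ (r + t)) u = (\<lambda>A. 0)" for t
      by (induction t) (use less.prems(2) in auto)
    \<comment> \<open>Applying \<open>f\<close> lowers the first weight, which drives the induction,
      and widens the gap to \<open>r + 2\<close>. The commutator expresses
      \<open>e^(r+2) f u\<close> through \<open>e^(r+2) u\<close> and \<open>e^(r+1) u\<close>,
      which both vanish.\<close>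
    have "pair_weight i j (a - 1) (b + 1) (mset_op j i u)"
      using pair_weight_mset_op[of j i b a u] less.prems(1) assms(2) by (simp add: pair_weight_swap[of i j])
    moreover have "(mset_op i j ^^ (r + 2)) (mset_op j i u) = (\<lambda>A. 0)"
      using mset_op_pow_commutator[OF less.prems(1) assms(2), of "Suc r"] pow[of 1] pow[of 2] by simp
    ultimately have fu: "mset_op j i u = (\<lambda>A. 0)"
      by (rule less.hyps[rotated]) (use False less.prems(3) in auto)
    \<comment> \<open>Once \<open>f u = 0\<close>, the commutator reads
      \<open>(m+1) (a - b + m) e^m u = 0\<close>. Since \<open>a - b = -r\<close>, the scalar is
      nonzero for \<open>m < r\<close>, so the vanishing power descends from \<open>r\<close> to
      0.\<close>
    have "(mset_op i j ^^ (r - k)) u = (\<lambda>A. 0)" if "k \<le> r" for k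
      using that
    proof (induction k)
      case 0
      show ?case using less.prems(2) by simp
    next
      case (Suc k)
      define m where "m = r - Suc k"
      have m: "r - k = Suc m" "m < r" using Suc.prems by (auto simp: m_def)
      have z: "(mset_op i j ^^ Suc m) u = (\<lambda>A. 0)" using Suc m by simp
      have "of_int (int (Suc m) * (a - b + int m)) * (mset_op i j ^^ m) u A = 0" for A
        using fun_cong[OF mset_op_pow_commutator[OF less.prems(1) assms(2), of m], of A]
        unfolding fu z by (simp only: mset_op_zero mset_op_pow_zero add_0_left)
      moreover have "of_int (int (Suc m) * (a - b + int m)) \<noteq> (0 :: complex)"
        using m less.prems(3) by (subst of_int_eq_0_iff) auto
      ultimately have "(mset_op i j ^^ m) u A = 0" for A
        by (meson mult_eq_0_iff)
      then show ?case unfolding m_def[symmetric] by (simp add: fun_eq_iff)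
    qed
    from this[of r] show ?thesis by simp
  qed
qed

section \<open>Branching by degree-zero letters\<close>

definition zero_part :: "nat \<Rightarrow> (nat \<Rightarrow> nat) \<Rightarrow> (nat \<times> nat) multiset" where
  "zero_part N \<beta> = (\<Sum>i<N. replicate_mset (\<beta> i) (i, 0))"

definition shift_up :: "(nat \<times> nat) multiset \<Rightarrow> (nat \<times> nat) multiset" where
  "shift_up = image_mset (map_prod id Suc)"

definition msdeg :: "(nat \<times> nat) multiset \<Rightarrow> nat" where
  "msdeg A = (\<Sum>p\<in>#A. snd p)"

lemma msdeg_simps [simp]:
  "msdeg {#} = 0" "msdeg (add_mset p A) = snd p + msdeg A" "msdeg (A + B) = msdeg A + msdeg B"
  by (simp_all add: msdeg_def)

lemma shift_up_simps [simp]: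
  "shift_up {#} = {#}" "shift_up (add_mset p A) = add_mset (fst p, Suc (snd p)) (shift_up A)"
  by (cases p; simp add: shift_up_def)+

lemma letter_count_shift_up [simp]: "letter_count i (shift_up A) = letter_count i A"
  by (induction A) auto

lemma msdeg_shift_up [simp]: "msdeg (shift_up A) = msdeg A + size A"
  by (induction A) auto

lemma fst_shift_up: "fst ` set_mset (shift_up A) = fst ` set_mset A"
  by (induction A) auto

lemma mset_op_shift_up: "mset_op i j c (shift_up A) = mset_op i j (\<lambda>A. c (shift_up A)) A"
  by (induction A arbitrary: c) (simp_all add: mset_op_add_mset)

lemma size_eq_sum_letter_count:
  assumes "fst ` set_mset A \<subseteq> {..<N}"
  shows "size A = (\<Sum>i<N. letter_count i A)"
  using assms
proof (induction A)
  case (add p A)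
  have "(\<Sum>i<N. letter_count i (add_mset p A)) = (\<Sum>i<N. letter_count i A + (if fst p = i then 1 else 0))"
    by (intro sum.cong) auto
  also have "\<dots> = Suc (\<Sum>i<N. letter_count i A)"
    using add.prems by (simp add: sum.distrib)
  finally show ?case using add by simp
qed simp

lemma count_zero_part: "count (zero_part N \<beta>) p = (if fst p < N \<and> snd p = 0 then \<beta> (fst p) else 0)"
proof -
  have "count (zero_part N \<beta>) p = (\<Sum>i<N. if (i, 0) = p then \<beta> i else 0)"
    unfolding zero_part_def count_sum by (intro sum.cong) auto
  also have "\<dots> = (\<Sum>i<N. if i = fst p then (if snd p = 0 then \<beta> (fst p) else 0) else 0)"
    by (intro sum.cong) (auto simp: prod_eq_iff)
  finally show ?thesis by (cases "snd p = 0") simp_all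
qed

lemma filter_zero_part: "filter_mset (\<lambda>p. fst p = i) (zero_part N \<beta>) = (if i < N then replicate_mset (\<beta> i) (i, 0) else {#})"
  by (rule multiset_eqI) (auto simp: count_zero_part prod_eq_iff)

lemma letter_count_zero_part [simp]: "letter_count i (zero_part N \<beta>) = (if i < N then \<beta> i else 0)"
  by (simp add: letter_count_def filter_zero_part)

lemma msdeg_zero_part [simp]: "msdeg (zero_part N \<beta>) = 0"
proof -
  have "snd p = 0" if "p \<in># zero_part N \<beta>" for p
    using that by (metis count_zero_part count_eq_zero_iff)
  then show ?thesis by (simp add: msdeg_def)
qed

lemma zero_part_Suc: "i < N \<Longrightarrow> add_mset (i, 0) (zero_part N \<beta>) = zero_part N (\<beta>(i := Suc (\<beta> i)))"
  by (rule multiset_eqI) (auto simp: count_zero_part)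

text \<open>All \<open>\<beta> i\<close> copies of \<open>(i, 0)\<close> contribute the same term.
  The factor also makes the truncated \<open>\<beta> i - 1\<close> harmless when
  \<open>\<beta> i = 0\<close>.\<close>

lemma mset_op_zero_part:
  assumes "i < N" "j < N" "i \<noteq> j"
  shows "mset_op i j c (zero_part N \<beta>) =
    of_nat (\<beta> i) * c (zero_part N (\<beta>(i := \<beta> i - 1, j := Suc (\<beta> j))))"
proof (cases "\<beta> i")
  case 0
  then show ?thesis using assms by (simp add: mset_op_def filter_zero_part)
next
  case (Suc b)
  have "add_mset (j, 0) (zero_part N \<beta> - {#(i, 0)#}) = zero_part N (\<beta>(i := \<beta> i - 1, j := Suc (\<beta> j)))"
    using assms by (intro multiset_eqI) (auto simp: count_zero_part)
  then show ?thesis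
    using assms by (simp add: mset_op_def filter_zero_part)
qed

lemma zero_part_shift_up_cases:
  assumes "fst ` set_mset A \<subseteq> {..<N}"
  shows "\<exists>\<beta> B. (\<forall>i\<ge>N. \<beta> i = 0) \<and> A = zero_part N \<beta> + shift_up B"
  using assms
proof (induction A)
  case empty
  show ?case by (intro exI[of _ "\<lambda>_. 0"] exI[of _ "{#}"]) (simp add: zero_part_def)
next
  case (add p A)
  then obtain \<beta> B where *: "\<forall>i\<ge>N. \<beta> i = 0" "A = zero_part N \<beta> + shift_up B" by auto
  obtain i k where p: "p = (i, k)" "i < N" using add.prems by (cases p) auto
  show ?case
  proof (cases k)
    case 0
    have "add_mset p A = zero_part N (\<beta>(i := Suc (\<beta> i))) + shift_up B"
      using zero_part_Suc[OF p(2), of \<beta>] *(2) p(1) 0 by simp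
    moreover have "\<forall>j\<ge>N. (\<beta>(i := Suc (\<beta> i))) j = 0" using * p by simp
    ultimately show ?thesis by blast
  next
    case (Suc l)
    with * p show ?thesis
      by (intro exI[of _ \<beta>] exI[of _ "add_mset (i, l) B"]) auto
  qed
qed

text \<open>The first summand couples the slice \<open>\<beta>\<close> to the slice with one
  degree-zero letter moved from row \<open>i\<close> to row \<open>j\<close>; the second acts inside
  the slice. For singular \<open>c\<close> the sum is zero, so the operator on a slice is a multiple
  of a neighbouring slice.\<close>

lemma mset_op_slice:
  assumes "i < N" "j < N" "i \<noteq> j"
  shows "mset_op i j c (zero_part N \<beta> + shift_up A) =
     of_nat (\<beta> i) * c (zero_part N (\<beta>(i := \<beta> i - 1, j := Suc (\<beta> j))) + shift_up A)
     + mset_op i j (\<lambda>A. c (zero_part N \<beta> + shift_up A)) A"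
  by (simp add: mset_op_union mset_op_zero_part[OF assms] mset_op_shift_up)

text \<open>Weight and degree are support conditions. Only the simple raising operators are imposed,
  which keeps the branching argument local to two adjacent rows.\<close>

definition sing_funs :: "nat \<Rightarrow> (nat \<Rightarrow> nat) \<Rightarrow> nat \<Rightarrow> ((nat \<times> nat) multiset \<Rightarrow> complex) set" where
  "sing_funs N lam d = {c.
     (\<forall>A. c A \<noteq> 0 \<longrightarrow> fst ` set_mset A \<subseteq> {..<N} \<and> (\<forall>i<N. letter_count i A = lam i) \<and> msdeg A = d) \<and>
     (\<forall>i. Suc i < N \<longrightarrow> mset_op i (Suc i) c = (\<lambda>A. 0))}"

text \<open>Sorting the coefficients of \<open>c\<close> by the letters \<open>(i, 0)\<close> of degree zero writes \<open>c\<close> as a family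
  of slices; the slice with all degree-zero letters pushed as far down as possible is again singular.\<close>

lemma sing_funs_branch:
  assumes c: "c \<in> sing_funs N lam d" and nz: "c \<noteq> (\<lambda>A. 0)"
  shows "\<exists>\<mu>. (\<forall>i<N. \<mu> i \<le> lam i) \<and> (\<forall>i. Suc i < N \<longrightarrow> lam (Suc i) \<le> \<mu> i) \<and> (\<forall>i\<ge>N. \<mu> i = 0) \<and>
     (\<Sum>i<N. \<mu> i) \<le> d \<and>
     (\<lambda>A. c (zero_part N (\<lambda>i. lam i - \<mu> i) + shift_up A)) \<in> sing_funs N \<mu> (d - (\<Sum>i<N. \<mu> i)) \<and>
     (\<lambda>A. c (zero_part N (\<lambda>i. lam i - \<mu> i) + shift_up A)) \<noteq> (\<lambda>A. 0)"
proof -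
  define sl where "sl \<beta> = (\<lambda>A. c (zero_part N \<beta> + shift_up A))" for \<beta>
  have supp: "fst ` set_mset A \<subseteq> {..<N} \<and> (\<forall>i<N. letter_count i A = lam i) \<and> msdeg A = d" if "c A \<noteq> 0" for A
    using c that by (auto simp: sing_funs_def)
  have e0: "mset_op i (Suc i) c A = 0" if "Suc i < N" for i A
    using c that by (auto simp: sing_funs_def)
  \<comment> \<open>Moving a degree-zero letter from row \<open>i\<close> to row
    \<open>i + 1\<close> lowers \<open>\<psi>\<close> by one. At a nonzero slice of least
    \<open>\<psi>\<close> the neighbours reached in this way vanish, so that slice is
    singular.\<close>
  define \<psi> where "\<psi> \<beta> = (\<Sum>i<N. (N - i) * \<beta> i)" for \<beta> :: "nat \<Rightarrow> nat"
  obtain A0 where "c A0 \<noteq> 0" using nz by auto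
  with zero_part_shift_up_cases[of A0 N] supp obtain \<beta>0 B0 where "A0 = zero_part N \<beta>0 + shift_up B0" by blast
  then have "sl \<beta>0 \<noteq> (\<lambda>A. 0)" using \<open>c A0 \<noteq> 0\<close> by (auto simp: sl_def fun_eq_iff)
  then obtain \<beta> where \<beta>: "sl \<beta> \<noteq> (\<lambda>A. 0)" and \<beta>_min: "\<And>\<gamma>. sl \<gamma> \<noteq> (\<lambda>A. 0) \<Longrightarrow> \<psi> \<beta> \<le> \<psi> \<gamma>"
    using ex_has_least_nat[of "\<lambda>\<beta>. sl \<beta> \<noteq> (\<lambda>A. 0)" \<beta>0 \<psi>] by blast
  have sl_supp: "fst ` set_mset A \<subseteq> {..<N} \<and> (\<forall>i<N. \<gamma> i + letter_count i A = lam i) \<and> msdeg A + size A = d"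
    if "sl \<gamma> A \<noteq> 0" for \<gamma> A
    using supp[of "zero_part N \<gamma> + shift_up A"] that fst_shift_up[of A] by (auto simp: sl_def image_Un)
  have sl_e: "mset_op i (Suc i) (sl \<gamma>) A =
      - of_nat (\<gamma> i) * sl (\<gamma>(i := \<gamma> i - 1, Suc i := Suc (\<gamma> (Suc i)))) A"
    if "Suc i < N" for \<gamma> i A
    using mset_op_slice[of i N "Suc i" c \<gamma> A] e0[OF that] that
    by (simp add: sl_def add_eq_0_iff)
  have \<psi>_less: "\<psi> (\<gamma>(i := \<gamma> i - 1, Suc i := Suc (\<gamma> (Suc i)))) < \<psi> \<gamma>" if i: "Suc i < N" "\<gamma> i > 0" for \<gamma> i
  proof -
    define \<gamma>' where "\<gamma>' = \<gamma>(i := \<gamma> i - 1, Suc i := Suc (\<gamma> (Suc i)))"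
    have split: "(\<Sum>k<N. f k) = f i + f (Suc i) + (\<Sum>k\<in>{..<N} - {i, Suc i}. f k)" for f :: "nat \<Rightarrow> nat"
      using that by (simp add: sum.remove[of _ i] sum.remove[of _ "Suc i"] Diff_insert2[symmetric] insert_commute)
    have "(\<Sum>k\<in>{..<N} - {i, Suc i}. (N - k) * \<gamma>' k) = (\<Sum>k\<in>{..<N} - {i, Suc i}. (N - k) * \<gamma> k)"
      by (intro sum.cong) (auto simp: \<gamma>'_def)
    moreover obtain g where "\<gamma> i = Suc g" using i by (cases "\<gamma> i") auto
    moreover obtain r where "N - i = Suc r" "N - Suc i = r" using i by (metis Suc_diff_Suc Suc_lessD)
    ultimately show ?thesis unfolding \<gamma>'_def[symmetric] \<psi>_def split
      by (simp add: \<gamma>'_def)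
  qed
  have sing: "mset_op i (Suc i) (sl \<beta>) = (\<lambda>A. 0)" if "Suc i < N" for i
  proof (cases "\<beta> i = 0")
    case False
    then have "sl (\<beta>(i := \<beta> i - 1, Suc i := Suc (\<beta> (Suc i)))) = (\<lambda>A. 0)"
      using \<psi>_less[of i \<beta>] \<beta>_min that by (meson linorder_not_le neq0_conv)
    then show ?thesis using sl_e[OF that, of \<beta>] by (simp add: fun_eq_iff)
  qed (use sl_e[OF that, of \<beta>] in \<open>simp add: fun_eq_iff\<close>)
  have bound: "\<beta> i + lam (Suc i) \<le> lam i" if i: "Suc i < N" for i
  proof (rule ccontr)
    assume neg: "\<not> ?thesis"
    define t where "t = \<beta> (Suc i)"
    \<comment> \<open>These slices undo the minimal choice along one line: \<open>s\<close>
      degree-zero letters return from row \<open>i + 1\<close> to row \<open>i\<close>, until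
      \<open>u t\<close> has none left in row \<open>i + 1\<close>. Raising sends
      \<open>u (Suc s)\<close> to a nonzero multiple of \<open>u s\<close> and kills
      \<open>u 0\<close>, so \<open>Suc s\<close> raisings kill \<open>u s\<close>; conversely,
      \<open>u t = 0\<close> would propagate down to \<open>u 0 = 0\<close>.\<close>
    define u where "u s = sl (\<beta>(i := \<beta> i + s, Suc i := t - s))" for s
    have u0: "u 0 = sl \<beta>" by (simp add: u_def t_def)
    have e_u: "mset_op i (Suc i) (u (Suc s)) = (\<lambda>A. - of_nat (\<beta> i + Suc s) * u s A)" if "Suc s \<le> t" for s
    proof -
      have "(\<beta>(i := \<beta> i + Suc s, Suc i := t - Suc s))(i := (\<beta>(i := \<beta> i + Suc s, Suc i := t - Suc s)) i - 1,
          Suc i := Suc ((\<beta>(i := \<beta> i + Suc s, Suc i := t - Suc s)) (Suc i)))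
         = \<beta>(i := \<beta> i + s, Suc i := t - s)"
        using that by (auto simp: fun_eq_iff)
      from sl_e[OF i, of "\<beta>(i := \<beta> i + Suc s, Suc i := t - Suc s)", unfolded this]
      show ?thesis by (auto simp: u_def fun_eq_iff)
    qed
    have "(mset_op i (Suc i) ^^ Suc s) (u s) = (\<lambda>A. 0)" if "s \<le> t" for s
      using that
    proof (induction s)
      case 0
      show ?case using sing[OF i] by (simp add: u0)
    next
      case (Suc s)
      have "(mset_op i (Suc i) ^^ Suc (Suc s)) (u (Suc s)) = (mset_op i (Suc i) ^^ Suc s) (mset_op i (Suc i) (u (Suc s)))"
        by (simp only: funpow_Suc_right o_apply)
      also have "\<dots> = (\<lambda>A. - of_nat (\<beta> i + Suc s) * (mset_op i (Suc i) ^^ Suc s) (u s) A)"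
        unfolding e_u[OF Suc.prems] by (rule mset_op_pow_scale)
      finally show ?case using Suc by (simp add: fun_eq_iff)
    qed
    then have ker: "(mset_op i (Suc i) ^^ Suc t) (u t) = (\<lambda>A. 0)" by blast
    have ker': "(mset_op i (Suc i) ^^ (Suc t + k)) (u t) = (\<lambda>A. 0)" for k
      by (induction k) (use ker in auto)
    \<comment> \<open>\<open>Suc t + r\<close> is exactly the gap between the weights of
      \<open>u t\<close> in rows \<open>i + 1\<close> and \<open>i\<close>, as
      \<open>mset_op_pow_injective\<close> requires. The negated bound says that this gap is at
      least \<open>Suc t\<close>, so the subtraction is not truncated.\<close>
    define r where "r = \<beta> i + t + lam (Suc i) - lam i - Suc t"
    have r: "int (lam (Suc i)) - (int (lam i) - int (\<beta> i + t)) = int (Suc t + r)"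
      using neg by (simp add: r_def)
    have "pair_weight i (Suc i) (int (lam i) - int (\<beta> i + t)) (int (lam (Suc i))) (u t)"
      unfolding pair_weight_def u_def
    proof (intro allI impI)
      fix A assume A: "sl (\<beta>(i := \<beta> i + t, Suc i := t - t)) A \<noteq> 0"
      have *: "\<forall>k<N. (\<beta>(i := \<beta> i + t, Suc i := t - t)) k + letter_count k A = lam k"
        using sl_supp[OF A] by blast
      have "\<beta> i + t + letter_count i A = lam i" "letter_count (Suc i) A = lam (Suc i)"
        using *[rule_format, of i] *[rule_format, of "Suc i"] i by auto
      then show "int (letter_count i A) = int (lam i) - int (\<beta> i + t) \<and> int (letter_count (Suc i) A) = int (lam (Suc i))"
        by simp
    qed
    then have ut: "u t = (\<lambda>A. 0)"
      by (rule mset_op_pow_injective[OF _ _ ker'[of r]]) (use r in auto)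
    have step: "u s = (\<lambda>A. 0)" if "u (Suc s) = (\<lambda>A. 0)" "Suc s \<le> t" for s
    proof -
      have "0 = - of_nat (\<beta> i + Suc s) * u s A" for A
        using fun_cong[OF e_u[OF that(2)], of A] by (simp only: that(1) mset_op_zero)
      moreover have "- of_nat (\<beta> i + Suc s) \<noteq> (0 :: complex)"
        by (subst neg_equal_0_iff_equal, subst of_nat_eq_0_iff) auto
      ultimately show ?thesis by (metis mult_eq_0_iff)
    qed
    have "u (t - k) = (\<lambda>A. 0)" if "k \<le> t" for k
      using that
    proof (induction k)
      case (Suc k)
      have "Suc (t - Suc k) = t - k" using Suc.prems by auto
      with Suc.IH Suc.prems have "u (Suc (t - Suc k)) = (\<lambda>A. 0)" by (simp only: Suc_leD)
      then show ?case by (rule step) (use Suc.prems in simp)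
    qed (use ut in simp)
    from this[of t] have "u 0 = (\<lambda>A. 0)" by simp
    with u0 \<beta> show False by simp
  qed
  obtain A1 where A1: "sl \<beta> A1 \<noteq> 0" using \<beta> by auto
  define \<mu> where "\<mu> = (\<lambda>i. if i < N then lam i - \<beta> i else 0)"
  have \<beta>_le: "\<beta> i \<le> lam i" if "i < N" for i using sl_supp[OF A1] that by (metis le_add1)
  have zeq: "zero_part N (\<lambda>i. lam i - \<mu> i) = zero_part N \<beta>"
    using \<beta>_le by (intro multiset_eqI) (auto simp: count_zero_part \<mu>_def)
  have sl_supp': "fst ` set_mset A \<subseteq> {..<N} \<and> (\<forall>i<N. letter_count i A = \<mu> i) \<and> msdeg A + (\<Sum>i<N. \<mu> i) = d"
    if "sl \<beta> A \<noteq> 0" for A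
  proof -
    have 1: "\<forall>i<N. letter_count i A = \<mu> i" using sl_supp[OF that] by (auto simp: \<mu>_def)
    then have "size A = (\<Sum>i<N. \<mu> i)" using size_eq_sum_letter_count[of A N] sl_supp[OF that] by simp
    with 1 sl_supp[OF that] show ?thesis by simp
  qed
  have "sl \<beta> \<in> sing_funs N \<mu> (d - (\<Sum>i<N. \<mu> i))"
    unfolding sing_funs_def mem_Collect_eq
  proof (intro conjI allI impI)
    fix A assume A: "sl \<beta> A \<noteq> 0"
    show "fst ` set_mset A \<subseteq> {..<N}" "msdeg A = d - (\<Sum>i<N. \<mu> i)" using sl_supp'[OF A] by auto
    show "letter_count i A = \<mu> i" if "i < N" for i using sl_supp'[OF A] that by simp
  qed (use sing in simp)
  moreover have "lam (Suc i) \<le> \<mu> i" if "Suc i < N" for i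
    using bound[OF that] that by (simp add: \<mu>_def)
  moreover have "(\<Sum>i<N. \<mu> i) \<le> d" using sl_supp'[OF A1] by simp
  moreover have "\<forall>i<N. \<mu> i \<le> lam i" "\<forall>i\<ge>N. \<mu> i = 0" by (simp_all add: \<mu>_def)
  ultimately show ?thesis
    using \<beta> by (intro exI[of _ \<mu>]) (simp add: zeq sl_def)
qed

subsection \<open>A determinantal recursion for Hilbert series\<close>

definition fdet :: "nat \<Rightarrow> (nat \<Rightarrow> nat \<Rightarrow> 'a) \<Rightarrow> 'a::comm_ring_1" where
  "fdet N f = det (mat N N (\<lambda>(i, j). f i j))"

lemma fdet_leibniz: "fdet N f = (\<Sum>p | p permutes {..<N}. of_int (sign p) * (\<Prod>i<N. f i (p i)))"
  unfolding fdet_def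
  by (subst det_def'[of _ N]) (auto simp: lessThan_atLeast0 permutes_in_image intro!: sum.cong prod.cong arg_cong2[of _ _ _ _ "(*)"])

lemma fdet_cong:
  assumes "\<And>i j. i < N \<Longrightarrow> j < N \<Longrightarrow> f i j = g i j"
  shows "fdet N f = fdet N g"
  unfolding fdet_def by (intro arg_cong[of _ _ det] cong_mat) (use assms in auto)

lemma fdet_rows_sum:
  assumes "\<And>i. i < N \<Longrightarrow> finite (S i)"
  shows "fdet N (\<lambda>i j. \<Sum>m\<in>S i. g m j) = (\<Sum>m\<in>PiE {..<N} S. fdet N (\<lambda>i. g (m i)))"
proof -
  have "fdet N (\<lambda>i j. \<Sum>m\<in>S i. g m j) =
      (\<Sum>p | p permutes {..<N}. \<Sum>m\<in>PiE {..<N} S. of_int (sign p) * (\<Prod>i<N. g (m i) (p i)))"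
    unfolding fdet_leibniz
    by (intro sum.cong refl, subst prod_sum_PiE) (use assms in \<open>auto simp: sum_distrib_left\<close>)
  also have "\<dots> = (\<Sum>m\<in>PiE {..<N} S. fdet N (\<lambda>i. g (m i)))"
    unfolding fdet_leibniz by (rule sum.swap)
  finally show ?thesis .
qed

lemma fdet_scale_rows: "fdet N (\<lambda>i j. r i * g i j) = (\<Prod>i<N. r i) * fdet N g"
  unfolding fdet_leibniz by (simp add: prod.distrib sum_distrib_left mult_ac)

lemma fdet_scale_cols: "fdet N (\<lambda>i j. r j * g i j) = (\<Prod>i<N. r i) * fdet N g"
proof -
  have "(\<Prod>i<N. r (p i)) = (\<Prod>i<N. r i)" if "p permutes {..<N}" for p
    using prod.permute[OF that, of r] by (simp add: o_def)
  then show ?thesis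
    unfolding fdet_leibniz by (simp add: prod.distrib sum_distrib_left mult_ac)
qed

lemma fdet_mult: "fdet N (\<lambda>i j. \<Sum>k<N. f i k * g k j) = fdet N f * fdet N g"
proof -
  have "mat N N (\<lambda>(i, j). \<Sum>k<N. f i k * g k j) = mat N N (\<lambda>(i, j). f i j) * mat N N (\<lambda>(i, j). g i j)"
    by (rule eq_matI) (auto simp: scalar_prod_def lessThan_atLeast0)
  then show ?thesis unfolding fdet_def by (simp add: det_mult[of _ N])
qed

lemma prod_list_diag_mat: "prod_list (diag_mat (mat N N (\<lambda>(i, j). f i j))) = (\<Prod>i<N. f i i)"
  by (simp add: prod_list_diag_prod lessThan_atLeast0)

lemma fdet_upper_triangular:
  assumes "\<And>i j. j < i \<Longrightarrow> i < N \<Longrightarrow> f i j = 0"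
  shows "fdet N f = (\<Prod>i<N. f i i)"
  unfolding fdet_def prod_list_diag_mat[symmetric]
  by (rule det_upper_triangular[of _ N]) (use assms in \<open>auto simp: upper_triangular_def\<close>)

lemma fdet_lower_triangular:
  assumes "\<And>i j. i < j \<Longrightarrow> j < N \<Longrightarrow> f i j = 0"
  shows "fdet N f = (\<Prod>i<N. f i i)"
  unfolding fdet_def prod_list_diag_mat[symmetric]
  by (rule det_lower_triangular[of N]) (use assms in auto)

text \<open>Left multiplication by the unitriangular matrix with entries -1 just above the
  diagonal.\<close>

lemma fdet_row_differences:
  "fdet N (\<lambda>i j. if Suc i < N then f i j - f (Suc i) j else f i j) = fdet N f"
proof -
  define L where "L = (\<lambda>i k. if k = i then 1 else if k = Suc i then - 1 else 0 :: 'a)"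
  have "fdet N L = 1"
    by (subst fdet_upper_triangular) (auto simp: L_def)
  moreover have "(\<Sum>k<N. L i k * f k j) = (if Suc i < N then f i j - f (Suc i) j else f i j)"
    if "i < N" for i j
  proof -
    have "(\<Sum>k<N. L i k * f k j) = (\<Sum>k<N. (if k = i then f i j else 0) + (if k = Suc i then - f (Suc i) j else 0))"
      by (intro sum.cong) (auto simp: L_def)
    then show ?thesis using that by (simp add: sum.distrib)
  qed
  ultimately show ?thesis
    using fdet_mult[of N L f] by (simp cong: fdet_cong)
qed

text \<open>Induction via \<open>y c - X = (y c - x k) - (X - x k)\<close>: the first term stays in
  degree \<open>k\<close>, the second moves to degree \<open>k + 1\<close>. The coefficients do not
  depend on \<open>X\<close>, as the matrix factorization requires, and only the leading one is
  needed explicitly.\<close>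

lemma newton_basis_expansion:
  fixes x y :: "nat \<Rightarrow> 'a::comm_ring_1"
  shows "\<exists>b. b c = (-1) ^ c \<and> (\<forall>X. (\<Prod>t<c. y t - X) = (\<Sum>k\<le>c. (\<Prod>t<k. X - x t) * b k))"
proof (induction c)
  case 0
  show ?case by (intro exI[of _ "\<lambda>_. 1"]) simp
next
  case (Suc c)
  then obtain b where b: "b c = (-1) ^ c" "\<And>X. (\<Prod>t<c. y t - X) = (\<Sum>k\<le>c. (\<Prod>t<k. X - x t) * b k)"
    by blast
  define b' where "b' = (\<lambda>k. (if k \<le> c then b k * (y c - x k) else 0) - (if k = 0 then 0 else b (k - 1)))"
  have "(\<Prod>t<Suc c. y t - X) = (\<Sum>k\<le>Suc c. (\<Prod>t<k. X - x t) * b' k)" for X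
  proof -
    have "(\<Prod>t<Suc c. y t - X) = (\<Sum>k\<le>c. (\<Prod>t<k. X - x t) * b k * (y c - X))"
      by (simp add: b(2) sum_distrib_right)
    also have "\<dots> = (\<Sum>k\<le>c. (\<Prod>t<k. X - x t) * (b k * (y c - x k)) - (\<Prod>t<Suc k. X - x t) * b k)"
      by (intro sum.cong) (auto simp: algebra_simps)
    also have "\<dots> = (\<Sum>k\<le>Suc c. (\<Prod>t<k. X - x t) * b' k)"
    proof -
      have "(\<Sum>k\<le>Suc c. (\<Prod>t<k. X - x t) * b' k) =
        (\<Sum>k\<le>Suc c. (\<Prod>t<k. X - x t) * (if k \<le> c then b k * (y c - x k) else 0))
        - (\<Sum>k\<le>Suc c. (\<Prod>t<k. X - x t) * (if k = 0 then 0 else b (k - 1)))"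
        by (simp only: b'_def right_diff_distrib sum_subtractf)
      also have "(\<Sum>k\<le>Suc c. (\<Prod>t<k. X - x t) * (if k = 0 then 0 else b (k - 1))) =
          (\<Sum>k\<le>c. (\<Prod>t<Suc k. X - x t) * b k)"
        by (subst sum.atMost_Suc_shift) simp
      also have "(\<Sum>k\<le>Suc c. (\<Prod>t<k. X - x t) * (if k \<le> c then b k * (y c - x k) else 0)) =
          (\<Sum>k\<le>c. (\<Prod>t<k. X - x t) * (b k * (y c - x k)))"
        by simp
      finally show ?thesis by (simp only: sum_subtractf)
    qed
    finally show ?thesis .
  qed
  moreover have "b' (Suc c) = (-1) ^ Suc c" by (simp add: b'_def b(1))
  ultimately show ?case by blast
qed

text \<open>The matrix factors through the Newton basis with nodes \<open>x\<close>: a lower triangular matrix times an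
  upper triangular one with diagonal entries \<open>(-1)\<^sup>c\<close>.\<close>

lemma fdet_vandermonde:
  fixes x y :: "nat \<Rightarrow> 'a::comm_ring_1"
  shows "fdet N (\<lambda>i c. \<Prod>t<c. y t - x i) = (\<Prod>k<N. \<Prod>t<k. x t - x k)"
proof -
  obtain b where b: "\<And>c. b c c = (-1) ^ c"
    "\<And>c X. (\<Prod>t<c. y t - X) = (\<Sum>k\<le>c. (\<Prod>t<k. X - x t) * b c k)"
    using newton_basis_expansion[where y = y and x = x] by metis
  define U where "U = (\<lambda>k c. if k \<le> c then b c k else 0)"
  have "(\<Prod>t<c. y t - x i) = (\<Sum>k<N. (\<Prod>t<k. x i - x t) * U k c)" if "c < N" for i c
    unfolding b(2) by (rule sum.mono_neutral_cong_left) (use that in \<open>auto simp: U_def\<close>)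
  then have "fdet N (\<lambda>i c. \<Prod>t<c. y t - x i) = fdet N (\<lambda>i k. \<Prod>t<k. x i - x t) * fdet N U"
    unfolding fdet_mult[symmetric] by (intro fdet_cong)
  also have "fdet N U = (\<Prod>k<N. (-1) ^ k)"
    by (subst fdet_upper_triangular) (auto simp: U_def b(1))
  also have "fdet N (\<lambda>i k. \<Prod>t<k. x i - x t) = (\<Prod>k<N. \<Prod>t<k. x k - x t)"
    by (rule fdet_lower_triangular) (metis (no_types, lifting) diff_self finite_lessThan lessThan_iff prod_zero)
  also have "(\<Prod>k<N. \<Prod>t<k. x k - x t) * (\<Prod>k<N. (-1) ^ k) = (\<Prod>k<N. \<Prod>t<k. x t - x k)"
  proof -
    have "(\<Prod>t<k. x k - x t) * (-1) ^ k = (\<Prod>t<k. x t - x k)" for k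
    proof -
      have "(\<Prod>t<k. x k - x t) * (\<Prod>t<k. - 1) = (\<Prod>t<k. x t - x k)"
        by (subst prod.distrib[symmetric]) simp
      then show ?thesis by simp
    qed
    then show ?thesis by (simp flip: prod.distrib)
  qed
  finally show ?thesis .
qed

section \<open>q-series rows, their determinant and its product formula\<close>

abbreviation qX :: "rat fps" where "qX \<equiv> fps_X"

definition inv_qfact :: "nat \<Rightarrow> rat fps" where
  "inv_qfact d = (\<Prod>t=1..d. inverse (1 - qX ^ t))"

text \<open>Up to the factor \<open>q\<^bsup>c(c-1)/2\<^esup>\<close> this is \<open>h\<^bsub>d-c\<^esub>(1, q, q\<^sup>2, ...)\<close>, the Jacobi--Trudi entry; it
  vanishes for \<open>d < c\<close>.\<close>

definition qrow :: "nat \<Rightarrow> nat \<Rightarrow> rat fps" where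
  "qrow c d = (\<Prod>t<c. qX ^ t - qX ^ d) * inv_qfact d"

lemma fps_one_minus_X_pow_inverse:
  assumes "t \<ge> 1"
  shows "(1 - qX ^ t) * inverse (1 - qX ^ t) = 1"
  using assms by (intro inverse_mult_eq_1') (simp add: fps_X_power_nth)

text \<open>Telescoping from \<open>(q^c - q^(d+1)) qrow c (d+1) = q^c qrow c d\<close>. In terms of
  complete symmetric functions, this splits the variable 1 off from 1, q, q^2, ..., the counterpart
  of splitting off the letters of degree zero.\<close>

lemma qrow_sum: "qX ^ c * qrow c d = (\<Sum>m\<le>d. qX ^ m * qrow c m)"
proof (induction d)
  case 0
  show ?case by (cases c) (simp_all add: qrow_def prod.lessThan_Suc_shift del: prod.lessThan_Suc)
next
  case (Suc d)
  have "(qX ^ c - qX ^ Suc d) * qrow c (Suc d) = (\<Prod>t<Suc c. qX ^ t - qX ^ Suc d) * inv_qfact (Suc d)"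
    by (simp add: qrow_def mult_ac)
  also have "\<dots> = (\<Prod>t<c. qX * (qX ^ t - qX ^ d)) * ((1 - qX ^ Suc d) * inv_qfact (Suc d))"
    by (subst prod.lessThan_Suc_shift) (simp add: algebra_simps)
  also have "(1 - qX ^ Suc d) * inv_qfact (Suc d) = inv_qfact d"
    using fps_one_minus_X_pow_inverse[of "Suc d"] by (simp add: inv_qfact_def mult_ac)
  also have "(\<Prod>t<c. qX * (qX ^ t - qX ^ d)) * inv_qfact d = qX ^ c * qrow c d"
    by (simp add: prod.distrib qrow_def mult_ac)
  finally show ?case using Suc by (simp add: algebra_simps)
qed

definition qrow_det :: "nat \<Rightarrow> (nat \<Rightarrow> nat) \<Rightarrow> rat fps" where
  "qrow_det N d = fdet N (\<lambda>i c. qrow c (d i))"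

text \<open>Scaling column \<open>c\<close> by \<open>q^c\<close> makes \<open>qrow_sum\<close>
  apply to every entry. Subtracting the next row cuts each sum to the interval between consecutive
  \<open>d\<close>, while the last row keeps its full range; multilinearity then expands the
  determinant.\<close>

lemma qrow_det_recursion:
  assumes "\<And>i. Suc i < N \<Longrightarrow> d (Suc i) < d i"
  shows "(\<Prod>c<N. qX ^ c) * qrow_det N d =
    (\<Sum>m\<in>PiE {..<N} (\<lambda>i. if Suc i < N then {d (Suc i)<..d i} else {..d i}). (\<Prod>i<N. qX ^ m i) * qrow_det N m)"
    (is "_ = (\<Sum>m\<in>PiE _ ?S. _)")
proof -
  have "(\<Prod>c<N. qX ^ c) * qrow_det N d = fdet N (\<lambda>i c. qX ^ c * qrow c (d i))"
    unfolding qrow_det_def by (rule fdet_scale_cols[symmetric])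
  also have "\<dots> = fdet N (\<lambda>i c. if Suc i < N then qX ^ c * qrow c (d i) - qX ^ c * qrow c (d (Suc i)) else qX ^ c * qrow c (d i))"
    by (rule fdet_row_differences[symmetric])
  also have "\<dots> = fdet N (\<lambda>i c. \<Sum>m\<in>?S i. qX ^ m * qrow c m)"
  proof (rule fdet_cong)
    fix i c assume "i < N"
    have "(\<Sum>m\<le>d i. qX ^ m * qrow c m) - (\<Sum>m\<le>d (Suc i). qX ^ m * qrow c m) = (\<Sum>m\<in>{d (Suc i)<..d i}. qX ^ m * qrow c m)"
      if "Suc i < N"
    proof -
      have "{d (Suc i)<..d i} = {..d i} - {..d (Suc i)}" by auto
      then show ?thesis using assms[OF that] by (simp add: sum_diff)
    qed
    then show "(if Suc i < N then qX ^ c * qrow c (d i) - qX ^ c * qrow c (d (Suc i)) else qX ^ c * qrow c (d i)) =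
        (\<Sum>m\<in>?S i. qX ^ m * qrow c m)"
      unfolding qrow_sum by auto
  qed
  also have "\<dots> = (\<Sum>m\<in>PiE {..<N} ?S. fdet N (\<lambda>i c. qX ^ m i * qrow c (m i)))"
    by (rule fdet_rows_sum) auto
  also have "\<dots> = (\<Sum>m\<in>PiE {..<N} ?S. (\<Prod>i<N. qX ^ m i) * qrow_det N m)"
    by (simp add: fdet_scale_rows qrow_det_def)
  finally show ?thesis .
qed

text \<open>After \<open>inv_qfact\<close> is taken out of each row, this is
  \<open>fdet_vandermonde\<close> with \<open>y t = q^t\<close> and \<open>x i = q^(d i)\<close>.
  Each factor \<open>q^(d t) - q^(d k)\<close> with \<open>t < k\<close> then gives up
  \<open>-q^(d k)\<close>.\<close>

lemma qrow_det_product: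
  assumes "\<And>t k. t < k \<Longrightarrow> k < N \<Longrightarrow> d k < d t"
  shows "qrow_det N d = (\<Prod>k<N. (-1) ^ k) * (\<Prod>k<N. qX ^ (k * d k)) *
      ((\<Prod>k<N. inv_qfact (d k)) * (\<Prod>k<N. \<Prod>t<k. 1 - qX ^ (d t - d k)))"
proof -
  have "qrow_det N d = fdet N (\<lambda>i c. inv_qfact (d i) * (\<Prod>t<c. qX ^ t - qX ^ d i))"
    by (simp add: qrow_det_def qrow_def mult_ac)
  also have "\<dots> = (\<Prod>k<N. inv_qfact (d k)) * (\<Prod>k<N. \<Prod>t<k. qX ^ d t - qX ^ d k)"
    by (simp add: fdet_scale_rows fdet_vandermonde)
  also have "(\<Prod>k<N. \<Prod>t<k. qX ^ d t - qX ^ d k) =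
      (\<Prod>k<N. (-1) ^ k * qX ^ (k * d k) * (\<Prod>t<k. 1 - qX ^ (d t - d k)))"
  proof (rule prod.cong[OF refl])
    fix k assume "k \<in> {..<N}"
    then have "qX ^ d t - qX ^ d k = - (qX ^ d k) * (1 - qX ^ (d t - d k))" if "t < k" for t
      using power_add[of qX "d k" "d t - d k"] assms[of t k] that by (simp add: algebra_simps)
    then have "(\<Prod>t<k. qX ^ d t - qX ^ d k) = (\<Prod>t<k. - (qX ^ d k) * (1 - qX ^ (d t - d k)))"
      by (intro prod.cong) auto
    also have "\<dots> = (\<Prod>t<k. - (qX ^ d k)) * (\<Prod>t<k. 1 - qX ^ (d t - d k))"
      by (rule prod.distrib)
    also have "(\<Prod>t<k. - (qX ^ d k)) = (-1) ^ k * qX ^ (k * d k)"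
    proof -
      have "(\<Prod>t<k. - (qX ^ d k)) = (- (qX ^ d k)) ^ k" by (simp only: prod_constant card_lessThan)
      also have "\<dots> = (-1) ^ k * (qX ^ d k) ^ k" by (rule power_minus)
      also have "(qX ^ d k) ^ k = qX ^ (k * d k)" by (simp only: power_mult[symmetric] mult.commute)
      finally show ?thesis .
    qed
    finally show "(\<Prod>t<k. qX ^ d t - qX ^ d k) = (-1) ^ k * qX ^ (k * d k) * (\<Prod>t<k. 1 - qX ^ (d t - d k))" .
  qed
  finally show ?thesis by (simp add: prod.distrib mult_ac)
qed

subsection \<open>Monomials in the generators\<close>

lemma wdeg_superset:
  assumes "finite S" "Poly_Mapping.keys m \<subseteq> S"
  shows "wdeg m = (\<Sum>g\<in>S. snd g * Poly_Mapping.lookup m g)"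
  unfolding wdeg_def using assms by (intro sum.mono_neutral_left) (auto simp: in_keys_iff)

lemma wdeg_add: "wdeg (a + b) = wdeg a + wdeg b"
proof -
  define S where "S = Poly_Mapping.keys a \<union> Poly_Mapping.keys b"
  have "finite S" "Poly_Mapping.keys a \<subseteq> S" "Poly_Mapping.keys b \<subseteq> S" "Poly_Mapping.keys (a + b) \<subseteq> S"
    using Poly_Mapping.keys_add[of a b] by (auto simp: S_def)
  then show ?thesis
    by (simp add: wdeg_superset[of S] lookup_add algebra_simps sum.distrib)
qed

lemma wdeg_single [simp]: "wdeg (Poly_Mapping.single g k) = snd g * k"
  by (simp add: wdeg_superset[of "{g}"])

lemma wdeg_zero [simp]: "wdeg 0 = 0"
  by (simp add: wdeg_def)

definition wmons :: "(nat \<times> nat) set \<Rightarrow> nat \<Rightarrow> ((nat \<times> nat) \<Rightarrow>\<^sub>0 nat) set" where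
  "wmons S d = {m. Poly_Mapping.keys m \<subseteq> S \<and> wdeg m = d}"

lemma lookup_le_wdeg:
  assumes "snd g \<ge> 1"
  shows "Poly_Mapping.lookup m g \<le> wdeg m"
proof (cases "g \<in> Poly_Mapping.keys m")
  case True
  have "Poly_Mapping.lookup m g \<le> snd g * Poly_Mapping.lookup m g"
    using assms by (cases "snd g") auto
  also have "\<dots> \<le> wdeg m"
    unfolding wdeg_def by (rule member_le_sum) (use True in auto)
  finally show ?thesis .
qed (simp add: in_keys_iff)

text \<open>Given the weight, the exponent of \<open>g0\<close> is determined by the other exponents.\<close>

lemma wmons_card_le:
  assumes "finite S" "\<And>g. g \<in> S \<Longrightarrow> snd g \<ge> 1"
  shows finite_wmons: "finite (wmons S d)"
    and "g0 \<in> S \<Longrightarrow> card (wmons S d) \<le> Suc d ^ (card S - 1)"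
proof -
  define r where "r = (\<lambda>T (m :: (nat \<times> nat) \<Rightarrow>\<^sub>0 nat). restrict (Poly_Mapping.lookup m) T)"
  have img: "r T ` wmons S d \<subseteq> PiE T (\<lambda>_. {..d})" if "T \<subseteq> S" for T
  proof (rule image_subsetI)
    fix m assume "m \<in> wmons S d"
    then have "Poly_Mapping.lookup m g \<le> d" if "g \<in> T" for g
      using lookup_le_wdeg[of g m] assms(2)[of g] that \<open>T \<subseteq> S\<close> by (auto simp: wmons_def)
    then show "r T m \<in> PiE T (\<lambda>_. {..d})" by (simp add: r_def)
  qed
  have inj: "inj_on (r S) (wmons S d)"
  proof (rule inj_onI)
    fix m m' assume m: "m \<in> wmons S d" "m' \<in> wmons S d" "r S m = r S m'"
    show "m = m'"
    proof (rule poly_mapping_eqI)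
      fix g
      show "Poly_Mapping.lookup m g = Poly_Mapping.lookup m' g"
      proof (cases "g \<in> S")
        case True
        then show ?thesis using fun_cong[OF m(3), of g] by (simp add: r_def)
      next
        case False
        then have "g \<notin> Poly_Mapping.keys m" "g \<notin> Poly_Mapping.keys m'"
          using m by (auto simp: wmons_def)
        then show ?thesis by (simp add: in_keys_iff)
      qed
    qed
  qed
  show "finite (wmons S d)"
    by (rule inj_on_finite[OF inj img[OF order_refl]]) (use assms in \<open>simp add: finite_PiE\<close>)
  assume g0: "g0 \<in> S"
  have "inj_on (r (S - {g0})) (wmons S d)"
  proof (rule inj_onI)
    fix m m' assume m: "m \<in> wmons S d" "m' \<in> wmons S d" "r (S - {g0}) m = r (S - {g0}) m'"
    have eq: "Poly_Mapping.lookup m g = Poly_Mapping.lookup m' g" if "g \<in> S - {g0}" for g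
      using fun_cong[OF m(3), of g] that by (simp add: r_def)
    have "snd g0 * Poly_Mapping.lookup m g0 = snd g0 * Poly_Mapping.lookup m' g0"
    proof -
      have "(\<Sum>g\<in>S. snd g * Poly_Mapping.lookup m g) = (\<Sum>g\<in>S. snd g * Poly_Mapping.lookup m' g)"
        using m assms(1) by (auto simp: wmons_def wdeg_superset)
      moreover have "(\<Sum>g\<in>S - {g0}. snd g * Poly_Mapping.lookup m g) = (\<Sum>g\<in>S - {g0}. snd g * Poly_Mapping.lookup m' g)"
        using eq by simp
      ultimately show ?thesis
        by (simp add: sum.remove[OF assms(1) g0])
    qed
    then have "Poly_Mapping.lookup m g0 = Poly_Mapping.lookup m' g0"
      using assms(2)[OF g0] by simp
    with eq have "r S m = r S m'" by (auto simp: r_def fun_eq_iff)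
    then show "m = m'" using inj m by (simp add: inj_on_def)
  qed
  then have "card (wmons S d) \<le> card (PiE (S - {g0}) (\<lambda>_. {..d}))"
    by (rule card_inj_on_le[OF _ img]) (use assms in \<open>auto intro: finite_PiE\<close>)
  also have "\<dots> = Suc d ^ (card S - 1)"
    using assms(1) g0 by (simp add: card_PiE)
  finally show "card (wmons S d) \<le> Suc d ^ (card S - 1)" .
qed

text \<open>A monomial either omits \<open>g\<close> or is \<open>g\<close> times a monomial whose
  weight is smaller by \<open>snd g\<close>.\<close>

lemma wmons_card_rec:
  assumes "finite S" "\<And>h. h \<in> insert g S \<Longrightarrow> snd h \<ge> 1" "g \<notin> S"
  shows "card (wmons (insert g S) d) =
     card (wmons S d) + (if snd g \<le> d then card (wmons (insert g S) (d - snd g)) else 0)"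
proof -
  define B where "B = {m \<in> wmons (insert g S) d. Poly_Mapping.lookup m g > 0}"
  have fin: "finite (wmons (insert g S) e)" for e
    using finite_wmons[of "insert g S"] assms by blast
  have "wmons (insert g S) d = wmons S d \<union> B"
    unfolding B_def wmons_def by (auto simp: subset_iff in_keys_iff)
  moreover have "wmons S d \<inter> B = {}"
    using assms(3) unfolding B_def wmons_def by (cases g) (auto simp: subset_iff in_keys_iff)
  ultimately have "card (wmons (insert g S) d) = card (wmons S d) + card B"
    using fin[of d] by (metis card_Un_disjoint finite_Un)
  also have "card B = (if snd g \<le> d then card (wmons (insert g S) (d - snd g)) else 0)"
  proof (cases "snd g \<le> d")
    case True
    have "bij_betw (\<lambda>m. m + Poly_Mapping.single g 1) (wmons (insert g S) (d - snd g)) B"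
    proof (rule bij_betw_byWitness[where f' = "\<lambda>m. m - Poly_Mapping.single g 1"])
      show "\<forall>m\<in>B. m - Poly_Mapping.single g 1 + Poly_Mapping.single g 1 = m"
        by (auto simp: B_def lookup_add lookup_minus lookup_single when_def intro!: poly_mapping_eqI)
      then have B: "wdeg (m - Poly_Mapping.single g 1) + snd g = wdeg m" if "m \<in> B" for m
        using wdeg_add[of "m - Poly_Mapping.single g 1" "Poly_Mapping.single g 1"] that by simp
      show "(\<lambda>m. m - Poly_Mapping.single g 1) ` B \<subseteq> wmons (insert g S) (d - snd g)"
      proof (rule image_subsetI)
        fix m assume m: "m \<in> B"
        have "Poly_Mapping.keys (m - Poly_Mapping.single g 1) \<subseteq> Poly_Mapping.keys m"
          by (auto simp: in_keys_iff lookup_minus)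
        with m B[OF m] show "m - Poly_Mapping.single g 1 \<in> wmons (insert g S) (d - snd g)"
          by (auto simp: wmons_def B_def)
      qed
      show "(\<lambda>m. m + Poly_Mapping.single g 1) ` wmons (insert g S) (d - snd g) \<subseteq> B"
      proof (rule image_subsetI)
        fix m assume m: "m \<in> wmons (insert g S) (d - snd g)"
        have "Poly_Mapping.keys (m + Poly_Mapping.single g 1) \<subseteq> insert g (Poly_Mapping.keys m)"
          using Poly_Mapping.keys_add[of m "Poly_Mapping.single g 1"] by auto
        with m True show "m + Poly_Mapping.single g 1 \<in> B"
          by (auto simp: wmons_def B_def wdeg_add lookup_add)
      qed
    qed auto
    then show ?thesis using True by (simp add: bij_betw_same_card)
  next
    case False
    have "B = {}"
    proof -
      have "snd g \<le> wdeg m" if "Poly_Mapping.lookup m g > 0" for m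
      proof -
        have "snd g \<le> snd g * Poly_Mapping.lookup m g" using that by simp
        also have "\<dots> \<le> wdeg m"
          unfolding wdeg_def by (rule member_le_sum) (use that in \<open>auto simp: in_keys_iff\<close>)
        finally show ?thesis .
      qed
      with False show ?thesis by (auto simp: B_def wmons_def)
    qed
    with False show ?thesis by simp
  qed
  finally show ?thesis .
qed

lemma wmons_empty: "wmons {} d = (if d = 0 then {0} else {})"
  by (auto simp: wmons_def)

lemma wmons_fps:
  assumes "finite S" "\<And>g. g \<in> S \<Longrightarrow> snd g \<ge> 1"
  shows "Abs_fps (\<lambda>d. of_nat (card (wmons S d))) = (\<Prod>g\<in>S. inverse (1 - qX ^ snd g))"
  using assms
proof (induction S)
  case empty
  show ?case by (rule fps_ext) (simp add: wmons_empty)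
next
  case (insert g S)
  have w: "1 \<le> snd g" using insert.prems by blast
  define F where "F = (\<lambda>S. Abs_fps (\<lambda>d. of_nat (card (wmons S d))) :: rat fps)"
  have rec: "card (wmons (insert g S) n) =
      card (wmons S n) + (if snd g \<le> n then card (wmons (insert g S) (n - snd g)) else 0)" for n
    by (rule wmons_card_rec) (use insert in auto)
  have "(1 - qX ^ snd g) * F (insert g S) = F S"
  proof (rule fps_ext)
    fix n
    show "fps_nth ((1 - qX ^ snd g) * F (insert g S)) n = fps_nth (F S) n"
      using rec[of n] by (auto simp: F_def left_diff_distrib fps_X_power_mult_nth)
  qed
  note eq = this
  have "F (insert g S) * ((1 - qX ^ snd g) * inverse (1 - qX ^ snd g)) =
      ((1 - qX ^ snd g) * F (insert g S)) * inverse (1 - qX ^ snd g)"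
    by (simp only: mult_ac)
  also have "\<dots> = inverse (1 - qX ^ snd g) * F S"
    unfolding eq by (rule mult.commute)
  finally have "F (insert g S) = inverse (1 - qX ^ snd g) * F S"
    by (simp only: fps_one_minus_X_pow_inverse[OF w] mult_1_right)
  also have "F S = (\<Prod>g\<in>S. inverse (1 - qX ^ snd g))"
    unfolding F_def by (rule insert.IH) (use insert.prems in blast)
  also have "inverse (1 - qX ^ snd g) * \<dots> = (\<Prod>g\<in>insert g S. inverse (1 - qX ^ snd g))"
    using insert.hyps by (rule prod.insert[symmetric])
  finally show ?case unfolding F_def .
qed

lemma finite_Ogens [simp]: "finite (Ogens N lam)"
  by (rule finite_subset[of _ "{..<N} \<times> {..Max (dd N lam ` {..<N})}"])
     (auto simp: Ogens_def intro!: order.trans[OF _ Max_ge])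

lemma Ogens_snd: "g \<in> Ogens N lam \<Longrightarrow> snd g \<ge> 1"
  by (auto simp: Ogens_def)

lemma dd_less:
  assumes "\<And>i. Suc i < N \<Longrightarrow> lam (Suc i) \<le> lam i" "t < k" "k < N"
  shows "dd N lam k < dd N lam t"
  using assms(2,3)
proof (induction rule: less_Suc_induct)
  case (1 i)
  then show ?case using assms(1)[of i] by (simp add: dd_def)
next
  case (2 i j k)
  then show ?case by simp
qed

context
  fixes N :: nat and lam :: "nat \<Rightarrow> nat"
  assumes antitone: "\<And>i. Suc i < N \<Longrightarrow> lam (Suc i) \<le> lam i"
begin

definition row_degs :: "nat \<Rightarrow> nat set" where
  "row_degs i = {j. 1 \<le> j \<and> j \<le> dd N lam i \<and> dd N lam i - j \<notin> dd N lam ` {..<N}}"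

lemma Ogens_Sigma: "Ogens N lam = Sigma {..<N} row_degs"
  by (auto simp: Ogens_def row_degs_def)

text \<open>The degrees missing from row \<open>i\<close> are the differences
  \<open>d_i - d_k\<close> with \<open>k > i\<close>: if \<open>d_i - j = d_k\<close> with
  \<open>j \<ge> 1\<close>, then \<open>d_k < d_i\<close>, and strict decrease of \<open>d\<close>
  forces \<open>k > i\<close>.\<close>

lemma interval_split:
  assumes "i < N"
  shows "{1..dd N lam i} = row_degs i \<union> (\<lambda>k. dd N lam i - dd N lam k) ` {i<..<N}"
    and "row_degs i \<inter> (\<lambda>k. dd N lam i - dd N lam k) ` {i<..<N} = {}"
    and "inj_on (\<lambda>k. dd N lam i - dd N lam k) {i<..<N}"
proof -
  note less = dd_less[of N lam, OF antitone]
  have le: "dd N lam k \<le> dd N lam i" if "k \<in> {i<..<N}" for k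
    using less[of i k] that by auto
  show "inj_on (\<lambda>k. dd N lam i - dd N lam k) {i<..<N}"
  proof (rule inj_onI)
    fix k l assume kl: "k \<in> {i<..<N}" "l \<in> {i<..<N}" "dd N lam i - dd N lam k = dd N lam i - dd N lam l"
    then have "dd N lam k = dd N lam l" using le by (metis diff_diff_cancel)
    then show "k = l" using less[of k l] less[of l k] kl by (metis greaterThanLessThan_iff less_irrefl nat_neq_iff)
  qed
  show "row_degs i \<inter> (\<lambda>k. dd N lam i - dd N lam k) ` {i<..<N} = {}"
    using le by (auto simp: row_degs_def)
  show "{1..dd N lam i} = row_degs i \<union> (\<lambda>k. dd N lam i - dd N lam k) ` {i<..<N}"
  proof (intro equalityI subsetI)
    fix j assume j: "j \<in> {1..dd N lam i}"
    show "j \<in> row_degs i \<union> (\<lambda>k. dd N lam i - dd N lam k) ` {i<..<N}"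
    proof (cases "dd N lam i - j \<in> dd N lam ` {..<N}")
      case True
      then obtain k where k: "k < N" "dd N lam i - j = dd N lam k" by auto
      then have "dd N lam k < dd N lam i" using j by auto
      then have "i < k" using less[of k i] assms by (metis less_asym less_irrefl linorder_neqE_nat)
      moreover have "j = dd N lam i - dd N lam k" using k j by auto
      ultimately show ?thesis using k by auto
    qed (use j in \<open>auto simp: row_degs_def\<close>)
  next
    fix j assume "j \<in> row_degs i \<union> (\<lambda>k. dd N lam i - dd N lam k) ` {i<..<N}"
    then show "j \<in> {1..dd N lam i}"
      using less[of i] by (auto simp: row_degs_def Suc_le_eq)
  qed
qed

lemma finite_row_degs [simp]: "finite (row_degs i)"
  by (rule finite_subset[of _ "{..dd N lam i}"]) (auto simp: row_degs_def)

text \<open>Row \<open>i\<close> keeps \<open>d_i - (N - 1 - i) = lam i\<close> of its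
  \<open>d_i\<close> candidate degrees.\<close>

lemma card_Ogens: "card (Ogens N lam) = (\<Sum>i<N. lam i)"
proof -
  have "card (row_degs i) = lam i" if "i < N" for i
  proof -
    have "card {1..dd N lam i} = card (row_degs i) + card ((\<lambda>k. dd N lam i - dd N lam k) ` {i<..<N})"
      unfolding interval_split(1)[OF that]
      by (rule card_Un_disjoint) (use interval_split(2)[OF that] in auto)
    moreover have "card ((\<lambda>k. dd N lam i - dd N lam k) ` {i<..<N}) = N - Suc i"
      using card_image[OF interval_split(3)[OF that]] by simp
    moreover have "card {1..dd N lam i} = lam i + (N - Suc i)" using that by (simp add: dd_def)
    ultimately show ?thesis by linarith
  qed
  then show ?thesis unfolding Ogens_Sigma by simp
qed

text \<open>In row \<open>i\<close>, the differences \<open>d_i - d_k\<close> with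
  \<open>k > i\<close> cancel from \<open>inv_qfact\<close> exactly the degrees that are no
  generators. The double product is first reordered from columns to rows.\<close>

lemma Ogens_prod:
  "(\<Prod>k<N. inv_qfact (dd N lam k)) * (\<Prod>k<N. \<Prod>t<k. 1 - qX ^ (dd N lam t - dd N lam k)) =
   (\<Prod>g\<in>Ogens N lam. inverse (1 - qX ^ snd g))"
proof -
  have row: "inv_qfact (dd N lam i) * (\<Prod>k\<in>{i<..<N}. 1 - qX ^ (dd N lam i - dd N lam k)) = (\<Prod>j\<in>row_degs i. inverse (1 - qX ^ j))"
    if i: "i < N" for i
  proof -
    have "inv_qfact (dd N lam i) = (\<Prod>j\<in>row_degs i. inverse (1 - qX ^ j)) *
        (\<Prod>k\<in>{i<..<N}. inverse (1 - qX ^ (dd N lam i - dd N lam k)))"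
      unfolding inv_qfact_def interval_split(1)[OF i]
      using interval_split(2,3)[OF i] by (subst prod.union_disjoint) (auto simp: prod.reindex)
    moreover have "(\<Prod>k\<in>{i<..<N}. inverse (1 - qX ^ (dd N lam i - dd N lam k))) * (\<Prod>k\<in>{i<..<N}. 1 - qX ^ (dd N lam i - dd N lam k)) = 1"
    proof (subst prod.distrib[symmetric], rule prod.neutral, rule ballI)
      fix k assume "k \<in> {i<..<N}"
      then have "1 \<le> dd N lam i - dd N lam k" using dd_less[of N lam i k, OF antitone] by auto
      then show "inverse (1 - qX ^ (dd N lam i - dd N lam k)) * (1 - qX ^ (dd N lam i - dd N lam k)) = 1"
        using fps_one_minus_X_pow_inverse[of "dd N lam i - dd N lam k"] by (simp add: mult.commute)
    qed
    ultimately show ?thesis by (simp add: mult.assoc)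
  qed
  have "(\<Prod>k<N. \<Prod>t<k. 1 - qX ^ (dd N lam t - dd N lam k)) = (\<Prod>k<N. \<Prod>t | t \<in> {..<N} \<and> t < k. 1 - qX ^ (dd N lam t - dd N lam k))"
    by (intro prod.cong) auto
  also have "\<dots> = (\<Prod>i<N. \<Prod>k | k \<in> {..<N} \<and> i < k. 1 - qX ^ (dd N lam i - dd N lam k))"
    by (rule prod.swap_restrict) auto
  also have "\<dots> = (\<Prod>i<N. \<Prod>k\<in>{i<..<N}. 1 - qX ^ (dd N lam i - dd N lam k))"
    by (intro prod.cong) auto
  finally have "(\<Prod>k<N. inv_qfact (dd N lam k)) * (\<Prod>k<N. \<Prod>t<k. 1 - qX ^ (dd N lam t - dd N lam k)) =
      (\<Prod>i<N. inv_qfact (dd N lam i) * (\<Prod>k\<in>{i<..<N}. 1 - qX ^ (dd N lam i - dd N lam k)))"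
    by (simp only: prod.distrib)
  also have "\<dots> = (\<Prod>i<N. \<Prod>j\<in>row_degs i. inverse (1 - qX ^ j))"
    by (rule prod.cong) (simp_all only: row lessThan_iff)
  also have "\<dots> = (\<Prod>g\<in>Ogens N lam. inverse (1 - qX ^ snd g))"
    unfolding Ogens_Sigma by (subst prod.Sigma) (auto simp: case_prod_unfold)
  finally show ?thesis .
qed

end

subsection \<open>Points determining singular functions\<close>

definition lowdeg :: "nat \<Rightarrow> (nat \<Rightarrow> nat) \<Rightarrow> nat" where
  "lowdeg N lam = (\<Sum>i<N. i * lam i)"

definition hilb :: "nat \<Rightarrow> (nat \<Rightarrow> nat) \<Rightarrow> rat fps" where
  "hilb N lam = qX ^ lowdeg N lam * (\<Prod>g\<in>Ogens N lam. inverse (1 - qX ^ snd g))"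

text \<open>The horizontal strip condition on \<open>lam/\<mu>\<close>. Extension by zero from
  \<open>N\<close> on makes \<open>\<mu>\<close> determined by its first \<open>N\<close>
  values.\<close>

definition interlacing :: "nat \<Rightarrow> (nat \<Rightarrow> nat) \<Rightarrow> (nat \<Rightarrow> nat) set" where
  "interlacing N lam = {\<mu>. (\<forall>i<N. \<mu> i \<le> lam i) \<and> (\<forall>i. Suc i < N \<longrightarrow> lam (Suc i) \<le> \<mu> i) \<and> (\<forall>i\<ge>N. \<mu> i = 0)}"

text \<open>The exponent \<open>\<Sum> k d_k\<close> splits into \<open>lowdeg\<close> and a
  staircase part; the latter and the sign are independent of \<open>lam\<close>, so they cancel in
  the recursion.\<close>

lemma qrow_det_hilb:
  assumes "\<And>i. Suc i < N \<Longrightarrow> lam (Suc i) \<le> lam i"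
  shows "qrow_det N (dd N lam) = (\<Prod>k<N. (-1) ^ k) * qX ^ (\<Sum>k<N. k * (N - 1 - k)) * hilb N lam"
proof -
  have "(\<Prod>k<N. qX ^ (k * dd N lam k)) = qX ^ (\<Sum>k<N. k * dd N lam k)"
    by (rule power_sum[symmetric])
  also have "(\<Sum>k<N. k * dd N lam k) = (\<Sum>k<N. k * (N - 1 - k)) + lowdeg N lam"
    unfolding lowdeg_def sum.distrib[symmetric]
  proof (rule sum.cong[OF refl])
    fix k assume "k \<in> {..<N}"
    then have "dd N lam k = (N - 1 - k) + lam k" by (auto simp: dd_def)
    then show "k * dd N lam k = k * (N - 1 - k) + k * lam k" by (simp only: distrib_left)
  qed
  finally show ?thesis
    using qrow_det_product[of N "dd N lam", OF dd_less[of N lam, OF assms]] Ogens_prod[of N lam, OF assms]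
    by (simp add: hilb_def power_add mult.assoc)
qed

lemma qrow_det_cong: "(\<And>i. i < N \<Longrightarrow> f i = g i) \<Longrightarrow> qrow_det N f = qrow_det N g"
  unfolding qrow_det_def by (rule fdet_cong) simp

text \<open>The staircase shift by \<open>N - 1 - i\<close> turns the weak bound
  \<open>lam (Suc i) \<le> \<mu> i\<close> into a strict one between the shifted entries, which
  gives the half-open intervals.\<close>

lemma interlacing_bij:
  assumes "\<And>i. Suc i < N \<Longrightarrow> lam (Suc i) \<le> lam i"
  shows "bij_betw (\<lambda>\<mu>. restrict (dd N \<mu>) {..<N}) (interlacing N lam)
    (PiE {..<N} (\<lambda>i. if Suc i < N then {dd N lam (Suc i)<..dd N lam i} else {..dd N lam i}))"
    (is "bij_betw _ _ (PiE _ ?S)")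
proof (rule bij_betw_byWitness[where f' = "\<lambda>m i. if i < N then m i - (N - 1 - i) else 0"])
  show "\<forall>\<mu>\<in>interlacing N lam. (\<lambda>i. if i < N then restrict (dd N \<mu>) {..<N} i - (N - 1 - i) else 0) = \<mu>"
    by (auto simp: interlacing_def dd_def fun_eq_iff)
  have ge: "N - 1 - i \<le> m i \<and> (Suc i < N \<longrightarrow> dd N lam (Suc i) < m i) \<and> m i \<le> dd N lam i" if "m \<in> PiE {..<N} ?S" "i < N" for m i
    using PiE_mem[OF that(1), of i] that(2) by (cases "Suc i < N") (auto simp: dd_def)
  show "\<forall>m\<in>PiE {..<N} ?S. restrict (dd N (\<lambda>i. if i < N then m i - (N - 1 - i) else 0)) {..<N} = m"
  proof (intro ballI ext)
    fix m i assume m: "m \<in> PiE {..<N} ?S"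
    show "restrict (dd N (\<lambda>i. if i < N then m i - (N - 1 - i) else 0)) {..<N} i = m i"
      using ge[OF m, of i] PiE_arb[OF m, of i] by (cases "i < N") (auto simp: dd_def)
  qed
  show "(\<lambda>\<mu>. restrict (dd N \<mu>) {..<N}) ` interlacing N lam \<subseteq> PiE {..<N} ?S"
  proof (rule image_subsetI)
    fix \<mu> assume "\<mu> \<in> interlacing N lam"
    then have "dd N \<mu> i \<in> ?S i" if "i < N" for i
      using that by (auto simp: interlacing_def dd_def)
    then show "restrict (dd N \<mu>) {..<N} \<in> PiE {..<N} ?S" by (intro restrict_PiE_iff[THEN iffD2]) auto
  qed
  show "(\<lambda>m i. if i < N then m i - (N - 1 - i) else 0) ` PiE {..<N} ?S \<subseteq> interlacing N lam"
  proof (rule image_subsetI)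
    fix m assume m: "m \<in> PiE {..<N} ?S"
    show "(\<lambda>i. if i < N then m i - (N - 1 - i) else 0) \<in> interlacing N lam"
      unfolding interlacing_def mem_Collect_eq
    proof (intro conjI allI impI)
      fix i assume "i < N"
      then show "(if i < N then m i - (N - 1 - i) else 0) \<le> lam i"
        using ge[OF m, of i] by (auto simp: dd_def)
    next
      fix i assume "Suc i < N"
      then show "lam (Suc i) \<le> (if i < N then m i - (N - 1 - i) else 0)"
        using ge[OF m, of i] by (auto simp: dd_def)
    qed auto
  qed
qed

lemma finite_interlacing:
  assumes "\<And>i. Suc i < N \<Longrightarrow> lam (Suc i) \<le> lam i"
  shows "finite (interlacing N lam)"
  using bij_betw_finite[OF interlacing_bij[of N lam, OF assms]] by (simp add: finite_PiE)

lemma interlacing_antitone: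
  assumes "\<mu> \<in> interlacing N lam" "Suc i < N"
  shows "\<mu> (Suc i) \<le> \<mu> i"
proof -
  have "\<mu> (Suc i) \<le> lam (Suc i)" "lam (Suc i) \<le> \<mu> i" using assms by (auto simp: interlacing_def)
  then show ?thesis by linarith
qed

text \<open>\<open>qrow_det_recursion\<close> after the staircase shift. The power \<open>C\<close>
  comes from the column scaling on the left and from \<open>\<Sum> (N - 1 - i)\<close> on the right;
  the common factor is nonzero and power series over a field form a domain.\<close>

lemma hilb_recursion:
  assumes anti: "\<And>i. Suc i < N \<Longrightarrow> lam (Suc i) \<le> lam i"
  shows "hilb N lam = (\<Sum>\<mu>\<in>interlacing N lam. qX ^ (\<Sum>i<N. \<mu> i) * hilb N \<mu>)"
proof -
  define s where "s = (\<Prod>k<N. (-1) ^ k) * qX ^ (\<Sum>k<N. k * (N - 1 - k))"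
  define C where "C = (\<Sum>c<N. c)"
  have C': "C = (\<Sum>i<N. N - 1 - i)"
    using sum.nat_diff_reindex[of "\<lambda>i. i" N] by (simp add: C_def)
  have "(\<Prod>c<N. qX ^ c) * qrow_det N (dd N lam) =
     (\<Sum>\<mu>\<in>interlacing N lam. (\<Prod>i<N. qX ^ restrict (dd N \<mu>) {..<N} i) * qrow_det N (restrict (dd N \<mu>) {..<N}))"
    (is "_ = ?R")
  proof -
    have "(\<Prod>c<N. qX ^ c) * qrow_det N (dd N lam) =
        (\<Sum>m\<in>PiE {..<N} (\<lambda>i. if Suc i < N then {dd N lam (Suc i)<..dd N lam i} else {..dd N lam i}).
          (\<Prod>i<N. qX ^ m i) * qrow_det N m)"
      by (rule qrow_det_recursion) (rule dd_less[of N lam, OF anti], auto)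
    also have "\<dots> = ?R"
      by (rule sum.reindex_bij_betw[OF interlacing_bij[of N lam, OF anti], symmetric])
    finally show ?thesis .
  qed
  also have "\<dots> = (\<Sum>\<mu>\<in>interlacing N lam. qX ^ C * (qX ^ (\<Sum>i<N. \<mu> i) * (s * hilb N \<mu>)))"
  proof (rule sum.cong[OF refl])
    fix \<mu> assume \<mu>: "\<mu> \<in> interlacing N lam"
    have "qrow_det N (restrict (dd N \<mu>) {..<N}) = qrow_det N (dd N \<mu>)" by (rule qrow_det_cong) simp
    also have "\<dots> = s * hilb N \<mu>"
      unfolding s_def by (rule qrow_det_hilb) (rule interlacing_antitone[OF \<mu>])
    finally have 1: "qrow_det N (restrict (dd N \<mu>) {..<N}) = s * hilb N \<mu>" .
    have "(\<Prod>i<N. qX ^ restrict (dd N \<mu>) {..<N} i) = (\<Prod>i<N. qX ^ ((N - 1 - i) + \<mu> i))"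
      by (intro prod.cong) (auto simp: dd_def intro!: arg_cong[of _ _ "\<lambda>n. qX ^ n"])
    also have "\<dots> = qX ^ C * qX ^ (\<Sum>i<N. \<mu> i)"
      by (simp only: power_add prod.distrib C' power_sum)
    finally show "(\<Prod>i<N. qX ^ restrict (dd N \<mu>) {..<N} i) * qrow_det N (restrict (dd N \<mu>) {..<N}) =
        qX ^ C * (qX ^ (\<Sum>i<N. \<mu> i) * (s * hilb N \<mu>))" using 1 by (simp add: mult.assoc)
  qed
  also have "\<dots> = qX ^ C * s * (\<Sum>\<mu>\<in>interlacing N lam. qX ^ (\<Sum>i<N. \<mu> i) * hilb N \<mu>)"
    by (simp add: sum_distrib_left mult_ac)
  also have "(\<Prod>c<N. qX ^ c) * qrow_det N (dd N lam) = qX ^ C * s * hilb N lam"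
    by (simp add: qrow_det_hilb[of N lam, OF anti] s_def C_def power_sum mult_ac)
  finally have eq: "qX ^ C * s * hilb N lam = qX ^ C * s * (\<Sum>\<mu>\<in>interlacing N lam. qX ^ (\<Sum>i<N. \<mu> i) * hilb N \<mu>)" .
  have "qX ^ C * s \<noteq> 0" by (simp add: s_def)
  from mult_left_cancel[OF this] eq show ?thesis by blast
qed

definition ocount :: "nat \<Rightarrow> (nat \<Rightarrow> nat) \<Rightarrow> nat \<Rightarrow> nat" where
  "ocount N lam d = (if lowdeg N lam \<le> d then card (wmons (Ogens N lam) (d - lowdeg N lam)) else 0)"

lemma hilb_nth: "fps_nth (hilb N lam) d = of_nat (ocount N lam d)"
proof -
  have "(\<Prod>g\<in>Ogens N lam. inverse (1 - qX ^ snd g)) =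
      Abs_fps (\<lambda>d. of_nat (card (wmons (Ogens N lam) d)))"
    by (rule wmons_fps[symmetric]) (use Ogens_snd in auto)
  then show ?thesis by (simp add: hilb_def ocount_def fps_X_power_mult_nth)
qed

lemma ocount_recursion:
  assumes anti: "\<And>i. Suc i < N \<Longrightarrow> lam (Suc i) \<le> lam i"
  shows "ocount N lam d =
    (\<Sum>\<mu>\<in>interlacing N lam. if (\<Sum>i<N. \<mu> i) \<le> d then ocount N \<mu> (d - (\<Sum>i<N. \<mu> i)) else 0)"
proof -
  have "rat_of_nat (ocount N lam d) = fps_nth (hilb N lam) d" by (simp only: hilb_nth)
  also have "\<dots> = (\<Sum>\<mu>\<in>interlacing N lam. fps_nth (qX ^ (\<Sum>i<N. \<mu> i) * hilb N \<mu>) d)"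
    unfolding fps_sum_nth[symmetric] by (rule arg_cong[OF hilb_recursion]) (rule anti)
  also have "\<dots> = (\<Sum>\<mu>\<in>interlacing N lam.
      of_nat (if (\<Sum>i<N. \<mu> i) \<le> d then ocount N \<mu> (d - (\<Sum>i<N. \<mu> i)) else 0))"
    by (intro sum.cong) (auto simp: fps_X_power_mult_nth hilb_nth)
  finally show ?thesis by (simp flip: of_nat_sum)
qed

lemma ocount_zero:
  assumes "(\<Sum>i<N. lam i) = 0"
  shows "ocount N lam d = (if d = 0 then 1 else 0)"
proof -
  have z: "lam i = 0" if "i < N" for i using assms that by simp
  then have "Ogens N lam = {}"
    using card_Ogens[of N lam] assms by simp
  moreover have "lowdeg N lam = 0" using z by (simp add: lowdeg_def)
  ultimately show ?thesis by (simp add: ocount_def wmons_empty)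
qed

text \<open>A dimension bound in terms of evaluation points. A nonzero singular function has a
  nonzero singular slice for some \<open>\<mu>\<close>, so the point sets of all
  \<open>\<mu>\<close>, translated into their slices, suffice, and their sizes add up as in
  \<open>ocount_recursion\<close>. The measure of the smaller problem is
  \<open>(d - |\<mu>|) + |\<mu>| = d\<close>, which is a decrease even for
  \<open>\<mu> = lam\<close> as long as \<open>lam\<close> is nonzero.\<close>

theorem sing_funs_determined:
  assumes "\<And>i. Suc i < N \<Longrightarrow> lam (Suc i) \<le> lam i"
  shows "\<exists>K. finite K \<and> card K \<le> ocount N lam d \<and>
     (\<forall>c\<in>sing_funs N lam d. (\<forall>A\<in>K. c A = 0) \<longrightarrow> c = (\<lambda>A. 0))"
  using assms
proof (induction "d + (\<Sum>i<N. lam i)" arbitrary: d lam rule: less_induct)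
  case less
  define n where "n = (\<Sum>i<N. lam i)"
  show ?case
  proof (cases "n = 0")
    case True
    have supp: "A = {#} \<and> d = 0" if "c \<in> sing_funs N lam d" "c A \<noteq> 0" for c A
    proof -
      have "fst ` set_mset A \<subseteq> {..<N}" "\<forall>i<N. letter_count i A = lam i" "msdeg A = d"
        using that by (auto simp: sing_funs_def)
      with size_eq_sum_letter_count[of A N] True show ?thesis by (auto simp: n_def)
    qed
    show ?thesis
    proof (rule exI[of _ "if d = 0 then {{#}} else {}"], intro conjI ballI impI)
      show "finite (if d = 0 then {{#}} else {})" by simp
      show "card (if d = 0 then {{#}} else {}) \<le> ocount N lam d"
        using ocount_zero[of lam N d] True by (simp add: n_def)
      fix c assume c: "c \<in> sing_funs N lam d" "\<forall>A\<in>if d = 0 then {{#}} else {}. c A = 0"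
      show "c = (\<lambda>A. 0)"
      proof (rule ext, rule ccontr)
        fix A assume "c A \<noteq> 0"
        with supp[OF c(1)] c(2) show False by auto
      qed
    qed
  next
    case False
    define I where "I = {\<mu> \<in> interlacing N lam. (\<Sum>i<N. \<mu> i) \<le> d}"
    have "\<exists>K. finite K \<and> card K \<le> ocount N \<mu> (d - (\<Sum>i<N. \<mu> i)) \<and>
       (\<forall>c\<in>sing_funs N \<mu> (d - (\<Sum>i<N. \<mu> i)). (\<forall>A\<in>K. c A = 0) \<longrightarrow> c = (\<lambda>A. 0))" if \<mu>: "\<mu> \<in> I" for \<mu>
    proof (rule less.hyps)
      have "(\<Sum>i<N. \<mu> i) \<le> n" unfolding n_def
        by (rule sum_mono) (use \<mu> in \<open>auto simp: I_def interlacing_def\<close>)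
      then show "d - (\<Sum>i<N. \<mu> i) + (\<Sum>i<N. \<mu> i) < d + (\<Sum>i<N. lam i)"
        using \<mu> False unfolding n_def[symmetric] by (simp add: I_def)
    qed (use \<mu> interlacing_antitone in \<open>auto simp: I_def\<close>)
    then obtain K where K: "\<And>\<mu>. \<mu> \<in> I \<Longrightarrow> finite (K \<mu>)"
      "\<And>\<mu>. \<mu> \<in> I \<Longrightarrow> card (K \<mu>) \<le> ocount N \<mu> (d - (\<Sum>i<N. \<mu> i))"
      "\<And>\<mu> c. \<mu> \<in> I \<Longrightarrow> c \<in> sing_funs N \<mu> (d - (\<Sum>i<N. \<mu> i)) \<Longrightarrow> (\<forall>A\<in>K \<mu>. c A = 0) \<Longrightarrow> c = (\<lambda>A. 0)"
      by metis
    define K' where "K' = (\<Union>\<mu>\<in>I. (\<lambda>A. zero_part N (\<lambda>i. lam i - \<mu> i) + shift_up A) ` K \<mu>)"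
    have finI: "finite (interlacing N lam)" by (rule finite_interlacing) (rule less.prems)
    then have fin: "finite I" by (simp add: I_def)
    show ?thesis
    proof (rule exI[of _ K'], intro conjI ballI impI)
      show "finite K'" using fin K(1) by (simp add: K'_def)
      have "card K' \<le> (\<Sum>\<mu>\<in>I. card ((\<lambda>A. zero_part N (\<lambda>i. lam i - \<mu> i) + shift_up A) ` K \<mu>))"
        unfolding K'_def by (rule card_UN_le[OF fin])
      also have "\<dots> \<le> (\<Sum>\<mu>\<in>I. ocount N \<mu> (d - (\<Sum>i<N. \<mu> i)))"
        by (rule sum_mono) (use K card_image_le le_trans in blast)
      also have "\<dots> = ocount N lam d"
      proof -
        have "ocount N lam d = (\<Sum>\<mu>\<in>interlacing N lam.
            if (\<Sum>i<N. \<mu> i) \<le> d then ocount N \<mu> (d - (\<Sum>i<N. \<mu> i)) else 0)"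
          by (rule ocount_recursion) (rule less.prems)
        also have "\<dots> = (\<Sum>\<mu>\<in>I. ocount N \<mu> (d - (\<Sum>i<N. \<mu> i)))"
          unfolding I_def by (rule sum.inter_filter[OF finI, symmetric])
        finally show ?thesis by simp
      qed
      finally show "card K' \<le> ocount N lam d" .
      fix c assume c: "c \<in> sing_funs N lam d" "\<forall>A\<in>K'. c A = 0"
      show "c = (\<lambda>A. 0)"
      proof (rule ccontr)
        assume "c \<noteq> (\<lambda>A. 0)"
        from sing_funs_branch[OF c(1) this] obtain \<mu> where
          "\<mu> \<in> I" "(\<lambda>A. c (zero_part N (\<lambda>i. lam i - \<mu> i) + shift_up A)) \<in> sing_funs N \<mu> (d - (\<Sum>i<N. \<mu> i))"
          "(\<lambda>A. c (zero_part N (\<lambda>i. lam i - \<mu> i) + shift_up A)) \<noteq> (\<lambda>A. 0)"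
          by (auto simp: I_def interlacing_def)
        with K(3)[of \<mu>] c(2) show False by (auto simp: K'_def)
      qed
    qed
  qed
qed

subsection \<open>Singular vectors as functions on multisets\<close>

lemma lookup_zconst_mult: "Poly_Mapping.lookup (zconst c * p) m = c * Poly_Mapping.lookup p m"
  unfolding zconst_def mult_map_scale_conv_mult[symmetric]
  by (simp add: Poly_Mapping.map.rep_eq when_def)

text \<open>A list of letters encodes a word and, through \<open>exps_of\<close>, a monomial at the
  same time; forgetting the order of the list is then passing to symmetric tensors.\<close>

definition word_of :: "(nat \<times> nat) list \<Rightarrow> nat \<Rightarrow> nat" where
  "word_of l s = (if s < length l then fst (l ! s) else 0)"

lift_definition exps_of :: "(nat \<times> nat) list \<Rightarrow> (nat \<Rightarrow>\<^sub>0 nat)" is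
  "\<lambda>l s. if s < length l then snd (l ! s) else 0"
  by (rule finite_subset[of _ "{..<length _}"]) (auto split: if_splits)

lemma lookup_exps_of: "Poly_Mapping.lookup (exps_of l) s = (if s < length l then snd (l ! s) else 0)"
  by transfer simp

lemma mdeg_superset:
  assumes "finite S" "Poly_Mapping.keys m \<subseteq> S"
  shows "mdeg m = (\<Sum>g\<in>S. Poly_Mapping.lookup m g)"
  unfolding mdeg_def using assms by (intro sum.mono_neutral_left) (auto simp: in_keys_iff)

lemma msdeg_mset: "msdeg (mset l) = (\<Sum>s<length l. snd (l ! s))"
  by (induction l rule: rev_induct) (auto simp: nth_append)

lemma mdeg_exps_of: "mdeg (exps_of l) = msdeg (mset l)"
proof -
  have "mdeg (exps_of l) = (\<Sum>s<length l. Poly_Mapping.lookup (exps_of l) s)"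
    by (rule mdeg_superset) (auto simp: in_keys_iff lookup_exps_of split: if_splits)
  then show ?thesis by (simp add: lookup_exps_of msdeg_mset)
qed

lemma word_exps_surj:
  assumes "\<forall>s\<ge>n. w s = 0" "Poly_Mapping.keys m \<subseteq> {..<n}"
  shows "\<exists>l. length l = n \<and> word_of l = w \<and> exps_of l = m"
proof (rule exI[of _ "map (\<lambda>s. (w s, Poly_Mapping.lookup m s)) [0..<n]"], intro conjI)
  show "word_of (map (\<lambda>s. (w s, Poly_Mapping.lookup m s)) [0..<n]) = w"
    using assms(1) by (auto simp: word_of_def fun_eq_iff)
  show "exps_of (map (\<lambda>s. (w s, Poly_Mapping.lookup m s)) [0..<n]) = m"
  proof (rule poly_mapping_eqI)
    fix s
    have "Poly_Mapping.lookup m s = 0" if "\<not> s < n" using assms(2) that by (auto simp: in_keys_iff)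
    then show "Poly_Mapping.lookup (exps_of (map (\<lambda>s. (w s, Poly_Mapping.lookup m s)) [0..<n])) s = Poly_Mapping.lookup m s"
      by (auto simp: lookup_exps_of)
  qed
qed simp

text \<open>The permutation carrying one list to the other moves words and exponents simultaneously,
  which is precisely the action under which \<open>x\<close> is invariant.\<close>

lemma Sn_invariant_mset:
  assumes "Sn_invariant n x" "length l = n" "mset l = mset l'"
  shows "Poly_Mapping.lookup (x (word_of l)) (exps_of l) = Poly_Mapping.lookup (x (word_of l')) (exps_of l')"
proof -
  have len: "length l' = n" using assms(2,3) by (metis size_mset)
  obtain p where p: "p permutes {..<n}" "permute_list p l' = l"
    using mset_eq_permutation[OF assms(3)] len by blast
  have nth: "l ! s = l' ! p s" if "s < n" for s
    using p that len by (metis permute_list_nth)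
  have out: "p s = s" if "\<not> s < n" for s
    using p(1) that by (auto simp: permutes_def)
  have lt: "p s < n \<longleftrightarrow> s < n" for s
    using permutes_in_image[OF p(1), of s] by simp
  have 1: "Poly_Mapping.lookup (exps_of l) = Poly_Mapping.lookup (exps_of l') \<circ> p"
    using nth assms(2) len lt by (auto simp: fun_eq_iff lookup_exps_of)
  have "word_of l = word_of l' \<circ> p"
    using nth assms(2) len lt by (auto simp: fun_eq_iff word_of_def)
  then have 2: "word_of l \<circ> inv_into UNIV p = word_of l'"
    using permutes_inv_o(1)[OF p(1)] by (simp add: o_assoc[symmetric])
  show ?thesis
    using assms(1) p(1) 1 2 unfolding Sn_invariant_def by metis
qed

lemma mset_op_mset:
  "mset_op i j c (mset l) = (\<Sum>s<length l. if fst (l ! s) = i then c (mset (l[s := (j, snd (l ! s))])) else 0)"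
proof (induction l arbitrary: c)
  case (Cons a l)
  show ?case
    unfolding length_Cons sum.lessThan_Suc_shift
    by (simp add: mset_op_add_mset Cons.IH cong: if_cong)
qed simp

lemma lookup_genop_0:
  "Poly_Mapping.lookup (genop n i j 0 x w) m =
     (\<Sum>s<n. if w s = i then Poly_Mapping.lookup (x (w(s := j))) m else 0)"
  unfolding genop_def lookup_sum by (intro sum.cong) (auto simp: Eop_def)

text \<open>On invariant vectors the chosen enumeration does not matter
  (\<open>ms_coeff_mset\<close>). The restriction to degree \<open>e\<close> extracts one
  homogeneous component, so that \<open>x\<close> itself may have mixed degrees.\<close>

definition ms_coeff :: "nat \<Rightarrow> nat \<Rightarrow> vvec \<Rightarrow> (nat \<times> nat) multiset \<Rightarrow> complex" where
  "ms_coeff n e x A = (if size A = n \<and> msdeg A = e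
     then let l = SOME l. mset l = A in Poly_Mapping.lookup (x (word_of l)) (exps_of l) else 0)"

lemma ms_coeff_mset:
  assumes "Sn_invariant n x"
  shows "ms_coeff n e x (mset l) = (if length l = n \<and> msdeg (mset l) = e
    then Poly_Mapping.lookup (x (word_of l)) (exps_of l) else 0)"
proof -
  have "mset (SOME l'. mset l' = mset l) = mset l" by (rule someI_ex) blast
  then show ?thesis
    using Sn_invariant_mset[OF assms, of l "SOME l'. mset l' = mset l"] by (auto simp: ms_coeff_def Let_def)
qed

lemma ms_coeff_add: "ms_coeff n e (vadd x y) A = ms_coeff n e x A + ms_coeff n e y A"
  by (simp add: ms_coeff_def vadd_def lookup_add Let_def)

lemma ms_coeff_scale: "ms_coeff n e (vscale c x) A = c * ms_coeff n e x A"
  by (simp add: ms_coeff_def vscale_def lookup_zconst_mult Let_def)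

lemma word_of_update: "s < length l \<Longrightarrow> word_of (l[s := (j, k)]) = (word_of l)(s := j)"
  by (auto simp: word_of_def fun_eq_iff nth_list_update)

lemma exps_of_update: "exps_of (l[s := (j, snd (l ! s))]) = exps_of l"
  by (rule poly_mapping_eqI, cases "s < length l") (auto simp: lookup_exps_of nth_list_update)

text \<open>Changing the row of a letter leaves its exponent alone, so the conditions on size and
  degree pass through and \<open>mset_op\<close> matches the module action term by term.\<close>

lemma mset_op_ms_coeff:
  assumes "Sn_invariant n x"
  shows "mset_op i j (ms_coeff n e x) (mset l) = (if length l = n \<and> msdeg (mset l) = e
    then Poly_Mapping.lookup (genop n i j 0 x (word_of l)) (exps_of l) else 0)"
proof -
  have "mset_op i j (ms_coeff n e x) (mset l) = (\<Sum>s<length l. if fst (l ! s) = i then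
      (if length l = n \<and> msdeg (mset l) = e
       then Poly_Mapping.lookup (x ((word_of l)(s := j))) (exps_of l) else 0) else 0)"
    unfolding mset_op_mset
  proof (intro sum.cong refl if_cong)
    fix s assume "s \<in> {..<length l}"
    then have s: "s < length l" by simp
    have "msdeg (mset (l[s := (j, snd (l ! s))])) = msdeg (mset l)"
      unfolding mdeg_exps_of[symmetric] exps_of_update ..
    then show "ms_coeff n e x (mset (l[s := (j, snd (l ! s))])) = (if length l = n \<and> msdeg (mset l) = e
       then Poly_Mapping.lookup (x ((word_of l)(s := j))) (exps_of l) else 0)"
      using s by (simp only: ms_coeff_mset[OF assms] length_list_update word_of_update exps_of_update)
  qed
  then show ?thesis
    by (cases "length l = n \<and> msdeg (mset l) = e")
       (auto simp: lookup_genop_0 word_of_def intro!: sum.cong sum.neutral)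
qed

lemma letter_count_mset: "letter_count i (mset l) = card {s. s < length l \<and> fst (l ! s) = i}"
  unfolding letter_count_def mset_filter[symmetric] size_mset by (rule length_filter_conv_card)

text \<open>The diagonal operator for row \<open>i\<close> multiplies each coefficient by the number
  of occurrences of \<open>i\<close> in its word; where the coefficient is nonzero, the weight
  equation forces this number to be \<open>lam i\<close>.\<close>

lemma ms_coeff_sing:
  assumes "x \<in> MM N lam"
  shows "ms_coeff (\<Sum>i<N. lam i) e x \<in> sing_funs N lam e"
proof -
  define n where "n = (\<Sum>i<N. lam i)"
  have x: "x \<in> VV N n" "Sn_invariant n x" "singular N n lam x"
    using assms by (auto simp: MM_def Let_def n_def)
  have "fst ` set_mset A \<subseteq> {..<N} \<and> (\<forall>i<N. letter_count i A = lam i) \<and> msdeg A = e" if "ms_coeff n e x A \<noteq> 0" for A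
  proof -
    obtain l where l: "A = mset l" by (metis ex_mset)
    have nz: "length l = n" "msdeg (mset l) = e" "Poly_Mapping.lookup (x (word_of l)) (exps_of l) \<noteq> 0"
      using that unfolding l ms_coeff_mset[OF x(2)] by (auto split: if_splits)
    then have "x (word_of l) \<noteq> 0" by auto
    then have w: "word_of l \<in> words N n" using x(1) by (auto simp: VV_def)
    have "fst (l ! s) < N" if "s < n" for s
      using w that nz(1) by (auto simp: words_def word_of_def split: if_splits)
    then have "\<forall>p\<in>set l. fst p < N" using nz(1) by (metis in_set_conv_nth)
    then have "fst ` set_mset A \<subseteq> {..<N}" using l by auto
    moreover have "letter_count i A = lam i" if i: "i < N" for i
    proof -
      have "genop n i i 0 x (word_of l) = vscale (of_nat (lam i)) x (word_of l)"
        using x(3) i by (simp add: singular_def)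
      then have "(\<Sum>s<n. if word_of l s = i then Poly_Mapping.lookup (x ((word_of l)(s := i))) (exps_of l) else 0) =
          of_nat (lam i) * Poly_Mapping.lookup (x (word_of l)) (exps_of l)"
        by (simp only: lookup_genop_0[symmetric]) (simp add: vscale_def lookup_zconst_mult)
      also have "(\<Sum>s<n. if word_of l s = i then Poly_Mapping.lookup (x ((word_of l)(s := i))) (exps_of l) else 0) =
          (\<Sum>s<n. if word_of l s = i then Poly_Mapping.lookup (x (word_of l)) (exps_of l) else 0)"
        by (intro sum.cong if_cong refl) (metis fun_upd_triv)
      also have "\<dots> = (\<Sum>s | s \<in> {..<n} \<and> word_of l s = i. Poly_Mapping.lookup (x (word_of l)) (exps_of l))"
        by (rule sum.inter_filter[symmetric]) simp
      also have "{s. s \<in> {..<n} \<and> word_of l s = i} = {s. s < length l \<and> fst (l ! s) = i}"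
        using nz(1) by (auto simp: word_of_def)
      finally have "of_nat (letter_count i A) * Poly_Mapping.lookup (x (word_of l)) (exps_of l) =
          (of_nat (lam i) :: complex) * Poly_Mapping.lookup (x (word_of l)) (exps_of l)"
        by (simp add: l letter_count_mset)
      with nz(3) show ?thesis by simp
    qed
    ultimately show ?thesis using nz l by simp
  qed
  moreover have "mset_op i (Suc i) (ms_coeff n e x) A = 0" if "Suc i < N" for i A
  proof -
    obtain l where l: "A = mset l" by (metis ex_mset)
    have "genop n i (Suc i) 0 x = (\<lambda>w. 0)" using x(3) that by (simp add: singular_def)
    then show ?thesis unfolding l mset_op_ms_coeff[OF x(2)] by simp
  qed
  ultimately show ?thesis unfolding sing_funs_def n_def[symmetric] by auto
qed

lemma MM_zeroI:
  assumes x: "x \<in> MM N lam" and z: "\<And>e. ms_coeff (\<Sum>i<N. lam i) e x = (\<lambda>A. 0)"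
  shows "x = (\<lambda>w. 0)"
proof (rule ext, rule poly_mapping_eqI, rule ccontr)
  fix w m
  assume nz: "Poly_Mapping.lookup (x w) m \<noteq> Poly_Mapping.lookup 0 m"
  define n where "n = (\<Sum>i<N. lam i)"
  have xn: "x \<in> VV N n" "Sn_invariant n x"
    using x by (auto simp: MM_def Let_def n_def)
  have "w \<in> words N n" "m \<in> Poly_Mapping.keys (x w)"
    using nz xn(1) by (auto simp: VV_def in_keys_iff)
  moreover have "\<forall>m\<in>Poly_Mapping.keys (x w). Poly_Mapping.keys m \<subseteq> {..<n}"
    using xn(1) by (simp add: VV_def)
  ultimately have "\<forall>s\<ge>n. w s = 0" "Poly_Mapping.keys m \<subseteq> {..<n}"
    by (auto simp: words_def)
  from word_exps_surj[OF this] obtain l where l: "length l = n" "word_of l = w" "exps_of l = m" by blast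
  have "ms_coeff n (msdeg (mset l)) x (mset l) \<noteq> 0"
    using nz l by (simp add: ms_coeff_mset[OF xn(2)])
  with z show False by (simp add: n_def)
qed

lemma ms_coeff_high:
  assumes "x \<in> MM N lam" "\<And>w m. m \<in> Poly_Mapping.keys (x w) \<Longrightarrow> mdeg m \<le> E" "e > E"
  shows "ms_coeff (\<Sum>i<N. lam i) e x = (\<lambda>A. 0)"
proof
  fix A :: "(nat \<times> nat) multiset"
  obtain l where l: "A = mset l" by (metis ex_mset)
  have "Sn_invariant (\<Sum>i<N. lam i) x" using assms(1) by (simp add: MM_def Let_def)
  note coeff = ms_coeff_mset[OF this, of e l]
  show "ms_coeff (\<Sum>i<N. lam i) e x A = 0"
  proof (cases "msdeg (mset l) = e")
    case True
    then have "exps_of l \<notin> Poly_Mapping.keys (x (word_of l))"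
      using assms(2)[of "exps_of l" "word_of l"] assms(3) by (auto simp: mdeg_exps_of)
    then show ?thesis unfolding l coeff by (simp add: in_keys_iff)
  qed (simp add: l coeff)
qed

lemma VV_vadd: "x \<in> VV N n \<Longrightarrow> y \<in> VV N n \<Longrightarrow> vadd x y \<in> VV N n"
  unfolding VV_def vadd_def using Poly_Mapping.keys_add by (fastforce simp: subset_iff)

lemma MM_vadd:
  assumes "x \<in> MM N lam" "y \<in> MM N lam"
  shows "vadd x y \<in> MM N lam"
proof -
  have "genop n i j 0 (vadd x y) = vadd (genop n i j 0 x) (genop n i j 0 y)" for n i j
    by (intro ext) (auto simp: genop_def vadd_def Eop_def simp flip: sum.distrib intro!: sum.cong)
  with assms VV_vadd show ?thesis
    by (auto simp: MM_def Let_def singular_def Sn_invariant_def vadd_def vscale_def lookup_add algebra_simps fun_eq_iff)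
qed

lemma MM_vscale:
  assumes "x \<in> MM N lam"
  shows "vscale c x \<in> MM N lam"
proof -
  have g: "genop n i j 0 (vscale c x) = vscale c (genop n i j 0 x)" for n i j
    by (intro ext) (auto simp: genop_def vscale_def Eop_def sum_distrib_left intro!: sum.cong)
  have "Poly_Mapping.keys (zconst c * p) \<subseteq> Poly_Mapping.keys p" for p
    by (auto simp: in_keys_iff lookup_zconst_mult)
  then have "vscale c x \<in> VV N n" if "x \<in> VV N n" for n
    using that unfolding VV_def vscale_def by (fastforce simp: subset_iff)
  moreover have "Sn_invariant n (vscale c x)" if "Sn_invariant n x" for n
    using that unfolding Sn_invariant_def vscale_def lookup_zconst_mult by metis
  moreover have "singular N n lam (vscale c x)" if "singular N n lam x" for n
    using that unfolding singular_def g by (auto simp: vscale_def mult.left_commute)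
  ultimately show ?thesis using assms by (auto simp: MM_def Let_def)
qed

subsection \<open>The first Bethe coefficient\<close>

lemma ser_derivn_0: "ser_derivn 0 b = b"
  by (intro ext) (simp add: ser_derivn_def opscale_def vscale_def zconst_def)

text \<open>The only coefficient that could survive sits at \<open>j = m\<close>, and there
  \<open>pochhammer 0 m\<close> is zero.\<close>

lemma ser_derivn_const:
  assumes "\<And>j. j > 0 \<Longrightarrow> b j = opzero" "m > 0"
  shows "ser_derivn m b j = opzero"
proof -
  have z: "vscale c (\<lambda>w. 0) = (\<lambda>w. 0)" "vscale 0 x = (\<lambda>w. 0)" for c x
    by (auto simp: vscale_def zconst_def)
  show ?thesis
  proof (cases "j - m = 0")
    case True
    then show ?thesis using assms(2)
      by (auto simp: ser_derivn_def opscale_def z opzero_def pochhammer_0_left fun_eq_iff)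
  next
    case False
    then have "b (j - m) = opzero" using assms(1)[of "j - m"] by simp
    then show ?thesis
      by (auto simp: ser_derivn_def opscale_def z opzero_def)
  qed
qed

lemma ser_derivn_zero: "ser_derivn m (\<lambda>j. opzero) j = opzero"
  by (cases "m = 0") (simp_all add: ser_derivn_0 ser_derivn_const)

text \<open>Operators are bare functions on vectors, with no linearity in their type. Preservation
  of the zero vector is the fragment of linearity by which a vanishing right factor makes a product
  vanish.\<close>

definition dop_zero_pres :: "vdop \<Rightarrow> bool" where
  "dop_zero_pres A \<longleftrightarrow> (\<forall>k j. A k j (\<lambda>w. 0) = (\<lambda>w. 0))"

lemma ser_mult_opzero:
  assumes "dop_zero_pres A" "\<And>j. b j = opzero"
  shows "ser_mult (A k) b j x w = 0"
  using assms by (simp add: ser_mult_def opzero_def dop_zero_pres_def)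

lemma dop_zero_pres_bethe_entry: "dop_zero_pres (bethe_entry n i j)"
  by (auto simp: dop_zero_pres_def bethe_entry_def opzero_def opscale_def vscale_def genop_def Eop_def fun_eq_iff)

lemma dop_zero_pres_mult:
  assumes "dop_zero_pres A" "dop_zero_pres B"
  shows "dop_zero_pres (dop_mult K A B)"
proof -
  have "ser_derivn m (B l) p (\<lambda>w. 0) = (\<lambda>w. 0)" for m l p
    using assms(2) by (auto simp: dop_zero_pres_def ser_derivn_def opscale_def vscale_def opzero_def)
  then have "ser_mult (A k) (ser_derivn m (B l)) j (\<lambda>w. 0) w = 0" for k m l j w
    using assms(1) by (simp add: dop_zero_pres_def ser_mult_def)
  then show ?thesis by (simp add: dop_zero_pres_def dop_mult_def cong: if_cong)
qed

lemma dop_zero_pres_row_prod: "dop_zero_pres (row_prod N n \<sigma> r)"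
proof (induction r)
  case 0
  show ?case by (simp add: dop_zero_pres_def dop_one_def opzero_def)
qed (simp add: dop_zero_pres_mult dop_zero_pres_bethe_entry)

text \<open>\<open>A\<close> has order at most \<open>R\<close>. A term differentiating the series
  part of the entry would need a coefficient of \<open>A\<close> above order \<open>R\<close>, and
  the derivation part has constant coefficient. The bounds by \<open>N\<close> reflect the truncated
  sums in \<open>dop_mult\<close>.\<close>

lemma dop_mult_bethe_entry:
  assumes A: "dop_zero_pres A" and high: "\<And>k j x w. k > R \<Longrightarrow> A k j x w = 0" and N: "N \<ge> 1"
  shows "dop_mult N A (bethe_entry n i s) R j x w =
     (if R \<le> N then ser_mult (A R) (bethe_entry n i s 0) j x w else 0)
     + (if i = s \<and> 1 \<le> R \<and> R \<le> Suc N then A (R - 1) j x w else 0)"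
proof -
  define B where "B = bethe_entry n i s"
  define G where "G k l m = ser_mult (A k) (ser_derivn m (B l)) j x w" for k l m
  have G2: "G k l m = 0" if "l \<ge> 2" for k l m
  proof -
    have "B l = (\<lambda>j. opzero)" using that by (auto simp: B_def bethe_entry_def)
    then show ?thesis unfolding G_def by (intro ser_mult_opzero[OF A]) (simp add: ser_derivn_zero)
  qed
  have Gm: "G k 1 m = 0" if "m > 0" for k m
    unfolding G_def
    by (intro ser_mult_opzero[OF A] ser_derivn_const[OF _ that]) (simp add: B_def bethe_entry_def)
  have G1: "G k 1 0 = (if i = s then A k j x w else 0)" for k
  proof -
    have "G k 1 0 = (\<Sum>p\<le>j. if p = j then (if i = s then A k j x w else 0) else 0)"
      unfolding G_def ser_derivn_0 ser_mult_def
      using A by (intro sum.cong) (auto simp: B_def bethe_entry_def opzero_def dop_zero_pres_def)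
    then show ?thesis by simp
  qed
  have inner: "(\<Sum>l\<le>N. \<Sum>m\<le>k. if k - m + l = R then of_nat (k choose m) * G k l m else 0) =
      (if k = R then G k 0 0 else 0) + (if Suc k = R then G k 1 0 else 0)" if k: "k \<le> N" for k
  proof -
    have s01: "(\<Sum>l\<in>{0, 1}. f l) = f 0 + f 1" for f :: "nat \<Rightarrow> zpoly" by simp
    have e1: "(\<Sum>l\<le>N. \<Sum>m\<le>k. if k - m + l = R then of_nat (k choose m) * G k l m else 0) =
        (\<Sum>l\<in>{0, 1}. \<Sum>m\<le>k. if k - m + l = R then of_nat (k choose m) * G k l m else 0)"
      by (rule sum.mono_neutral_right) (use N G2 in \<open>auto intro!: sum.neutral\<close>)
    have "(\<Sum>m\<le>k. if k - m + 1 = R then of_nat (k choose m) * G k 1 m else 0) =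
        (\<Sum>m\<le>k. if m = 0 then (if Suc k = R then G k 1 0 else 0) else 0)"
      by (intro sum.cong refl) (use Gm in auto)
    also have "\<dots> = (if Suc k = R then G k 1 0 else 0)" by simp
    finally have e2: "(\<Sum>m\<le>k. if k - m + 1 = R then of_nat (k choose m) * G k 1 m else 0) = \<dots>" .
    have "(\<Sum>m\<le>k. if k - m + 0 = R then of_nat (k choose m) * G k 0 m else 0) =
        (\<Sum>m\<le>k. if m = 0 then (if k = R then G k 0 0 else 0) else 0)"
    proof (intro sum.cong refl)
      fix m assume m: "m \<in> {..k}"
      have "G k 0 m = 0" if "k > R"
        unfolding G_def ser_mult_def using high[OF that] by simp
      then show "(if k - m + 0 = R then of_nat (k choose m) * G k 0 m else 0) =
          (if m = 0 then (if k = R then G k 0 0 else 0) else 0)"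
        using m by (cases "m = 0") auto
    qed
    also have "\<dots> = (if k = R then G k 0 0 else 0)" by simp
    finally show ?thesis unfolding e1 s01 e2 by (simp only:)
  qed
  have "dop_mult N A B R j x w = (\<Sum>k\<le>N. (if k = R then G k 0 0 else 0) + (if Suc k = R then G k 1 0 else 0))"
    unfolding dop_mult_def G_def[symmetric] by (intro sum.cong refl inner) simp
  also have "\<dots> = (\<Sum>k\<le>N. if k = R then G R 0 0 else 0) + (\<Sum>k\<le>N. if k = R - 1 then (if 1 \<le> R then G (R - 1) 1 0 else 0) else 0)"
    unfolding sum.distrib by (intro arg_cong2[of _ _ _ _ "(+)"] sum.cong refl) auto
  also have "\<dots> = (if R \<le> N then G R 0 0 else 0) + (if 1 \<le> R \<and> R \<le> Suc N then G (R - 1) 1 0 else 0)"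
    by auto
  finally show ?thesis unfolding G1 by (simp add: B_def G_def ser_derivn_0)
qed

text \<open>Only diagonal entries contain the derivation, so each fixed point of
  \<open>\<sigma>\<close> raises the order by at most one.\<close>

lemma row_prod_order:
  assumes "N \<ge> 1" "k > card {i. i < r \<and> \<sigma> i = i}"
  shows "row_prod N n \<sigma> r k j x w = 0"
  using assms(2)
proof (induction r arbitrary: k j x w)
  case 0
  then show ?case by (simp add: dop_one_def opzero_def)
next
  case (Suc r)
  have fin: "finite {i. i < r \<and> \<sigma> i = i}" by simp
  have eq: "{i. i < Suc r \<and> \<sigma> i = i} = (if \<sigma> r = r then insert r {i. i < r \<and> \<sigma> i = i} else {i. i < r \<and> \<sigma> i = i})"
    by (auto simp: less_Suc_eq)
  have c: "card {i. i < Suc r \<and> \<sigma> i = i} = card {i. i < r \<and> \<sigma> i = i} + (if \<sigma> r = r then 1 else 0)"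
    unfolding eq using fin by simp
  have "row_prod N n \<sigma> r l j x w = 0" if "l \<ge> k" for l j x w
    using Suc.IH[of l] Suc.prems that c by simp
  moreover have "row_prod N n \<sigma> r (k - 1) j x w = 0" if "\<sigma> r = r" for j x w
    using Suc.IH[of "k - 1"] Suc.prems that c by simp
  ultimately show ?case
    using Suc.prems by (auto simp: dop_mult_bethe_entry[OF dop_zero_pres_row_prod _ assms(1)] ser_mult_def)
qed

text \<open>The two leading coefficients of the product of diagonal entries: 1 at order
  \<open>r\<close>, and minus the sum of the series \<open>e_ii(u)\<close> at order
  \<open>r - 1\<close>.\<close>

lemma row_prod_id:
  assumes "N \<ge> 1" "\<And>i. \<sigma> i = i"
  shows "row_prod N n \<sigma> r r j x w = (if j = 0 then x w else 0) \<or> r > N"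
    and "1 \<le> r \<Longrightarrow> r \<le> N \<Longrightarrow> row_prod N n \<sigma> r (r - 1) j x w =
       (if 1 \<le> j then - (\<Sum>i<r. genop n i i (j - 1) x w) else 0)"
proof -
  have high: "row_prod N n \<sigma> r k j x w = 0" if "k > r" for r k j x w
    by (rule row_prod_order) (use that assms in auto)
  have top: "row_prod N n \<sigma> r r j x w = (if j = 0 then x w else 0)" if "r \<le> N" for r j x w
    using that
  proof (induction r)
    case 0
    show ?case by (simp add: dop_one_def opzero_def)
  next
    case (Suc r)
    then show ?case
      using high[of r] by (simp add: dop_mult_bethe_entry[OF dop_zero_pres_row_prod _ assms(1)] ser_mult_def assms(2)[of r])
  qed
  then show "row_prod N n \<sigma> r r j x w = (if j = 0 then x w else 0) \<or> r > N" by auto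
  have e: "ser_mult (row_prod N n \<sigma> r r) (bethe_entry n r (\<sigma> r) 0) j x w =
      (if 1 \<le> j then - genop n r r (j - 1) x w else 0)" if "r \<le> N" for r j x w
  proof -
    have "ser_mult (row_prod N n \<sigma> r r) (bethe_entry n r (\<sigma> r) 0) j x w =
        (\<Sum>p\<le>j. if p = 0 then bethe_entry n r (\<sigma> r) 0 j x w else 0)"
      unfolding ser_mult_def by (intro sum.cong refl) (use top[OF that] in auto)
    also have "\<dots> = bethe_entry n r (\<sigma> r) 0 j x w" by simp
    also have "\<dots> = (if 1 \<le> j then - genop n r r (j - 1) x w else 0)"
      by (simp add: bethe_entry_def opscale_def vscale_def opzero_def zconst_def single_uminus assms(2))
    finally show ?thesis .
  qed
  show "1 \<le> r \<Longrightarrow> r \<le> N \<Longrightarrow> row_prod N n \<sigma> r (r - 1) j x w =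
       (if 1 \<le> j then - (\<Sum>i<r. genop n i i (j - 1) x w) else 0)"
  proof (induction r)
    case (Suc r)
    have "row_prod N n \<sigma> (Suc r) r j x w = (if 1 \<le> j then - genop n r r (j - 1) x w else 0)
        + (if 1 \<le> r then row_prod N n \<sigma> r (r - 1) j x w else 0)"
    proof -
      have "row_prod N n \<sigma> (Suc r) r j x w = dop_mult N (row_prod N n \<sigma> r) (bethe_entry n r (\<sigma> r)) r j x w"
        by (simp only: row_prod.simps)
      also have "\<dots> = (if r \<le> N then ser_mult (row_prod N n \<sigma> r r) (bethe_entry n r (\<sigma> r) 0) j x w else 0)
          + (if r = \<sigma> r \<and> 1 \<le> r \<and> r \<le> Suc N then row_prod N n \<sigma> r (r - 1) j x w else 0)"
        by (rule dop_mult_bethe_entry[OF dop_zero_pres_row_prod high assms(1)])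
      finally show ?thesis
        using Suc.prems e[of r j x w] assms(2)[of r] by simp
    qed
    with Suc show ?case by (cases "r = 0") auto
  qed simp
qed

text \<open>A permutation other than the identity moves at least two points, so its product has
  order at most \<open>N - 2\<close> and misses the coefficient of order
  \<open>N - 1\<close>.\<close>

lemma Bop_1:
  assumes "N \<ge> 1"
  shows "Bop N n 1 (Suc k) x w = - (\<Sum>i<N. genop n i i k x w)"
proof -
  have "of_int (sign \<sigma>) * row_prod N n \<sigma> N (N - 1) (Suc k) x w = 0" if \<sigma>: "\<sigma> permutes {..<N}" "\<sigma> \<noteq> id" for \<sigma>
  proof -
    obtain a where a: "\<sigma> a \<noteq> a" using \<sigma>(2) by (auto simp: fun_eq_iff)
    have inj: "inj \<sigma>" using permutes_inj[OF \<sigma>(1)] .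
    have lt: "a < N" "\<sigma> a < N" and b: "\<sigma> (\<sigma> a) \<noteq> \<sigma> a"
      using \<sigma>(1) a permutes_in_image[OF \<sigma>(1), of a] inj by (auto simp: permutes_def inj_eq)
    have "{i. i < N \<and> \<sigma> i = i} \<subseteq> {..<N} - {a, \<sigma> a}" using a b by auto
    then have "card {i. i < N \<and> \<sigma> i = i} \<le> card ({..<N} - {a, \<sigma> a})" by (intro card_mono) auto
    also have "\<dots> = N - 2" using a lt by (subst card_Diff_subset) auto
    finally have "card {i. i < N \<and> \<sigma> i = i} < N - 1" using lt a by auto
    then show ?thesis using row_prod_order[OF assms] by simp
  qed
  then have "(\<Sum>\<sigma>\<in>{\<sigma>. \<sigma> permutes {..<N}}. of_int (sign \<sigma>) * row_prod N n \<sigma> N (N - 1) (Suc k) x w) =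
      (\<Sum>\<sigma>\<in>{id}. of_int (sign \<sigma>) * row_prod N n \<sigma> N (N - 1) (Suc k) x w)"
    by (intro sum.mono_neutral_right) (auto simp: finite_permutations permutes_id)
  then show ?thesis
    using row_prod_id(2)[OF assms, of id N] assms by (simp add: Bop_def bethe_rdet_def sign_id)
qed

text \<open>In each tensor factor the diagonal matrix units sum to the identity, which leaves only
  the power sum of the variables.\<close>

lemma Bop_1_VV:
  assumes "N \<ge> 1" "x \<in> VV N n"
  shows "Bop N n 1 (Suc k) x w = - (\<Sum>s<n. zvar s ^ k) * x w"
proof -
  have "(\<Sum>i<N. genop n i i k x w) = (\<Sum>s<n. \<Sum>i<N. zvar s ^ k * Eop s i i x w)"
    unfolding genop_def by (rule sum.swap)
  also have "\<dots> = (\<Sum>s<n. zvar s ^ k * x w)"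
  proof (rule sum.cong[OF refl])
    fix s assume s: "s \<in> {..<n}"
    have "(\<Sum>i<N. zvar s ^ k * Eop s i i x w) = (\<Sum>i<N. if i = w s then zvar s ^ k * x w else 0)"
      by (intro sum.cong refl) (auto simp: Eop_def)
    also have "\<dots> = zvar s ^ k * x w"
    proof (cases "x w = 0")
      case False
      then have "w \<in> words N n" using assms(2) by (auto simp: VV_def)
      then show ?thesis using s by (simp add: words_def)
    qed simp
    finally show "(\<Sum>i<N. zvar s ^ k * Eop s i i x w) = zvar s ^ k * x w" .
  qed
  finally show ?thesis unfolding Bop_1[OF assms(1)] by (simp add: sum_distrib_right)
qed

subsection \<open>Monomial symmetric sums\<close>

definition dlists :: "nat \<Rightarrow> nat \<Rightarrow> nat list set" where
  "dlists n r = {ss. length ss = r \<and> distinct ss \<and> set ss \<subseteq> {..<n}}"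

text \<open>An augmented monomial symmetric polynomial: the variables are chosen in order, so equal
  exponents produce repetitions. This keeps multiplicities out of the recursion
  \<open>injsum_Cons\<close>.\<close>

definition injsum :: "nat \<Rightarrow> nat list \<Rightarrow> zpoly" where
  "injsum n as = (\<Sum>ss\<in>dlists n (length as). \<Prod>i<length as. zvar (ss ! i) ^ (as ! i))"

lemma finite_dlists [simp]: "finite (dlists n r)"
  by (rule finite_subset[OF _ finite_lists_length_eq[of "{..<n}" r]]) (auto simp: dlists_def)

text \<open>Multiplying by the power sum lets the new variable range over all indices. Where it
  coincides with the variable already chosen at place \<open>i\<close>, the two exponents merge, and
  these terms are subtracted.\<close>

lemma injsum_Cons:
  "injsum n (b # as) = (\<Sum>s<n. zvar s ^ b) * injsum n as - (\<Sum>i<length as. injsum n (as[i := as ! i + b]))"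
proof -
  define r where "r = length as"
  define pm where "pm as ss = (\<Prod>i<r. zvar (ss ! i) ^ (as ! i))" for as ss
  have bij: "bij_betw (\<lambda>(ss, s). s # ss) (SIGMA ss:dlists n r. {..<n} - set ss) (dlists n (Suc r))"
    by (rule bij_betw_byWitness[where f' = "\<lambda>l. (tl l, hd l)"])
       (auto simp: dlists_def length_Suc_conv)
  have "injsum n (b # as) = (\<Sum>ss\<in>dlists n (Suc r). zvar (hd ss) ^ b * pm as (tl ss))"
    unfolding injsum_def length_Cons r_def[symmetric]
  proof (rule sum.cong[OF refl])
    fix ss assume "ss \<in> dlists n (Suc r)"
    then obtain s l where "ss = s # l" by (auto simp: dlists_def length_Suc_conv)
    then show "(\<Prod>i<Suc r. zvar (ss ! i) ^ ((b # as) ! i)) = zvar (hd ss) ^ b * pm as (tl ss)"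
      unfolding prod.lessThan_Suc_shift by (simp add: pm_def)
  qed
  also have "\<dots> = (\<Sum>(ss, s)\<in>(SIGMA ss:dlists n r. {..<n} - set ss). zvar s ^ b * pm as ss)"
    by (subst sum.reindex_bij_betw[OF bij, symmetric]) (auto intro!: sum.cong)
  also have "\<dots> = (\<Sum>ss\<in>dlists n r. \<Sum>s\<in>{..<n} - set ss. zvar s ^ b * pm as ss)"
    by (rule sum.Sigma[symmetric]) auto
  also have "\<dots> = (\<Sum>ss\<in>dlists n r. (\<Sum>s<n. zvar s ^ b) * pm as ss - (\<Sum>i<r. pm (as[i := as ! i + b]) ss))"
  proof (rule sum.cong[OF refl])
    fix ss assume "ss \<in> dlists n r"
    then have ss: "length ss = r" "distinct ss" "set ss \<subseteq> {..<n}" by (auto simp: dlists_def)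
    have "(\<Sum>s\<in>set ss. zvar s ^ b * pm as ss) = (\<Sum>i<r. zvar (ss ! i) ^ b * pm as ss)"
      by (rule sum.reindex_bij_betw[OF bij_betw_nth, symmetric]) (use ss in auto)
    also have "\<dots> = (\<Sum>i<r. pm (as[i := as ! i + b]) ss)"
    proof (rule sum.cong[OF refl])
      fix i assume i: "i \<in> {..<r}"
      have "(\<Prod>k\<in>{..<r} - {i}. zvar (ss ! k) ^ (as[i := as ! i + b] ! k)) = (\<Prod>k\<in>{..<r} - {i}. zvar (ss ! k) ^ (as ! k))"
        by (intro prod.cong) auto
      then show "zvar (ss ! i) ^ b * pm as ss = pm (as[i := as ! i + b]) ss"
        using i unfolding pm_def by (simp add: prod.remove[of _ i] r_def power_add mult_ac)
    qed
    finally show "(\<Sum>s\<in>{..<n} - set ss. zvar s ^ b * pm as ss) =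
        (\<Sum>s<n. zvar s ^ b) * pm as ss - (\<Sum>i<r. pm (as[i := as ! i + b]) ss)"
      using ss(3) by (simp add: sum_diff sum_distrib_right)
  qed
  also have "\<dots> = (\<Sum>s<n. zvar s ^ b) * injsum n as - (\<Sum>i<r. injsum n (as[i := as ! i + b]))"
    by (simp add: sum_subtractf injsum_def r_def pm_def sum_distrib_left sum.swap[of _ "dlists n (length as)"])
  finally show ?thesis by (simp add: r_def)
qed

lemma mdeg_add: "mdeg (a + b) = mdeg a + mdeg b"
proof -
  define S where "S = Poly_Mapping.keys a \<union> Poly_Mapping.keys b"
  have "mdeg m = (\<Sum>g\<in>S. Poly_Mapping.lookup m g)" if "Poly_Mapping.keys m \<subseteq> S" for m
    unfolding mdeg_def using that by (intro sum.mono_neutral_left) (auto simp: S_def in_keys_iff)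
  moreover have "Poly_Mapping.keys a \<subseteq> S" "Poly_Mapping.keys b \<subseteq> S" "Poly_Mapping.keys (a + b) \<subseteq> S"
    using Poly_Mapping.keys_add[of a b] by (auto simp: S_def)
  ultimately show ?thesis by (simp add: lookup_add sum.distrib)
qed

lemma mdeg_sum: "mdeg (\<Sum>i\<in>I. f i) = (\<Sum>i\<in>I. mdeg (f i))"
  by (induction I rule: infinite_finite_induct) (simp_all add: mdeg_add, simp_all add: mdeg_def)

definition list_exps :: "nat list \<Rightarrow> nat list \<Rightarrow> (nat \<Rightarrow>\<^sub>0 nat)" where
  "list_exps ss as = (\<Sum>i<length as. Poly_Mapping.single (ss ! i) (as ! i))"

lemma zvar_power: "zvar s ^ k = Poly_Mapping.single (Poly_Mapping.single s k) 1"
  by (induction k) (simp_all add: zvar_def mult_single single_add[symmetric])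

lemma prod_single: "(\<Prod>i\<in>I. Poly_Mapping.single (f i) (1 :: complex)) = Poly_Mapping.single (\<Sum>i\<in>I. f i) 1"
  by (induction I rule: infinite_finite_induct) (simp_all add: mult_single)

lemma injsum_eq: "injsum n as = (\<Sum>ss\<in>dlists n (length as). Poly_Mapping.single (list_exps ss as) 1)"
  by (simp add: injsum_def zvar_power prod_single list_exps_def)

lemma lookup_list_exps:
  assumes "distinct ss" "length ss = length as" "i < length as"
  shows "Poly_Mapping.lookup (list_exps ss as) (ss ! i) = as ! i"
proof -
  have "Poly_Mapping.lookup (list_exps ss as) (ss ! i) = (\<Sum>k<length as. if k = i then as ! i else 0)"
    unfolding list_exps_def lookup_sum
    by (intro sum.cong) (use assms in \<open>auto simp: lookup_single nth_eq_iff_index_eq\<close>)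
  then show ?thesis using assms by simp
qed

lemma mdeg_list_exps: "mdeg (list_exps ss as) = sum_list as"
proof -
  have "mdeg (Poly_Mapping.single s k) = k" for s k :: nat by (simp add: mdeg_def)
  then show ?thesis by (simp add: list_exps_def mdeg_sum sum_list_sum_nth lessThan_atLeast0)
qed

lemma injsum_mdeg:
  assumes "m \<in> Poly_Mapping.keys (injsum n as)"
  shows "mdeg m = sum_list as"
proof -
  have "m \<in> (\<Union>ss\<in>dlists n (length as). Poly_Mapping.keys (Poly_Mapping.single (list_exps ss as) (1 :: complex)))"
    using assms Poly_Mapping.keys_sum unfolding injsum_eq by fast
  then show ?thesis by (auto simp: mdeg_list_exps)
qed

definition spread :: "nat \<Rightarrow> nat \<Rightarrow> (nat \<Rightarrow> nat) \<Rightarrow> nat list" where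
  "spread n B b = map (\<lambda>i. i * Suc B + b i) [0..<n]"

lemma length_spread [simp]: "length (spread n B b) = n"
  by (simp add: spread_def)

text \<open>Linear in \<open>B\<close>: the \<open>Suc B ^ n\<close> independent symmetric sums live
  in degrees bounded by a constant times \<open>Suc B\<close>, which is growth of full order
  \<open>n\<close>.\<close>

lemma sum_list_spread:
  assumes "b \<in> PiE {..<n} (\<lambda>_. {..B})"
  shows "sum_list (spread n B b) \<le> n * n * Suc B"
proof -
  have "sum_list (spread n B b) = (\<Sum>i<n. i * Suc B + b i)"
    by (simp add: spread_def interv_sum_list_conv_sum_set_nat lessThan_atLeast0)
  also have "\<dots> \<le> (\<Sum>i<n. n * Suc B)"
  proof (rule sum_mono)
    fix i assume i: "i \<in> {..<n}"
    then have "b i \<le> B" using assms by auto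
    then have "i * Suc B + b i \<le> Suc i * Suc B" by simp
    also have "\<dots> \<le> n * Suc B" using i by (intro mult_le_mono1) auto
    finally show "i * Suc B + b i \<le> n * Suc B" .
  qed
  also have "\<dots> = n * n * Suc B" by (simp add: algebra_simps)
  finally show ?thesis .
qed

text \<open>The parts of \<open>spread n B b\<close> lie in disjoint intervals of length \<open>B + 1\<close>, so that they can only be
  matched in the given order.\<close>

lemma lookup_injsum_spread:
  assumes b: "b \<in> PiE {..<n} (\<lambda>_. {..B})" and b': "b' \<in> PiE {..<n} (\<lambda>_. {..B})"
  shows "Poly_Mapping.lookup (injsum n (spread n B b)) (list_exps [0..<n] (spread n B b')) = (if b = b' then 1 else 0)"
proof -
  have le: "b i \<le> B" "b' i \<le> B" if "i < n" for i
    using b b' that by auto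
  have nth: "spread n B c ! i = i * Suc B + c i" if "i < n" for i c
    using that by (simp add: spread_def)
  have eq: "ss = [0..<n] \<and> b = b'" if ss: "ss \<in> dlists n n" "list_exps ss (spread n B b) = list_exps [0..<n] (spread n B b')" for ss
  proof -
    have len: "length ss = n" "distinct ss" "\<And>i. i < n \<Longrightarrow> ss ! i < n"
      using ss(1) by (auto simp: dlists_def) (metis lessThan_iff nth_mem subsetD)
    have step: "ss ! i = i \<and> b i = b' i" if i: "i < n" for i
    proof -
      have "i * Suc B + b i = Poly_Mapping.lookup (list_exps ss (spread n B b)) (ss ! i)"
        using lookup_list_exps[of ss "spread n B b" i] len i by (simp add: nth)
      also have "\<dots> = ss ! i * Suc B + b' (ss ! i)"
        using lookup_list_exps[of "[0..<n]" "spread n B b'" "ss ! i"] len(3)[OF i] by (simp add: ss(2) nth)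
      finally have e: "i * Suc B + b i = ss ! i * Suc B + b' (ss ! i)" .
      have "(i * Suc B + b i) div Suc B = i" "(ss ! i * Suc B + b' (ss ! i)) div Suc B = ss ! i"
        using le[OF i] le[OF len(3)[OF i]] by (simp_all only: div_mult_self3 div_less less_Suc_eq_le nat.distinct add_0_right not_False_eq_True)
      with e have "ss ! i = i" by simp
      with e show ?thesis by simp
    qed
    have "ss = [0..<n]" using len step by (intro nth_equalityI) auto
    moreover have "b = b'"
    proof
      fix i show "b i = b' i" using step[of i] PiE_arb[OF b, of i] PiE_arb[OF b', of i] by (cases "i < n") auto
    qed
    ultimately show ?thesis by simp
  qed
  have "Poly_Mapping.lookup (injsum n (spread n B b)) (list_exps [0..<n] (spread n B b')) =
      (\<Sum>ss\<in>dlists n n. if ss = [0..<n] then (if b = b' then 1 else 0) else 0)"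
    unfolding injsum_eq lookup_sum
    by (intro sum.cong) (use eq in \<open>auto simp: lookup_single when_def\<close>)
  moreover have "[0..<n] \<in> dlists n n" by (auto simp: dlists_def)
  ultimately show ?thesis by simp
qed

lemma injsum_spread_independent:
  assumes z: "(\<Sum>b\<in>PiE {..<n} (\<lambda>_. {..B}). zconst (c b) * injsum n (spread n B b)) = 0"
    and b: "b \<in> PiE {..<n} (\<lambda>_. {..B})"
  shows "c b = 0"
proof -
  have "0 = (\<Sum>b'\<in>PiE {..<n} (\<lambda>_. {..B}).
      c b' * Poly_Mapping.lookup (injsum n (spread n B b')) (list_exps [0..<n] (spread n B b)))"
    using arg_cong[OF z, of "\<lambda>p. Poly_Mapping.lookup p (list_exps [0..<n] (spread n B b))"]
    by (simp only: lookup_sum lookup_zconst_mult lookup_zero)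
  also have "\<dots> = (\<Sum>b'\<in>PiE {..<n} (\<lambda>_. {..B}). if b' = b then c b else 0)"
    by (intro sum.cong refl) (simp add: lookup_injsum_spread[OF _ b])
  also have "\<dots> = c b" using b by (subst sum.delta) (auto simp: finite_PiE)
  finally show ?thesis by simp
qed

subsection \<open>The module over the polynomial algebra\<close>

lemma Oalg_add: "F \<in> Oalg N lam \<Longrightarrow> G \<in> Oalg N lam \<Longrightarrow> F + G \<in> Oalg N lam"
  using Poly_Mapping.keys_add[of F G] by (fastforce simp: Oalg_def)

lemma Oalg_mult:
  assumes "F \<in> Oalg N lam" "G \<in> Oalg N lam"
  shows "F * G \<in> Oalg N lam"
  unfolding Oalg_def mem_Collect_eq
proof
  fix m assume "m \<in> Poly_Mapping.keys (F * G)"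
  then obtain a b where ab: "m = a + b" "a \<in> Poly_Mapping.keys F" "b \<in> Poly_Mapping.keys G"
    using Poly_Mapping.keys_mult[of F G] by blast
  then have "Poly_Mapping.keys m \<subseteq> Poly_Mapping.keys a \<union> Poly_Mapping.keys b"
    using Poly_Mapping.keys_add[of a b] by simp
  moreover have "Poly_Mapping.keys a \<subseteq> Ogens N lam" "Poly_Mapping.keys b \<subseteq> Ogens N lam"
    using assms ab by (simp_all add: Oalg_def)
  ultimately show "Poly_Mapping.keys m \<subseteq> Ogens N lam" by blast
qed

lemma Oalg_single: "Poly_Mapping.keys m \<subseteq> Ogens N lam \<Longrightarrow> Poly_Mapping.single m c \<in> Oalg N lam"
  by (simp add: Oalg_def)

lemma Oalg_oconst: "oconst c \<in> Oalg N lam"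
  by (simp add: oconst_def Oalg_single)

lemma Oalg_zero: "0 \<in> Oalg N lam"
  by (simp add: Oalg_def)

lemma Oalg_sum: "(\<And>i. i \<in> I \<Longrightarrow> F i \<in> Oalg N lam) \<Longrightarrow> (\<Sum>i\<in>I. F i) \<in> Oalg N lam"
  by (induction I rule: infinite_finite_induct) (auto simp: Oalg_add Oalg_zero)

lemma single_expansion:
  assumes "finite S" "Poly_Mapping.keys F \<subseteq> S"
  shows "F = (\<Sum>m\<in>S. Poly_Mapping.single m (Poly_Mapping.lookup F m))"
  by (rule poly_mapping_eqI)
     (use assms in \<open>auto simp: lookup_sum lookup_single when_def in_keys_iff\<close>)

lemma zconst_simps: "zconst 0 = 0" "zconst 1 = 1" "zconst (a * b) = zconst a * zconst b"
  "zconst (a + b) = zconst a + zconst b" "zconst (- a) = - zconst a"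
  by (simp_all add: zconst_def mult_single single_add single_uminus)

lemma lookup_oconst_mult: "Poly_Mapping.lookup (oconst c * p) m = c * Poly_Mapping.lookup p m"
  unfolding oconst_def mult_map_scale_conv_mult[symmetric]
  by (simp add: Poly_Mapping.map.rep_eq when_def)

definition low_mons :: "nat \<Rightarrow> (nat \<Rightarrow> nat) \<Rightarrow> nat \<Rightarrow> ((nat \<times> nat) \<Rightarrow>\<^sub>0 nat) set" where
  "low_mons N lam D = (\<Union>d\<le>D. wmons (Ogens N lam) d)"

lemma low_mons_iff: "m \<in> low_mons N lam D \<longleftrightarrow> Poly_Mapping.keys m \<subseteq> Ogens N lam \<and> wdeg m \<le> D"
  by (auto simp: low_mons_def wmons_def)

lemma finite_wmons_Ogens [simp]: "finite (wmons (Ogens N lam) d)"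
  by (rule finite_wmons) (use Ogens_snd in auto)

lemma finite_low_mons [simp]: "finite (low_mons N lam D)"
  by (simp add: low_mons_def)

lemma card_low_mons: "card (low_mons N lam D) = (\<Sum>d\<le>D. card (wmons (Ogens N lam) d))"
  unfolding low_mons_def by (rule card_UN_disjoint) (simp_all, auto simp: wmons_def)

lemma partition_antitone: "is_partition N lam \<Longrightarrow> lam (Suc i) \<le> lam i"
  by (simp add: is_partition_def)

text \<open>There are \<open>(B + 1)\<^sup>n\<close> vectors \<open>spread n B b\<close> of degree at most \<open>D\<close>, but the quotient of the
  polynomial ring \<open>Oalg\<close> by a principal ideal grows only like \<open>D\<^bsup>n-1\<^esup>\<close>.\<close>

lemma low_mons_growth:
  assumes "is_partition N lam" and n: "n = (\<Sum>i<N. lam i)" and f0: "n = 0 \<Longrightarrow> f = 0"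
  obtains B where "f \<le> n * n * Suc B"
    "card (low_mons N lam (n * n * Suc B)) < Suc B ^ n + card (low_mons N lam (n * n * Suc B - f))"
proof -
  \<comment> \<open>Chosen so that \<open>Suc D \<le> C * Suc B\<close>. Then
    \<open>f * Suc D ^ (n - 1)\<close> is at most \<open>f * C ^ (n - 1) * Suc B ^ (n - 1)\<close>,
    and the choice of \<open>B\<close> turns this into \<open>B * Suc B ^ (n - 1)\<close>, just
    below \<open>Suc B ^ n\<close>.\<close>
  define C where "C = Suc (n * n)"
  define B where "B = f * C ^ (n - 1)"
  define D where "D = n * n * Suc B"
  have cO: "card (Ogens N lam) = n"
    unfolding n by (rule card_Ogens) (rule partition_antitone[OF assms(1)])
  have fD: "f \<le> D"
  proof (cases "n = 0")
    case False
    have "f * 1 \<le> B" unfolding B_def by (rule mult_le_mono2) (simp add: C_def)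
    also have "B \<le> 1 * Suc B" by simp
    also have "\<dots> \<le> D" unfolding D_def using False by (intro mult_le_mono1) (simp add: Suc_le_eq)
    finally show ?thesis by simp
  qed (use f0 in simp)
  have split: "{..D} = {..D - f} \<union> {D - f<..D}" by auto
  have "card (low_mons N lam D) = card (low_mons N lam (D - f)) + (\<Sum>d\<in>{D - f<..D}. card (wmons (Ogens N lam) d))"
    unfolding card_low_mons by (subst split, rule sum.union_disjoint) auto
  moreover have "(\<Sum>d\<in>{D - f<..D}. card (wmons (Ogens N lam) d)) < Suc B ^ n"
  proof (cases "f = 0")
    case False
    then have "n \<noteq> 0" using f0 by blast
    then have n1: "n \<ge> 1" by simp
    have "Ogens N lam \<noteq> {}" using cO \<open>n \<noteq> 0\<close> by (metis card.empty)
    then obtain g0 where g0: "g0 \<in> Ogens N lam" by blast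
    have "card (wmons (Ogens N lam) d) \<le> Suc D ^ (n - 1)" if "d \<in> {D - f<..D}" for d
    proof -
      have "card (wmons (Ogens N lam) d) \<le> Suc d ^ (card (Ogens N lam) - 1)"
        by (rule wmons_card_le(2)[OF finite_Ogens _ g0]) (rule Ogens_snd)
      also have "\<dots> \<le> Suc D ^ (n - 1)" unfolding cO using that by (intro power_mono) auto
      finally show ?thesis .
    qed
    then have "(\<Sum>d\<in>{D - f<..D}. card (wmons (Ogens N lam) d)) \<le> card {D - f<..D} * Suc D ^ (n - 1)"
      using sum_bounded_above[of "{D - f<..D}" "\<lambda>d. card (wmons (Ogens N lam) d)"] by simp
    also have "card {D - f<..D} = f" using fD by simp
    also have "Suc D \<le> C * Suc B" by (simp add: D_def C_def)
    then have "f * Suc D ^ (n - 1) \<le> f * (C * Suc B) ^ (n - 1)" by (intro mult_le_mono2 power_mono) auto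
    also have "\<dots> = f * C ^ (n - 1) * Suc B ^ (n - 1)" by (simp only: power_mult_distrib mult.assoc)
    also have "\<dots> = B * Suc B ^ (n - 1)" by (simp only: B_def)
    also have "\<dots> < Suc B * Suc B ^ (n - 1)" by simp
    also have "\<dots> = Suc B ^ n" using n1 by (simp flip: power_Suc)
    finally show ?thesis .
  qed simp
  ultimately have "card (low_mons N lam D) < Suc B ^ n + card (low_mons N lam (D - f))" by linarith
  with fD that show ?thesis by (simp add: D_def)
qed

locale bethe_module =
  fixes N :: nat and lam :: "nat \<Rightarrow> nat" and tau :: "opoly \<Rightarrow> vop" and v :: vvec and n :: nat
  assumes n_def: "n = (\<Sum>i<N. lam i)"
    and N_pos: "1 \<le> N"
    and lam_part: "is_partition N lam"
    and tau_maps: "\<And>F x. F \<in> Oalg N lam \<Longrightarrow> x \<in> MM N lam \<Longrightarrow> tau F x \<in> MM N lam"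
    and tau_one: "\<And>x. x \<in> MM N lam \<Longrightarrow> tau 1 x = x"
    and tau_add: "\<And>F G x. F \<in> Oalg N lam \<Longrightarrow> G \<in> Oalg N lam \<Longrightarrow> x \<in> MM N lam \<Longrightarrow>
                   tau (F + G) x = vadd (tau F x) (tau G x)"
    and tau_scale: "\<And>F c x. F \<in> Oalg N lam \<Longrightarrow> x \<in> MM N lam \<Longrightarrow> tau (oconst c * F) x = vscale c (tau F x)"
    and tau_mult: "\<And>F G x. F \<in> Oalg N lam \<Longrightarrow> G \<in> Oalg N lam \<Longrightarrow> x \<in> MM N lam \<Longrightarrow>
                   tau (F * G) x = tau F (tau G x)"
    and tau_graded: "\<And>F d e x. F \<in> Oalg N lam \<Longrightarrow> ohom d F \<Longrightarrow> x \<in> MM N lam \<Longrightarrow> vhom e x \<Longrightarrow>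
                      vhom (d + e) (tau F x)"
    and tau_onto: "\<And>T. T \<in> bethe_alg N n \<Longrightarrow> \<exists>F\<in>Oalg N lam. \<forall>x\<in>MM N lam. tau F x = T x"
    and v_in: "v \<in> MM N lam"
    and v_nz: "v \<noteq> (\<lambda>w. 0)"
    and v_hom: "vhom (lowdeg N lam) v"
begin

lemma tau_zero: "x \<in> MM N lam \<Longrightarrow> tau 0 x = (\<lambda>w. 0)"
  using tau_scale[OF Oalg_zero, of x 0] by (simp add: vscale_def zconst_simps)

lemma tau_combination:
  assumes "finite S" "\<And>s. s \<in> S \<Longrightarrow> F s \<in> Oalg N lam" "x \<in> MM N lam"
  shows "tau (\<Sum>s\<in>S. oconst (c s) * F s) x w = (\<Sum>s\<in>S. zconst (c s) * tau (F s) x w)"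
  using assms(1,2)
proof (induction S)
  case empty
  show ?case using assms(3) by (simp add: tau_zero)
next
  case (insert s S)
  have O: "oconst (c s) * F s \<in> Oalg N lam" "(\<Sum>s\<in>S. oconst (c s) * F s) \<in> Oalg N lam"
    using insert.prems by (auto intro!: Oalg_sum Oalg_mult Oalg_oconst)
  have "tau (\<Sum>s\<in>insert s S. oconst (c s) * F s) x w =
      tau (oconst (c s) * F s) x w + tau (\<Sum>s\<in>S. oconst (c s) * F s) x w"
    using insert.hyps tau_add[OF O assms(3)] by (simp add: vadd_def)
  also have "tau (oconst (c s) * F s) x w = zconst (c s) * tau (F s) x w"
    using tau_scale[of "F s" x "c s"] insert.prems assms(3) by (simp add: vscale_def)
  also have "tau (\<Sum>s\<in>S. oconst (c s) * F s) x w = (\<Sum>s\<in>S. zconst (c s) * tau (F s) x w)"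
    by (rule insert.IH) (use insert.prems in auto)
  finally show ?case using insert.hyps by simp
qed

definition vmon :: "((nat \<times> nat) \<Rightarrow>\<^sub>0 nat) \<Rightarrow> vvec" where
  "vmon m = tau (Poly_Mapping.single m 1) v"

lemma tau_expansion:
  assumes "F \<in> Oalg N lam" "finite S" "Poly_Mapping.keys F \<subseteq> S" "\<And>m. m \<in> S \<Longrightarrow> Poly_Mapping.keys m \<subseteq> Ogens N lam"
  shows "tau F v w = (\<Sum>m\<in>S. zconst (Poly_Mapping.lookup F m) * vmon m w)"
proof -
  have "F = (\<Sum>m\<in>S. oconst (Poly_Mapping.lookup F m) * Poly_Mapping.single m 1)"
    using single_expansion[OF assms(2,3)] by (simp add: oconst_def mult_single)
  then have "tau F v w = tau (\<Sum>m\<in>S. oconst (Poly_Mapping.lookup F m) * Poly_Mapping.single m 1) v w"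
    by simp
  also have "\<dots> = (\<Sum>m\<in>S. zconst (Poly_Mapping.lookup F m) * vmon m w)"
    unfolding vmon_def by (rule tau_combination) (use assms v_in Oalg_single in auto)
  finally show ?thesis .
qed

lemma vmon_hom:
  assumes "Poly_Mapping.keys m \<subseteq> Ogens N lam"
  shows "vhom (wdeg m + lowdeg N lam) (vmon m)"
  unfolding vmon_def
  by (rule tau_graded[OF Oalg_single[OF assms] _ v_in v_hom]) (simp add: ohom_def)

definition mult_ops :: "zpoly set" where
  "mult_ops = {P. \<exists>F\<in>Oalg N lam. \<forall>x\<in>MM N lam. tau F x = (\<lambda>w. P * x w)}"

lemma mult_ops_add:
  assumes "P \<in> mult_ops" "Q \<in> mult_ops"
  shows "P + Q \<in> mult_ops"
proof -
  obtain F G where F: "F \<in> Oalg N lam" "\<And>x. x \<in> MM N lam \<Longrightarrow> tau F x = (\<lambda>w. P * x w)"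
    and G: "G \<in> Oalg N lam" "\<And>x. x \<in> MM N lam \<Longrightarrow> tau G x = (\<lambda>w. Q * x w)"
    using assms by (auto simp: mult_ops_def)
  have "tau (F + G) x = (\<lambda>w. (P + Q) * x w)" if x: "x \<in> MM N lam" for x
    using tau_add[OF F(1) G(1) x] F(2)[OF x] G(2)[OF x] by (simp add: vadd_def distrib_right)
  with Oalg_add[OF F(1) G(1)] show ?thesis by (auto simp: mult_ops_def)
qed

lemma mult_ops_mult:
  assumes "P \<in> mult_ops" "Q \<in> mult_ops"
  shows "P * Q \<in> mult_ops"
proof -
  obtain F G where F: "F \<in> Oalg N lam" "\<And>x. x \<in> MM N lam \<Longrightarrow> tau F x = (\<lambda>w. P * x w)"
    and G: "G \<in> Oalg N lam" "\<And>x. x \<in> MM N lam \<Longrightarrow> tau G x = (\<lambda>w. Q * x w)"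
    using assms by (auto simp: mult_ops_def)
  have "tau (F * G) x = (\<lambda>w. P * Q * x w)" if x: "x \<in> MM N lam" for x
    using tau_mult[OF F(1) G(1) x] F(2)[OF tau_maps[OF G(1) x]] G(2)[OF x] by (simp add: mult.assoc)
  with Oalg_mult[OF F(1) G(1)] show ?thesis by (auto simp: mult_ops_def)
qed

lemma mult_ops_zconst: "zconst c \<in> mult_ops"
proof -
  have "tau (oconst c * 1) x = (\<lambda>w. zconst c * x w)" if "x \<in> MM N lam" for x
    using tau_scale[of 1 x c] tau_one[OF that] that Oalg_oconst[of 1] by (simp add: vscale_def oconst_def)
  then show ?thesis using Oalg_oconst[of c] by (auto simp: mult_ops_def)
qed

lemma mult_ops_diff:
  assumes "P \<in> mult_ops" "Q \<in> mult_ops"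
  shows "P - Q \<in> mult_ops"
proof -
  have eq: "P - Q = P + zconst (- 1) * Q" by (simp add: zconst_simps)
  show ?thesis unfolding eq by (intro mult_ops_add mult_ops_mult mult_ops_zconst assms)
qed

lemma mult_ops_sum: "(\<And>i. i \<in> I \<Longrightarrow> P i \<in> mult_ops) \<Longrightarrow> (\<Sum>i\<in>I. P i) \<in> mult_ops"
  using mult_ops_zconst[of 0]
  by (induction I rule: infinite_finite_induct) (auto simp: mult_ops_add zconst_simps)

lemma power_sum_mult_ops: "(\<Sum>s<n. zvar s ^ k) \<in> mult_ops"
proof -
  have "Bop N n 1 (Suc k) \<in> bethe_alg N n"
    by (rule bethe_alg.gen) (use N_pos in auto)
  from tau_onto[OF this] obtain F where F: "F \<in> Oalg N lam" "\<And>x. x \<in> MM N lam \<Longrightarrow> tau F x = Bop N n 1 (Suc k) x"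
    by blast
  have "Bop N n 1 (Suc k) x = (\<lambda>w. - (\<Sum>s<n. zvar s ^ k) * x w)" if "x \<in> MM N lam" for x
    by (rule ext, rule Bop_1_VV[OF N_pos]) (use that in \<open>auto simp: MM_def Let_def n_def\<close>)
  with F have "- (\<Sum>s<n. zvar s ^ k) \<in> mult_ops" by (auto simp: mult_ops_def)
  from mult_ops_diff[OF mult_ops_zconst[of 0] this] show ?thesis by (simp add: zconst_simps)
qed

text \<open>Every sum on the right of \<open>injsum_Cons\<close> has one part fewer, so the
  induction ends in power sums and constants.\<close>

lemma injsum_mult_ops: "injsum n as \<in> mult_ops"
proof (induction "length as" arbitrary: as)
  case 0
  have "injsum n [] = zconst 1" by (simp add: injsum_def dlists_def zconst_simps cong: conj_cong)
  with 0 show ?case by (simp add: mult_ops_zconst)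
next
  case (Suc r)
  then obtain b as' where as: "as = b # as'" "length as' = r" by (cases as) auto
  show ?case
    unfolding as(1) injsum_Cons
    by (intro mult_ops_diff mult_ops_mult mult_ops_sum power_sum_mult_ops Suc.hyps(1)) (use as in auto)
qed

text \<open>The counting in \<open>mu_kernel\<close> needs a preimage of controlled weight. As
  \<open>tau\<close> is graded and \<open>v\<close> homogeneous, only the component of weight
  \<open>sum_list as\<close> can contribute to the degree of \<open>injsum n as * v w\<close>, and
  the others may be dropped.\<close>

lemma injsum_homogeneous_preimage:
  "\<exists>F\<in>Oalg N lam. Poly_Mapping.keys F \<subseteq> low_mons N lam (sum_list as) \<and> tau F v = (\<lambda>w. injsum n as * v w)"
proof -
  obtain F where F: "F \<in> Oalg N lam" "tau F v = (\<lambda>w. injsum n as * v w)"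
    using injsum_mult_ops[of as] v_in by (auto simp: mult_ops_def)
  define S where "S = Poly_Mapping.keys F"
  define S0 where "S0 = {m \<in> S. wdeg m = sum_list as}"
  have SO: "Poly_Mapping.keys m \<subseteq> Ogens N lam" if "m \<in> S" for m
    using F(1) that by (auto simp: S_def Oalg_def)
  have finS: "finite S" by (simp add: S_def)
  have finS0: "finite S0" using finS by (simp add: S0_def)
  define G where "G = (\<Sum>m\<in>S0. oconst (Poly_Mapping.lookup F m) * Poly_Mapping.single m 1)"
  have GO: "G \<in> Oalg N lam"
    unfolding G_def by (intro Oalg_sum Oalg_mult Oalg_oconst Oalg_single) (use SO in \<open>auto simp: S0_def\<close>)
  have "Poly_Mapping.keys G \<subseteq> (\<Union>m\<in>S0. Poly_Mapping.keys (oconst (Poly_Mapping.lookup F m) * Poly_Mapping.single m 1))"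
    unfolding G_def by (rule Poly_Mapping.keys_sum)
  also have "\<dots> \<subseteq> S0" by (auto simp: oconst_def mult_single split: if_splits)
  finally have "Poly_Mapping.keys G \<subseteq> S0" .
  then have Glow: "Poly_Mapping.keys G \<subseteq> low_mons N lam (sum_list as)"
    using SO by (auto simp: low_mons_iff S0_def)
  have tG: "tau G v w = (\<Sum>m\<in>S0. zconst (Poly_Mapping.lookup F m) * vmon m w)" for w
    unfolding G_def vmon_def
    by (rule tau_combination[OF finS0 _ v_in]) (use SO Oalg_single in \<open>auto simp: S0_def\<close>)
  have vm0: "Poly_Mapping.lookup (vmon m w) \<kappa> = 0" if "m \<in> S" "mdeg \<kappa> \<noteq> wdeg m + lowdeg N lam" for m w \<kappa>
  proof -
    have "\<kappa> \<notin> Poly_Mapping.keys (vmon m w)"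
      using vmon_hom[OF SO[OF that(1)]] that(2) by (auto simp: vhom_def)
    then show ?thesis by (simp add: in_keys_iff)
  qed
  have "tau G v w = tau F v w" for w
  proof (rule poly_mapping_eqI)
    fix \<kappa>
    have "tau F v w = (\<Sum>m\<in>S. zconst (Poly_Mapping.lookup F m) * vmon m w)"
      by (rule tau_expansion[OF F(1) finS _ SO]) (simp_all add: S_def)
    then have F': "Poly_Mapping.lookup (tau F v w) \<kappa> =
        (\<Sum>m\<in>S. Poly_Mapping.lookup F m * Poly_Mapping.lookup (vmon m w) \<kappa>)"
      by (simp only: lookup_sum lookup_zconst_mult)
    have G': "Poly_Mapping.lookup (tau G v w) \<kappa> =
        (\<Sum>m\<in>S0. Poly_Mapping.lookup F m * Poly_Mapping.lookup (vmon m w) \<kappa>)"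
      by (simp only: tG lookup_sum lookup_zconst_mult)
    show "Poly_Mapping.lookup (tau G v w) \<kappa> = Poly_Mapping.lookup (tau F v w) \<kappa>"
    proof (cases "mdeg \<kappa> = sum_list as + lowdeg N lam")
      case True
      have "Poly_Mapping.lookup (vmon m w) \<kappa> = 0" if "m \<in> S - S0" for m
        by (rule vm0) (use that True in \<open>auto simp: S0_def\<close>)
      then show ?thesis unfolding F' G'
        by (intro sum.mono_neutral_left[OF finS]) (simp_all add: S0_def)
    next
      case False
      have "\<kappa> \<notin> Poly_Mapping.keys (injsum n as * v w)"
      proof
        assume "\<kappa> \<in> Poly_Mapping.keys (injsum n as * v w)"
        then obtain a b where "\<kappa> = a + b" "a \<in> Poly_Mapping.keys (injsum n as)" "b \<in> Poly_Mapping.keys (v w)"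
          using Poly_Mapping.keys_mult[of "injsum n as" "v w"] by blast
        then show False using False injsum_mdeg[of a n as] v_hom by (auto simp: mdeg_add vhom_def)
      qed
      then have "Poly_Mapping.lookup (tau F v w) \<kappa> = 0" by (simp add: F(2) in_keys_iff)
      moreover have "Poly_Mapping.lookup (tau G v w) \<kappa> = 0"
      proof -
        have "Poly_Mapping.lookup (vmon m w) \<kappa> = 0" if "m \<in> S0" for m
          by (rule vm0) (use that False in \<open>auto simp: S0_def\<close>)
        then show ?thesis unfolding G' by simp
      qed
      ultimately show ?thesis by simp
    qed
  qed
  then have "tau G v = (\<lambda>w. injsum n as * v w)" using F(2) by (simp add: fun_eq_iff)
  with GO Glow show ?thesis by blast
qed

end

section \<open>Injectivity and surjectivity of the map to the module\<close>

context bethe_module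
begin

text \<open>The symmetric sums have preimages \<open>A b\<close>, and the multiples
  \<open>m * F\<close> with \<open>wdeg m \<le> D - f\<close> lie in the kernel. All of these have
  weight at most \<open>D\<close>, and \<open>low_mons_growth\<close> makes them outnumber the
  monomials there, so they satisfy a linear relation. Evaluated at \<open>v\<close>, it becomes a
  relation among the symmetric sums alone.\<close>

theorem mu_kernel:
  assumes F: "F \<in> Oalg N lam" and z: "tau F v = (\<lambda>w. 0)"
  shows "F = 0"
proof (rule ccontr)
  assume nz: "F \<noteq> 0"
  define f where "f = Max (wdeg ` Poly_Mapping.keys F)"
  have f_ge: "wdeg m \<le> f" if "m \<in> Poly_Mapping.keys F" for m
    unfolding f_def by (rule Max_ge) (use that in auto)
  have "f = 0" if "n = 0"
  proof -
    have "card (Ogens N lam) = 0"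
      using card_Ogens[of N lam] partition_antitone[OF lam_part] that by (simp add: n_def)
    then have "Ogens N lam = {}" by simp
    then have "m = 0" if "m \<in> Poly_Mapping.keys F" for m
      using F that by (auto simp: Oalg_def)
    moreover have "Poly_Mapping.keys F \<noteq> {}" using nz by simp
    ultimately have "Poly_Mapping.keys F = {0}" by blast
    then show ?thesis by (simp add: f_def)
  qed
  then obtain B where B: "f \<le> n * n * Suc B"
    "card (low_mons N lam (n * n * Suc B)) < Suc B ^ n + card (low_mons N lam (n * n * Suc B - f))"
    by (rule low_mons_growth[OF lam_part n_def])
  define D where "D = n * n * Suc B"
  define Bs where "Bs = PiE {..<n} (\<lambda>_. {..B})"
  have finB: "finite Bs" by (simp add: Bs_def finite_PiE)
  have cardB: "card Bs = Suc B ^ n" by (simp add: Bs_def card_PiE)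
  have "\<forall>b. \<exists>F. F \<in> Oalg N lam \<and> Poly_Mapping.keys F \<subseteq> low_mons N lam (sum_list (spread n B b)) \<and>
      tau F v = (\<lambda>w. injsum n (spread n B b) * v w)"
    using injsum_homogeneous_preimage by blast
  from choice[OF this] obtain A where A: "\<And>b. A b \<in> Oalg N lam"
    "\<And>b. Poly_Mapping.keys (A b) \<subseteq> low_mons N lam (sum_list (spread n B b))"
    "\<And>b. tau (A b) v = (\<lambda>w. injsum n (spread n B b) * v w)"
    by blast
  define L where "L = low_mons N lam (D - f)"
  define a where "a s = (case s of Inl b \<Rightarrow> A b | Inr m \<Rightarrow> Poly_Mapping.single m 1 * F)" for s
  obtain c where c: "\<exists>s\<in>Bs <+> L. c s \<noteq> 0"
    "\<forall>k\<in>low_mons N lam D. (\<Sum>s\<in>Bs <+> L. c s * Poly_Mapping.lookup (a s) k) = 0"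
  proof -
    have "card (low_mons N lam D) < card (Bs <+> L)"
      using B(2) finB by (simp add: card_Plus cardB L_def D_def)
    from homogeneous_system_nontrivial[OF _ _ this, of "\<lambda>s. Poly_Mapping.lookup (a s)"] finB that
    show ?thesis by (auto simp: L_def)
  qed
  have aO: "a s \<in> Oalg N lam" if "s \<in> Bs <+> L" for s
    using that A(1) F by (auto simp: a_def L_def low_mons_iff intro!: Oalg_mult Oalg_single)
  have akeys: "Poly_Mapping.keys (a s) \<subseteq> low_mons N lam D" if s: "s \<in> Bs <+> L" for s
  proof
    fix k assume k: "k \<in> Poly_Mapping.keys (a s)"
    then have "Poly_Mapping.keys k \<subseteq> Ogens N lam" using aO[OF s] by (auto simp: Oalg_def)
    moreover have "wdeg k \<le> D"
    proof (cases s)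
      case (Inl b)
      then have "b \<in> PiE {..<n} (\<lambda>_. {..B})" using s by (auto simp: Bs_def)
      then have "sum_list (spread n B b) \<le> D" unfolding D_def by (rule sum_list_spread)
      moreover have "k \<in> low_mons N lam (sum_list (spread n B b))" using A(2)[of b] k Inl by (auto simp: a_def)
      ultimately show ?thesis by (simp add: low_mons_iff)
    next
      case (Inr m)
      then have m: "wdeg m \<le> D - f" using s by (auto simp: L_def low_mons_iff)
      have "k \<in> Poly_Mapping.keys (Poly_Mapping.single m 1 * F)" using k Inr by (simp add: a_def)
      then obtain y where "k = m + y" "y \<in> Poly_Mapping.keys F"
        using Poly_Mapping.keys_mult[of "Poly_Mapping.single m 1" F] by auto
      then show ?thesis using m f_ge[of y] B(1) by (simp add: wdeg_add D_def)
    qed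
    ultimately show "k \<in> low_mons N lam D" by (simp add: low_mons_iff)
  qed
  have finS: "finite (Bs <+> L)" using finB by (simp add: L_def)
  have rel: "(\<Sum>s\<in>Bs <+> L. oconst (c s) * a s) = 0"
  proof (rule poly_mapping_eqI)
    fix k
    have "Poly_Mapping.lookup (\<Sum>s\<in>Bs <+> L. oconst (c s) * a s) k = (\<Sum>s\<in>Bs <+> L. c s * Poly_Mapping.lookup (a s) k)"
      by (simp add: lookup_sum lookup_oconst_mult)
    also have "\<dots> = 0"
    proof (cases "k \<in> low_mons N lam D")
      case False
      then have "Poly_Mapping.lookup (a s) k = 0" if "s \<in> Bs <+> L" for s
        using akeys[OF that] by (meson in_keys_iff subsetD)
      then show ?thesis by simp
    qed (use c in simp)
    finally show "Poly_Mapping.lookup (\<Sum>s\<in>Bs <+> L. oconst (c s) * a s) k = Poly_Mapping.lookup 0 k" by simp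
  qed
  have tInr: "tau (a (Inr m)) v w = 0" if "m \<in> L" for m w
  proof -
    have mO: "Poly_Mapping.single m 1 \<in> Oalg N lam" using that by (simp add: L_def low_mons_iff Oalg_single)
    have "tau (a (Inr m)) v = tau F (tau (Poly_Mapping.single m 1) v)"
      unfolding a_def using tau_mult[OF F mO v_in] by (simp add: mult.commute)
    also have "\<dots> = tau (Poly_Mapping.single m 1) (tau F v)"
      using tau_mult[OF F mO v_in] tau_mult[OF mO F v_in] by (simp add: mult.commute)
    \<comment> \<open>The assumptions on \<open>tau\<close> concern its polynomial argument, not
      linearity in the vector. Writing the zero vector as \<open>tau 0 v\<close> reduces the claim
      to multiplicativity.\<close>
    also have "\<dots> = tau (Poly_Mapping.single m 1) (tau 0 v)" by (simp add: z tau_zero[OF v_in])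
    also have "\<dots> = tau (Poly_Mapping.single m 1 * 0) v" by (rule tau_mult[OF mO Oalg_zero v_in, symmetric])
    also have "\<dots> = (\<lambda>w. 0)" by (simp add: tau_zero[OF v_in])
    finally show ?thesis by simp
  qed
  have "(\<Sum>b\<in>Bs. zconst (c (Inl b)) * injsum n (spread n B b)) * v w = 0" for w
  proof -
    have "0 = tau (\<Sum>s\<in>Bs <+> L. oconst (c s) * a s) v w" by (simp add: rel tau_zero[OF v_in])
    also have "\<dots> = (\<Sum>s\<in>Bs <+> L. zconst (c s) * tau (a s) v w)"
      by (rule tau_combination[OF finS aO v_in])
    also have "\<dots> = (\<Sum>b\<in>Bs. zconst (c (Inl b)) * tau (a (Inl b)) v w) + (\<Sum>m\<in>L. zconst (c (Inr m)) * tau (a (Inr m)) v w)"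
      using finB by (subst sum.Plus) (simp_all add: L_def)
    also have "(\<Sum>m\<in>L. zconst (c (Inr m)) * tau (a (Inr m)) v w) = 0"
      by (rule sum.neutral) (simp add: tInr)
    finally show ?thesis by (simp add: a_def A(3) sum_distrib_right mult.assoc)
  qed
  note prod0 = this
  \<comment> \<open>Torsion-freeness: one nonzero coordinate of \<open>v\<close> can be cancelled in
    the polynomial ring.\<close>
  obtain w where "v w \<noteq> 0" using v_nz by auto
  with prod0[of w] have "(\<Sum>b\<in>Bs. zconst (c (Inl b)) * injsum n (spread n B b)) = 0"
    unfolding mult_eq_0_iff by blast
  then have cb: "c (Inl b) = 0" if "b \<in> Bs" for b
    unfolding Bs_def by (rule injsum_spread_independent) (use that in \<open>simp add: Bs_def\<close>)
  \<comment> \<open>With the coefficients of the symmetric sums gone, the relation is a polynomial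
    times \<open>F\<close>. As \<open>F\<close> is nonzero in a domain, that polynomial is zero, and
    so are all remaining coefficients.\<close>
  have "(\<Sum>s\<in>Bs <+> L. oconst (c s) * a s) =
      (\<Sum>b\<in>Bs. oconst (c (Inl b)) * a (Inl b)) + (\<Sum>m\<in>L. oconst (c (Inr m)) * a (Inr m))"
    using finB by (subst sum.Plus) (simp_all add: L_def)
  also have "(\<Sum>b\<in>Bs. oconst (c (Inl b)) * a (Inl b)) = 0"
    by (rule sum.neutral) (simp add: cb oconst_def)
  also have "(\<Sum>m\<in>L. oconst (c (Inr m)) * a (Inr m)) = (\<Sum>m\<in>L. Poly_Mapping.single m (c (Inr m))) * F"
    by (simp add: a_def sum_distrib_right oconst_def mult_single mult.assoc[symmetric])
  finally have "(\<Sum>m\<in>L. Poly_Mapping.single m (c (Inr m))) * F = 0" using rel by simp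
  with nz have G0: "(\<Sum>m\<in>L. Poly_Mapping.single m (c (Inr m))) = 0" by simp
  have "c (Inr m) = 0" if "m \<in> L" for m
    using arg_cong[OF G0, of "\<lambda>p. Poly_Mapping.lookup p m"] that
    by (simp add: lookup_sum lookup_single when_def L_def)
  with cb c(1) show False by auto
qed

text \<open>Adjoin \<open>x\<close> to the vectors \<open>vmon m\<close> of weight at most
  \<open>D\<close>. There are then more vectors than evaluation points, so some nontrivial
  combination \<open>y\<close> vanishes at all points and hence is zero. Injectivity rules out a
  relation among the \<open>vmon m\<close> alone, so it can be solved for \<open>x\<close>.\<close>

theorem mu_surj:
  assumes x: "x \<in> MM N lam"
  shows "\<exists>F\<in>Oalg N lam. tau F v = x"
proof -
  define d0 where "d0 = lowdeg N lam"
  have "\<exists>E. \<forall>w. \<forall>m\<in>Poly_Mapping.keys (x w). mdeg m \<le> E"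
  proof -
    have finw: "finite (words N n)"
    proof (rule finite_subset)
      show "words N n \<subseteq> (\<lambda>l s. if s < length l then l ! s else 0) ` {l. set l \<subseteq> {..<N} \<and> length l = n}"
      proof
        fix w assume w: "w \<in> words N n"
        have "w = (\<lambda>l s. if s < length l then l ! s else 0) (map w [0..<n])"
          using w by (auto simp: words_def fun_eq_iff)
        then show "w \<in> (\<lambda>l s. if s < length l then l ! s else 0) ` {l. set l \<subseteq> {..<N} \<and> length l = n}"
          by (rule image_eqI) (use w in \<open>auto simp: words_def\<close>)
      qed
    qed (simp add: finite_lists_length_eq)
    define Q where "Q = (\<Union>w\<in>words N n. mdeg ` Poly_Mapping.keys (x w))"
    have "finite Q" using finw by (simp add: Q_def)
    moreover have "mdeg m \<in> Q" if "m \<in> Poly_Mapping.keys (x w)" for w m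
    proof -
      have "x w \<noteq> 0" using that by auto
      then have "w \<in> words N n" using x by (auto simp: MM_def Let_def VV_def n_def)
      then show ?thesis using that by (auto simp: Q_def)
    qed
    ultimately show ?thesis by (intro exI[of _ "Max Q"]) auto
  qed
  then obtain D where D: "\<And>w m. m \<in> Poly_Mapping.keys (x w) \<Longrightarrow> mdeg m \<le> D" by blast
  define S where "S = low_mons N lam D"
  have SO: "Poly_Mapping.keys m \<subseteq> Ogens N lam" "wdeg m \<le> D" if "m \<in> S" for m
    using that by (auto simp: S_def low_mons_iff)
  have finS: "finite S" by (simp add: S_def)
  have "\<forall>e. \<exists>K. finite K \<and> card K \<le> ocount N lam e \<and>
     (\<forall>c\<in>sing_funs N lam e. (\<forall>A\<in>K. c A = 0) \<longrightarrow> c = (\<lambda>A. 0))"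
    by (intro allI sing_funs_determined) (rule partition_antitone[OF lam_part])
  then obtain K where K: "\<And>e. finite (K e)" "\<And>e. card (K e) \<le> ocount N lam e"
    "\<And>e c. c \<in> sing_funs N lam e \<Longrightarrow> (\<forall>A\<in>K e. c A = 0) \<Longrightarrow> c = (\<lambda>A. 0)"
    by metis
  \<comment> \<open>The action on \<open>v\<close> adds \<open>d0\<close> to the weight, so the
    combination \<open>y\<close> has components only in degrees up to \<open>D + d0\<close>.\<close>
  define P where "P = Sigma {..D + d0} K"
  have finP: "finite P" using K(1) by (simp add: P_def)
  have "card P \<le> card S"
  proof -
    have "card P = (\<Sum>e\<le>D + d0. card (K e))" using K(1) by (simp add: P_def)
    also have "\<dots> \<le> (\<Sum>e\<le>D + d0. ocount N lam e)" by (rule sum_mono) (rule K(2))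
    \<comment> \<open>Below \<open>d0\<close> there are no points; after the shift by
      \<open>d0\<close> the counts are those of monomials by weight.\<close>
    also have "\<dots> = (\<Sum>e\<in>{d0..D + d0}. ocount N lam e)"
      by (rule sum.mono_neutral_right) (auto simp: ocount_def d0_def)
    also have "\<dots> = (\<Sum>d\<in>{0..D}. ocount N lam (d + d0))"
      using sum.shift_bounds_cl_nat_ivl[of "ocount N lam" 0 d0 D] by simp
    also have "\<dots> = card S"
      unfolding S_def card_low_mons by (rule sum.cong) (auto simp: ocount_def d0_def)
    finally show ?thesis .
  qed
  \<comment> \<open>\<open>None\<close> indexes \<open>x\<close>, the one vector beyond the
    monomials.\<close>
  define T where "T = insert None (Some ` S)"
  define u where "u t = (case t of None \<Rightarrow> x | Some m \<Rightarrow> vmon m)" for t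
  have "finite T" using finS by (simp add: T_def)
  have cT: "card P < card T" using \<open>card P \<le> card S\<close> finS
    by (simp add: T_def card_insert_if card_image)
  from homogeneous_system_nontrivial[OF finP \<open>finite T\<close> cT, of "\<lambda>t (e, A). ms_coeff n e (u t) A"]
  obtain c where c: "\<exists>t\<in>T. c t \<noteq> 0" "\<forall>k\<in>P. (\<Sum>t\<in>T. c t * (case k of (e, A) \<Rightarrow> ms_coeff n e (u t) A)) = 0"
    by blast
  define G where "G = (\<Sum>m\<in>S. oconst (c (Some m)) * Poly_Mapping.single m 1)"
  have GO: "G \<in> Oalg N lam"
    unfolding G_def by (intro Oalg_sum Oalg_mult Oalg_oconst Oalg_single SO(1))
  have tG: "tau G v w = (\<Sum>m\<in>S. zconst (c (Some m)) * vmon m w)" for w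
    unfolding G_def vmon_def by (rule tau_combination[OF finS _ v_in]) (rule Oalg_single[OF SO(1)])
  define y where "y = vadd (tau G v) (vscale (c None) x)"
  have y: "y \<in> MM N lam"
    unfolding y_def by (intro MM_vadd MM_vscale tau_maps GO v_in x)
  have coeff_y: "ms_coeff n e y A = (\<Sum>t\<in>T. c t * ms_coeff n e (u t) A)" for e A
  proof -
    have "ms_coeff n e (tau G v) A = (\<Sum>m\<in>S. c (Some m) * ms_coeff n e (vmon m) A)"
    proof (cases "size A = n \<and> msdeg A = e")
      case True
      then show ?thesis by (simp add: ms_coeff_def Let_def tG lookup_sum lookup_zconst_mult)
    next
      case False
      then have "ms_coeff n e z A = 0" for z unfolding ms_coeff_def by (rule if_not_P)
      then show ?thesis by simp
    qed
    then show ?thesis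
      using finS by (simp add: y_def ms_coeff_add ms_coeff_scale T_def u_def sum.reindex)
  qed
  have high: "mdeg \<kappa> \<le> D + d0" if "\<kappa> \<in> Poly_Mapping.keys (y w)" for \<kappa> w
  proof (rule ccontr)
    assume neg: "\<not> ?thesis"
    have "\<kappa> \<notin> Poly_Mapping.keys (x w)" using D[of \<kappa> w] neg by auto
    then have 1: "Poly_Mapping.lookup (x w) \<kappa> = 0" by (simp add: in_keys_iff)
    have "Poly_Mapping.lookup (vmon m w) \<kappa> = 0" if "m \<in> S" for m
    proof -
      have "\<kappa> \<notin> Poly_Mapping.keys (vmon m w)"
        using vmon_hom[OF SO(1)[OF that]] SO(2)[OF that] neg by (auto simp: vhom_def d0_def)
      then show ?thesis by (simp add: in_keys_iff)
    qed
    then have "Poly_Mapping.lookup (y w) \<kappa> = 0"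
      by (simp add: y_def vadd_def vscale_def lookup_add lookup_zconst_mult tG lookup_sum 1)
    with that show False by (simp add: in_keys_iff)
  qed
  have "ms_coeff n e y = (\<lambda>A. 0)" for e
  proof (cases "e \<le> D + d0")
    case True
    have "ms_coeff n e y \<in> sing_funs N lam e" unfolding n_def by (rule ms_coeff_sing[OF y])
    moreover have "\<forall>A\<in>K e. ms_coeff n e y A = 0"
    proof
      fix A assume "A \<in> K e"
      then have "(e, A) \<in> P" using True by (simp add: P_def)
      with c(2) show "ms_coeff n e y A = 0" by (fastforce simp: coeff_y)
    qed
    ultimately show ?thesis by (rule K(3))
  next
    case False
    then show ?thesis unfolding n_def by (intro ms_coeff_high[OF y high]) auto
  qed
  then have y0: "y = (\<lambda>w. 0)" by (intro MM_zeroI[OF y]) (simp add: n_def)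
  have c0: "c None \<noteq> 0"
  proof
    assume c0: "c None = 0"
    have "tau G v = (\<lambda>w. 0)"
      using y0 c0 by (simp add: y_def vadd_def vscale_def zconst_simps)
    then have G0: "G = 0" by (rule mu_kernel[OF GO])
    have "c (Some m) = 0" if "m \<in> S" for m
    proof -
      have "Poly_Mapping.lookup G m = c (Some m)"
        using that finS by (simp add: G_def lookup_sum oconst_def mult_single lookup_single when_def)
      with G0 show ?thesis by simp
    qed
    with c(1) c0 show False by (auto simp: T_def)
  qed
  define F where "F = oconst (- 1 / c None) * G"
  have "tau F v = vscale (- 1 / c None) (tau G v)" unfolding F_def by (rule tau_scale[OF GO v_in])
  also have "tau G v = vscale (- c None) x"
  proof
    fix w
    have "tau G v w + zconst (c None) * x w = 0"
      using fun_cong[OF y0, of w] by (simp add: y_def vadd_def vscale_def)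
    then show "tau G v w = vscale (- c None) x w" by (simp add: vscale_def zconst_simps eq_neg_iff_add_eq_0)
  qed
  also have "vscale (- 1 / c None) (vscale (- c None) x) = x"
  proof
    fix w
    have "zconst (- 1 / c None) * zconst (- c None) = 1"
      using c0 by (simp add: zconst_simps(3)[symmetric] zconst_simps(2))
    then show "vscale (- 1 / c None) (vscale (- c None) x) w = x w"
      by (simp add: vscale_def mult.assoc[symmetric])
  qed
  finally have "tau F v = x" .
  moreover have "F \<in> Oalg N lam" unfolding F_def by (intro Oalg_mult Oalg_oconst GO)
  ultimately show ?thesis by blast
qed

end

theorem theorem5p6:
  fixes N :: nat and lam :: "nat \<Rightarrow> nat"
    and tau :: "opoly \<Rightarrow> vop" and v :: vvec
  defines "n \<equiv> (\<Sum>i<N. lam i)"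
  defines "D0 \<equiv> (\<Sum>i<N. i * lam i)"
  defines "M \<equiv> MM N lam"
  defines "Ol \<equiv> Oalg N lam"
  defines "mu \<equiv> (\<lambda>F. tau F v)"
  assumes N_pos: "1 \<le> N"
    and lam_part: "is_partition N lam"
    \<comment> \<open>tau: O_lam \<rightarrow> End(M_lam) is a graded algebra homomorphism ...\<close>
    and tau_maps: "\<And>F x. F \<in> Ol \<Longrightarrow> x \<in> M \<Longrightarrow> tau F x \<in> M"
    and tau_one: "op_eq_on M (tau 1) id"
    and tau_add: "\<And>F G. F \<in> Ol \<Longrightarrow> G \<in> Ol \<Longrightarrow>
                   op_eq_on M (tau (F + G)) (\<lambda>x. vadd (tau F x) (tau G x))"
    and tau_scale: "\<And>F c. F \<in> Ol \<Longrightarrow> op_eq_on M (tau (oconst c * F)) (opscale c (tau F))"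
    and tau_mult: "\<And>F G. F \<in> Ol \<Longrightarrow> G \<in> Ol \<Longrightarrow> op_eq_on M (tau (F * G)) (tau F \<circ> tau G)"
    and tau_graded: "\<And>F d e x. F \<in> Ol \<Longrightarrow> ohom d F \<Longrightarrow> x \<in> M \<Longrightarrow> vhom e x \<Longrightarrow>
                      vhom (d + e) (tau F x)"
    \<comment> \<open>... which is injective with image B_lam ...\<close>
    and tau_inj: "\<And>F G. F \<in> Ol \<Longrightarrow> G \<in> Ol \<Longrightarrow> op_eq_on M (tau F) (tau G) \<Longrightarrow> F = G"
    and tau_into: "\<And>F. F \<in> Ol \<Longrightarrow> \<exists>T\<in>bethe_alg N n. op_eq_on M (tau F) T"
    and tau_onto: "\<And>T. T \<in> bethe_alg N n \<Longrightarrow> \<exists>F\<in>Ol. op_eq_on M (tau F) T"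
    \<comment> \<open>... and sends F_ij to B_ij.\<close>
    and tau_F: "\<And>i j. 1 \<le> i \<Longrightarrow> i \<le> N \<Longrightarrow> 1 \<le> j \<Longrightarrow>
                 op_eq_on M (tau (Fcoef N lam i j)) (Bop N n i j)"
    and v_in: "v \<in> M"
    and v_nz: "v \<noteq> (\<lambda>w. 0)"
    and v_hom: "vhom D0 v"
  shows "bij_betw mu Ol M
       \<and> (\<forall>F\<in>Ol. \<forall>G\<in>Ol. mu (F + G) = vadd (mu F) (mu G))
       \<and> (\<forall>F\<in>Ol. \<forall>c. mu (oconst c * F) = vscale c (mu F))
       \<and> (\<forall>F\<in>Ol. \<forall>d. ohom d F \<longrightarrow> vhom (d + D0) (mu F))
       \<and> (\<forall>F\<in>Ol. \<forall>G\<in>Ol. mu (F * G) = tau F (mu G))"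
proof -
  interpret bethe_module N lam tau v n
  proof
    show "n = (\<Sum>i<N. lam i)" by (simp only: n_def)
    show "1 \<le> N" by (rule N_pos)
    show "is_partition N lam" by (rule lam_part)
    show "v \<in> MM N lam" using v_in unfolding M_def .
    show "v \<noteq> (\<lambda>w. 0)" by (rule v_nz)
    show "vhom (lowdeg N lam) v" using v_hom unfolding D0_def lowdeg_def .
    fix F G x c d e T
    show "F \<in> Oalg N lam \<Longrightarrow> x \<in> MM N lam \<Longrightarrow> tau F x \<in> MM N lam"
      using tau_maps unfolding M_def Ol_def .
    show "x \<in> MM N lam \<Longrightarrow> tau 1 x = x"
      using tau_one unfolding M_def op_eq_on_def by simp
    show "F \<in> Oalg N lam \<Longrightarrow> G \<in> Oalg N lam \<Longrightarrow> x \<in> MM N lam \<Longrightarrow> tau (F + G) x = vadd (tau F x) (tau G x)"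
      using tau_add unfolding M_def Ol_def op_eq_on_def by blast
    show "F \<in> Oalg N lam \<Longrightarrow> x \<in> MM N lam \<Longrightarrow> tau (oconst c * F) x = vscale c (tau F x)"
      using tau_scale unfolding M_def Ol_def op_eq_on_def opscale_def by blast
    show "F \<in> Oalg N lam \<Longrightarrow> G \<in> Oalg N lam \<Longrightarrow> x \<in> MM N lam \<Longrightarrow> tau (F * G) x = tau F (tau G x)"
      using tau_mult unfolding M_def Ol_def op_eq_on_def by simp
    show "F \<in> Oalg N lam \<Longrightarrow> ohom d F \<Longrightarrow> x \<in> MM N lam \<Longrightarrow> vhom e x \<Longrightarrow> vhom (d + e) (tau F x)"
      using tau_graded unfolding M_def Ol_def .
    show "T \<in> bethe_alg N n \<Longrightarrow> \<exists>F\<in>Oalg N lam. \<forall>x\<in>MM N lam. tau F x = T x"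
      using tau_onto unfolding M_def Ol_def op_eq_on_def .
  qed
  have mu: "mu F = tau F v" for F by (simp only: mu_def)
  have D0: "D0 = lowdeg N lam" by (simp only: D0_def lowdeg_def)
  have add: "mu (F + G) = vadd (mu F) (mu G)" if "F \<in> Ol" "G \<in> Ol" for F G
    unfolding mu by (rule tau_add) (use that v_in in \<open>auto simp: Ol_def\<close>)
  have scale: "mu (oconst c * F) = vscale c (mu F)" if "F \<in> Ol" for F c
    unfolding mu by (rule tau_scale) (use that v_in in \<open>auto simp: Ol_def\<close>)
  have "inj_on mu Ol"
  proof (rule inj_onI)
    fix F G assume FG: "F \<in> Ol" "G \<in> Ol" "mu F = mu G"
    \<comment> \<open>The difference is written as a sum with a scalar multiple, matching the forms
      in which additivity and scaling of \<open>mu\<close> are available.\<close>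
    have neg: "oconst (- 1) * G \<in> Ol" using FG(2) unfolding Ol_def by (intro Oalg_mult Oalg_oconst)
    have "mu (F + oconst (- 1) * G) = (\<lambda>w. 0)"
      unfolding add[OF FG(1) neg] scale[OF FG(2)] FG(3)
      by (simp add: vadd_def vscale_def zconst_simps)
    then have "F + oconst (- 1) * G = 0"
      unfolding mu by (rule mu_kernel[rotated]) (use FG(1) neg Oalg_add in \<open>auto simp: Ol_def\<close>)
    moreover have "oconst (- 1) * G = - G"
      by (rule poly_mapping_eqI) (simp add: lookup_oconst_mult)
    ultimately show "F = G" by simp
  qed
  moreover have "mu ` Ol = M"
  proof
    show "mu ` Ol \<subseteq> M" using tau_maps v_in by (auto simp: mu M_def Ol_def)
    show "M \<subseteq> mu ` Ol"
    proof
      fix x assume "x \<in> M"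
      then obtain F where "F \<in> Oalg N lam" "tau F v = x" using mu_surj unfolding M_def by blast
      then show "x \<in> mu ` Ol" unfolding Ol_def mu by blast
    qed
  qed
  ultimately have "bij_betw mu Ol M" by (simp add: bij_betw_def)
  moreover have "vhom (d + D0) (mu F)" if "F \<in> Ol" "ohom d F" for F d
    unfolding mu D0 by (rule tau_graded) (use that v_in v_hom in \<open>auto simp: Ol_def\<close>)
  moreover have "mu (F * G) = tau F (mu G)" if "F \<in> Ol" "G \<in> Ol" for F G
    unfolding mu by (rule tau_mult) (use that v_in in \<open>auto simp: Ol_def\<close>)
  ultimately show ?thesis using add scale by blast
qed

end
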